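(* Let $X$ and $B$ be smooth affine algebraic varieties over $\mathbb{C}$, $n=\dim X$, and let $\pi:X\to B$ be a Zariski locally trivial fibration with fiber $Y$ admitting a nontrivial locally nilpotent vector field $\delta$. Let $\alpha_1,\dots,\alpha_k$ be regular functions on $B$ without common zeros such that, for each $i$, $X_i:=X\setminus(\alpha_i\circ\pi)^{-1}(0)$ is naturally isomorphic (over $B_i$) to $B_i\times Y$, where $B_i=B\setminus\alpha_i^{-1}(0)$. Suppose that $\pi$ is equivariant with respect to some actions of a semi-simple group $S$ on $X$ and on $B$. Let $\xi_1,\dots,\xi_k$ be locally nilpotent vector fields on $X$ induced by the actions of one-parameter unipotent subgroups of $S$ such that for each $i$: (i) $\xi_i(\mathbb{C}[B])\subset\mathbb{C}[B]$, i.e. $\xi_i$ induces a locally nilpotent vector field $\xi_i'$ on $B$; (ii) $\alpha_i\in\operatorname{Ker}\xi_i'$, i.e. $\xi_i'$ is locally nilpotent on $B_i$; (iii) $\xi_i'$ admits a slice on $B_i$, that is, $B_i$ is isomorphic to $R_i\times\mathbb{C}$ for some variety $R_i$ so that the $\mathbb{C}_+$-action generated by $\xi_i'$ is the translation on the second factor (in particular $\xi_i'$ is nontrivial). Let $N$ be the $\mathbb{C}[X]$-module generated by $\{\xi_i\}_{i=1}^k$. Suppose that for every $x\in X$ the subspace $N_x$ of $T_xX$ generated by the values of $N$ at $x$ coincides with the subspace generated by the values at $x$ of the fields $\{\xi_j\mid\alpha_j(x)\ne0\}$ (where $\alpha_j$ is viewed as a function on $X$). Let $X$ be equipped with an algebraic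 volume form $\omega$, and let $\eta$ be a nontrivial locally nilpotent vector field on $X$ with $\mathbb{C}[B]\subset\operatorname{Ker}\eta$ generated by $\delta$, i.e. obtained by multiplying the field on $X_1\simeq B_1\times Y$ induced by $\delta$ by a sufficiently high power of $\alpha_1$. Then the set $\mathrm{d}^{-1}(\Theta(\mathrm{Lie}_{alg}^\omega(X)))$ contains a $\mathbb{C}[X]$-submodule of $\mathcal{C}_{n-2}(X)$ that consists of all $(n-2)$-forms that can be presented as $\tau=\iota_\zeta\iota_\eta\omega$ with $\zeta$ running over $JN$ for some nontrivial (i.e. nonzero) ideal $J$ in $\mathbb{C}[X]$.
   Context: All varieties are irreducible; $\mathbb{C}[B]$ is regarded as a subring of $\mathbb{C}[X]$ via $\pi^*$. An algebraic volume form is a nowhere vanishing algebraic top-degree form. $\iota$ denotes the interior product. Vector fields are identified with derivations, and $\operatorname{Ker}$ denotes the kernel in the ring of regular functions. A vector field is complete if it is generated by a holomorphic $\mathbb{C}_+$-action, and locally nilpotent if it is generated by an algebraic $\mathbb{C}_+$-action. $\mathrm{AVF}_\omega(X)$ is the space of algebraic vector fields on $X$ with zero $\omega$-divergence, $\mathrm{IVF}_\omega(X)$ is its subset of complete fields, and $\mathrm{Lie}_{alg}^\omega(X)$ is the Lie algebra generated by $\mathrm{IVF}_\omega(X)$. $\mathcal{C}_k(X)$, $\mathcal{Z}_k(X)$, $\mathcal{B}_k(X)$ denote the spaces of algebraic, closed algebraic, and exact algebraic $k$-forms on $X$. $\Theta:\mathrm{AVF}_\omega(X)\to\mathcal{Z}_{n-1}(X)$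 is the isomorphism $\xi\mapsto\iota_\xi\omega$, and $\mathrm{d}:\mathcal{C}_{n-2}(X)\to\mathcal{B}_{n-1}(X)$ is the exterior differential. *)

theory Defs
  imports
    "HOL-Analysis.Analysis"
    "HOL-Computational_Algebra.Polynomial"
    "HOL-Algebra.Group_Action"
    "HOL-Algebra.Solvable_Groups"
    "HOL-Library.Function_Algebras"
begin

text \<open>The vector space operations on complex-valued functions are pointwise. They are used on
  point derivations, i.e. on complex-valued functions of a regular function.\<close>

global_interpretation cfun: vector_space "\<lambda>(c::complex) (v::'b \<Rightarrow> complex) x. c * v x"
  defines cfun_span = cfun.span and cfun_dim = cfun.dim
  by unfold_locales (auto simp: fun_eq_iff algebra_simps)


section \<open>Affine varieties\<close>

text \<open>An affine variety is a set of points together with its ring of regular functions. A regular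
  function is represented by a total function that vanishes outside the set of points, so that
  equality of regular functions is equality in HOL.\<close>

record 'a variety =
  points :: "'a set"
  funs :: "('a \<Rightarrow> complex) set"

text \<open>\<open>affine_space m\<close> is \<open>m\<close>-dimensional affine space; polynomial functions on it are restrictions
  of polynomials in finitely many of the variables \<open>w 0, w 1, \<dots>\<close>.\<close>

definition affine_space :: "nat \<Rightarrow> (nat \<Rightarrow> complex) set" where
  "affine_space m = {w. \<forall>i\<ge>m. w i = 0}"

inductive_set poly_funs :: "((nat \<Rightarrow> complex) \<Rightarrow> complex) set" where
  const: "(\<lambda>w. c) \<in> poly_funs"
| coord: "(\<lambda>w. w i) \<in> poly_funs"
| add: "p \<in> poly_funs \<Longrightarrow> q \<in> poly_funs \<Longrightarrow> p + q \<in> poly_funs"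
| mult: "p \<in> poly_funs \<Longrightarrow> q \<in> poly_funs \<Longrightarrow> p * q \<in> poly_funs"

definition algebraic_set :: "nat \<Rightarrow> (nat \<Rightarrow> complex) set \<Rightarrow> bool" where
  "algebraic_set m Z \<longleftrightarrow>
     (\<exists>P \<subseteq> poly_funs. Z = {w \<in> affine_space m. \<forall>p\<in>P. p w = 0})"

definition zariski_closed :: "'a variety \<Rightarrow> 'a set \<Rightarrow> bool" where
  "zariski_closed X Z \<longleftrightarrow> (\<exists>F \<subseteq> funs X. Z = {x \<in> points X. \<forall>f\<in>F. f x = 0})"

definition zariski_irreducible :: "'a variety \<Rightarrow> 'a set \<Rightarrow> bool" where
  "zariski_irreducible X Z \<longleftrightarrow> Z \<noteq> {} \<and>
     (\<forall>F G. zariski_closed X F \<and> zariski_closed X G \<and> Z \<subseteq> F \<union> G \<longrightarrow> Z \<subseteq> F \<or> Z \<subseteq> G)"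

definition zariski_connected :: "'a variety \<Rightarrow> 'a set \<Rightarrow> bool" where
  "zariski_connected X Z \<longleftrightarrow> \<not> (\<exists>F G. zariski_closed X F \<and> zariski_closed X G \<and> Z \<subseteq> F \<union> G \<and>
     Z \<inter> F \<noteq> {} \<and> Z \<inter> G \<noteq> {} \<and> Z \<inter> F \<inter> G = {})"

text \<open>\<open>X\<close> is identified by \<open>z\<close> with a closed subset of some affine space, together with its
  coordinate ring; varieties are irreducible.\<close>

definition affine_variety :: "'a variety \<Rightarrow> bool" where
  "affine_variety X \<longleftrightarrow>
     (\<exists>m z. inj_on z (points X) \<and> algebraic_set m (z ` points X) \<and>
        funs X = {(\<lambda>x. if x \<in> points X then p (z x) else 0) | p. p \<in> poly_funs}) \<and>
     zariski_irreducible X (points X)"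

text \<open>Krull dimension: the maximal length of a chain of irreducible closed subsets.\<close>

definition variety_dim :: "'a variety \<Rightarrow> nat" where
  "variety_dim X = (GREATEST n. \<exists>Z :: nat \<Rightarrow> 'a set.
     (\<forall>i\<le>n. zariski_closed X (Z i) \<and> zariski_irreducible X (Z i)) \<and> (\<forall>i<n. Z i \<subset> Z (Suc i)))"

text \<open>Tangent vectors are point derivations; they are extended by 0 to non-regular functions.\<close>

definition tangent_space :: "'a variety \<Rightarrow> 'a \<Rightarrow> (('a \<Rightarrow> complex) \<Rightarrow> complex) set" where
  "tangent_space X x = {v.
     (\<forall>f\<in>funs X. \<forall>g\<in>funs X. v (f + g) = v f + v g \<and> v (f * g) = f x * v g + g x * v f) \<and>
     (\<forall>c. \<forall>f\<in>funs X. v (\<lambda>y. c * f y) = c * v f) \<and>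
     (\<forall>f. f \<notin> funs X \<longrightarrow> v f = 0)}"

definition smooth_variety :: "'a variety \<Rightarrow> bool" where
  "smooth_variety X \<longleftrightarrow> (\<forall>x\<in>points X. cfun_dim (tangent_space X x) = variety_dim X)"

definition affine_line :: "complex variety" where
  "affine_line = \<lparr>points = UNIV, funs = range poly\<rparr>"

definition prod_variety :: "'a variety \<Rightarrow> 'b variety \<Rightarrow> ('a \<times> 'b) variety" where
  "prod_variety X Y = \<lparr>points = points X \<times> points Y,
     funs = {(\<lambda>(x, y). \<Sum>i<m. f i x * g i y) | (m::nat) f g.
               \<forall>i<m. f i \<in> funs X \<and> g i \<in> funs Y}\<rparr>"

definition principal_open :: "'a variety \<Rightarrow> ('a \<Rightarrow> complex) \<Rightarrow> 'a variety" where
  "principal_open X h = \<lparr>points = {x \<in> points X. h x \<noteq> 0},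
     funs = {(\<lambda>x. if x \<in> points X \<and> h x \<noteq> 0 then f x / h x ^ m else 0) | f (m::nat). f \<in> funs X}\<rparr>"

definition restrict_fun :: "'a variety \<Rightarrow> ('a \<Rightarrow> complex) \<Rightarrow> 'a \<Rightarrow> complex" where
  "restrict_fun X f = (\<lambda>x. if x \<in> points X then f x else 0)"

definition pullback :: "'a variety \<Rightarrow> ('a \<Rightarrow> 'b) \<Rightarrow> ('b \<Rightarrow> complex) \<Rightarrow> 'a \<Rightarrow> complex" where
  "pullback X \<phi> f = restrict_fun X (f \<circ> \<phi>)"

definition regular_map :: "'a variety \<Rightarrow> 'b variety \<Rightarrow> ('a \<Rightarrow> 'b) \<Rightarrow> bool" where
  "regular_map X Y \<phi> \<longleftrightarrow> \<phi> ` points X \<subseteq> points Y \<and> (\<forall>f\<in>funs Y. pullback X \<phi> f \<in> funs X)"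

definition variety_iso :: "'a variety \<Rightarrow> 'b variety \<Rightarrow> ('a \<Rightarrow> 'b) \<Rightarrow> bool" where
  "variety_iso X Y \<phi> \<longleftrightarrow> bij_betw \<phi> (points X) (points Y) \<and>
     regular_map X Y \<phi> \<and> regular_map Y X (inv_into (points X) \<phi>)"

definition trivialization ::
  "'a variety \<Rightarrow> 'b variety \<Rightarrow> ('a \<Rightarrow> 'b) \<Rightarrow> 'y variety \<Rightarrow> ('b \<Rightarrow> complex) \<Rightarrow> ('a \<Rightarrow> 'b \<times> 'y) \<Rightarrow> bool"
where
  "trivialization X B \<pi> Y h \<phi> \<longleftrightarrow>
     variety_iso (principal_open X (pullback X \<pi> h)) (prod_variety (principal_open B h) Y) \<phi> \<and>
     (\<forall>x \<in> points (principal_open X (pullback X \<pi> h)). fst (\<phi> x) = \<pi> x)"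

text \<open>The trivializing open sets may be taken principal, as these form a basis of the topology.\<close>

definition zariski_locally_trivial ::
  "'a variety \<Rightarrow> 'b variety \<Rightarrow> ('a \<Rightarrow> 'b) \<Rightarrow> 'y variety \<Rightarrow> bool" where
  "zariski_locally_trivial X B \<pi> Y \<longleftrightarrow> regular_map X B \<pi> \<and>
     (\<forall>b\<in>points B. \<exists>h\<in>funs B. h b \<noteq> 0 \<and> (\<exists>\<phi>. trivialization X B \<pi> Y h \<phi>))"


section \<open>Holomorphic maps\<close>

text \<open>Holomorphic functions of several variables: continuous and holomorphic in each variable. The
  topology on \<open>nat \<Rightarrow> complex\<close> is the product topology, which induces the Euclidean topology on
  every \<open>affine_space m\<close>.\<close>

definition holomorphic_several ::
  "(nat \<Rightarrow> complex) set \<Rightarrow> ((nat \<Rightarrow> complex) \<Rightarrow> complex) \<Rightarrow> bool" where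
  "holomorphic_several W H \<longleftrightarrow> open W \<and> continuous_on W H \<and>
     (\<forall>w\<in>W. \<forall>i. (\<lambda>t. H (w(i := t))) holomorphic_on {t. w(i := t) \<in> W})"

text \<open>A function on an affine variety is holomorphic if it is locally, in the classical topology,
  a holomorphic function of finitely many regular functions.\<close>

definition holomorphic_function :: "'a variety \<Rightarrow> ('a \<Rightarrow> complex) \<Rightarrow> bool" where
  "holomorphic_function X h \<longleftrightarrow> (\<forall>x\<in>points X. \<exists>m (z :: nat \<Rightarrow> 'a \<Rightarrow> complex) W H.
     (\<forall>i<m. z i \<in> funs X) \<and> holomorphic_several W H \<and>
     (\<lambda>i. if i < m then z i x else 0) \<in> W \<and>
     (\<forall>y\<in>points X. (\<lambda>i. if i < m then z i y else 0) \<in> W \<longrightarrow>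
        h y = H (\<lambda>i. if i < m then z i y else 0)))"

definition holomorphic_map :: "'a variety \<Rightarrow> 'b variety \<Rightarrow> ('a \<Rightarrow> 'b) \<Rightarrow> bool" where
  "holomorphic_map X Y \<phi> \<longleftrightarrow>
     \<phi> ` points X \<subseteq> points Y \<and> (\<forall>f\<in>funs Y. holomorphic_function X (f \<circ> \<phi>))"


section \<open>Algebraic vector fields\<close>

type_synonym 'a vfield = "('a \<Rightarrow> complex) \<Rightarrow> 'a \<Rightarrow> complex"

text \<open>Derivations of the ring of regular functions, extended by 0 to non-regular functions.\<close>

definition vector_fields :: "'a variety \<Rightarrow> 'a vfield set" where
  "vector_fields X = {D.
     (\<forall>f\<in>funs X. D f \<in> funs X) \<and>
     (\<forall>f\<in>funs X. \<forall>g\<in>funs X. D (f + g) = D f + D g \<and> D (f * g) = f * D g + g * D f) \<and>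
     (\<forall>c. \<forall>f\<in>funs X. D (\<lambda>x. c * f x) = (\<lambda>x. c * D f x)) \<and>
     (\<forall>f. f \<notin> funs X \<longrightarrow> D f = 0)}"

definition value_at :: "'a \<Rightarrow> 'a vfield \<Rightarrow> ('a \<Rightarrow> complex) \<Rightarrow> complex" where
  "value_at x D = (\<lambda>f. D f x)"

definition bracket :: "'a vfield \<Rightarrow> 'a vfield \<Rightarrow> 'a vfield" where
  "bracket D E = (\<lambda>f. D (E f) - E (D f))"

definition additive_action :: "'a variety \<Rightarrow> (complex \<Rightarrow> 'a \<Rightarrow> 'a) \<Rightarrow> bool" where
  "additive_action X \<Phi> \<longleftrightarrow>
     (\<forall>x\<in>points X. (\<forall>t. \<Phi> t x \<in> points X) \<and> \<Phi> 0 x = x \<and> (\<forall>s t. \<Phi> (s + t) x = \<Phi> s (\<Phi> t x)))"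

definition algebraic_additive_action :: "'a variety \<Rightarrow> (complex \<Rightarrow> 'a \<Rightarrow> 'a) \<Rightarrow> bool" where
  "algebraic_additive_action X \<Phi> \<longleftrightarrow> additive_action X \<Phi> \<and>
     regular_map (prod_variety affine_line X) X (\<lambda>(t, x). \<Phi> t x)"

definition holomorphic_additive_action :: "'a variety \<Rightarrow> (complex \<Rightarrow> 'a \<Rightarrow> 'a) \<Rightarrow> bool" where
  "holomorphic_additive_action X \<Phi> \<longleftrightarrow> additive_action X \<Phi> \<and>
     holomorphic_map (prod_variety affine_line X) X (\<lambda>(t, x). \<Phi> t x)"

definition generated_by_action :: "'a variety \<Rightarrow> (complex \<Rightarrow> 'a \<Rightarrow> 'a) \<Rightarrow> 'a vfield \<Rightarrow> bool" where
  "generated_by_action X \<Phi> D \<longleftrightarrow>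
     (\<forall>f\<in>funs X. \<forall>x\<in>points X. ((\<lambda>t. f (\<Phi> t x)) has_field_derivative D f x) (at 0))"

definition complete_field :: "'a variety \<Rightarrow> 'a vfield \<Rightarrow> bool" where
  "complete_field X D \<longleftrightarrow> D \<in> vector_fields X \<and>
     (\<exists>\<Phi>. holomorphic_additive_action X \<Phi> \<and> generated_by_action X \<Phi> D)"

definition locally_nilpotent :: "'a variety \<Rightarrow> 'a vfield \<Rightarrow> bool" where
  "locally_nilpotent X D \<longleftrightarrow> D \<in> vector_fields X \<and>
     (\<exists>\<Phi>. algebraic_additive_action X \<Phi> \<and> generated_by_action X \<Phi> D)"

text \<open>The field \<open>D'\<close> below is the restriction of \<open>D\<close> to the principal open subset. The variety
  \<open>R\<close> ranges over one type, in which every affine variety has an isomorphic copy.\<close>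

definition admits_slice_on :: "'a variety \<Rightarrow> ('a \<Rightarrow> complex) \<Rightarrow> 'a vfield \<Rightarrow> bool" where
  "admits_slice_on X h D \<longleftrightarrow> (\<exists>D' \<Phi> (R :: (nat \<Rightarrow> complex) variety) \<psi>.
     D' \<in> vector_fields (principal_open X h) \<and>
     (\<forall>f\<in>funs X. D' (restrict_fun (principal_open X h) f) =
                  restrict_fun (principal_open X h) (D f)) \<and>
     algebraic_additive_action (principal_open X h) \<Phi> \<and>
     generated_by_action (principal_open X h) \<Phi> D' \<and>
     affine_variety R \<and>
     variety_iso (principal_open X h) (prod_variety R affine_line) \<psi> \<and>
     (\<forall>t. \<forall>x\<in>points (principal_open X h). \<psi> (\<Phi> t x) = (fst (\<psi> x), snd (\<psi> x) + t)))"

text \<open>If \<open>\<phi>\<close> identifies \<open>V\<close> with a product whose second factor is \<open>Y\<close>, this is the vector field on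
  \<open>V\<close> that is tangent to the fibres \<open>{b} \<times> Y\<close> and equal to \<open>\<delta>\<close> on each of them.\<close>

definition induced_fibre_field ::
  "'a variety \<Rightarrow> 'y variety \<Rightarrow> ('a \<Rightarrow> 'b \<times> 'y) \<Rightarrow> 'y vfield \<Rightarrow> 'a vfield" where
  "induced_fibre_field V Y \<phi> \<delta> f = (\<lambda>x.
     \<delta> (restrict_fun Y (\<lambda>y. f (inv_into (points V) \<phi> (fst (\<phi> x), y)))) (snd (\<phi> x)))"

text \<open>Finite sums of products \<open>a D\<close> with \<open>a \<in> A\<close> and \<open>D \<in> G\<close>. For \<open>A\<close> the ring of regular functions
  this is the module generated by \<open>G\<close>; for an ideal \<open>A\<close> and a module \<open>G\<close> it is the product \<open>A G\<close>.\<close>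

inductive_set field_span :: "('a \<Rightarrow> complex) set \<Rightarrow> 'a vfield set \<Rightarrow> 'a vfield set"
  for A :: "('a \<Rightarrow> complex) set" and G :: "'a vfield set" where
  zero: "0 \<in> field_span A G"
| add: "a \<in> A \<Longrightarrow> D \<in> G \<Longrightarrow> E \<in> field_span A G \<Longrightarrow> (\<lambda>f. a * D f) + E \<in> field_span A G"

inductive_set lie_generated :: "'a vfield set \<Rightarrow> 'a vfield set" for G :: "'a vfield set" where
  gen: "D \<in> G \<Longrightarrow> D \<in> lie_generated G"
| zero: "0 \<in> lie_generated G"
| add: "D \<in> lie_generated G \<Longrightarrow> E \<in> lie_generated G \<Longrightarrow> D + E \<in> lie_generated G"
| scale: "D \<in> lie_generated G \<Longrightarrow> (\<lambda>f x. c * D f x) \<in> lie_generated G"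
| bracket: "D \<in> lie_generated G \<Longrightarrow> E \<in> lie_generated G \<Longrightarrow> bracket D E \<in> lie_generated G"

definition ideal_of :: "'a variety \<Rightarrow> ('a \<Rightarrow> complex) set \<Rightarrow> bool" where
  "ideal_of X J \<longleftrightarrow> J \<subseteq> funs X \<and> 0 \<in> J \<and> (\<forall>f\<in>J. \<forall>g\<in>J. f + g \<in> J) \<and>
     (\<forall>a\<in>funs X. \<forall>f\<in>J. a * f \<in> J)"


section \<open>Algebraic differential forms\<close>

text \<open>On a smooth affine variety the algebraic \<open>k\<close>-forms are the alternating \<open>k\<close>-linear maps, over
  the ring of regular functions, from vector fields to regular functions. The arguments are given
  as a list; the value is 0 on lists of another length or with entries that are no vector fields.\<close>

type_synonym 'a form = "'a vfield list \<Rightarrow> 'a \<Rightarrow> complex"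

definition forms :: "'a variety \<Rightarrow> nat \<Rightarrow> 'a form set" where
  "forms X k = {\<tau>.
     (\<forall>vs. length vs = k \<and> set vs \<subseteq> vector_fields X \<longrightarrow> \<tau> vs \<in> funs X) \<and>
     (\<forall>vs. \<not> (length vs = k \<and> set vs \<subseteq> vector_fields X) \<longrightarrow> \<tau> vs = 0) \<and>
     (\<forall>us ws. \<forall>D\<in>vector_fields X. \<forall>E\<in>vector_fields X. \<forall>a\<in>funs X.
        set us \<subseteq> vector_fields X \<and> set ws \<subseteq> vector_fields X \<longrightarrow>
        \<tau> (us @ (D + E) # ws) = \<tau> (us @ D # ws) + \<tau> (us @ E # ws) \<and>
        \<tau> (us @ (\<lambda>f. a * D f) # ws) = a * \<tau> (us @ D # ws)) \<and>
     (\<forall>vs. \<not> distinct vs \<longrightarrow> \<tau> vs = 0)}"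

definition nowhere_vanishing :: "'a variety \<Rightarrow> 'a form \<Rightarrow> bool" where
  "nowhere_vanishing X \<tau> \<longleftrightarrow> (\<forall>x\<in>points X. \<exists>vs. set vs \<subseteq> vector_fields X \<and> \<tau> vs x \<noteq> 0)"

definition volume_form :: "'a variety \<Rightarrow> 'a form \<Rightarrow> bool" where
  "volume_form X \<omega> \<longleftrightarrow> \<omega> \<in> forms X (variety_dim X) \<and> nowhere_vanishing X \<omega>"

definition interior_product :: "'a vfield \<Rightarrow> 'a form \<Rightarrow> 'a form" where
  "interior_product D \<tau> = (\<lambda>vs. \<tau> (D # vs))"

definition del_nth :: "nat \<Rightarrow> 'c list \<Rightarrow> 'c list" where
  "del_nth i vs = take i vs @ drop (Suc i) vs"

text \<open>Exterior differential by the Koszul formula; \<open>del_nth\<close> removes one argument of the form.\<close>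

definition ext_d :: "'a variety \<Rightarrow> 'a form \<Rightarrow> 'a form" where
  "ext_d X \<tau> = (\<lambda>vs x. if set vs \<subseteq> vector_fields X then
       (\<Sum>i<length vs. (-1) ^ i * (vs ! i) (\<tau> (del_nth i vs)) x) +
       (\<Sum>j<length vs. \<Sum>i<j. (-1) ^ (i + j) *
          \<tau> (bracket (vs ! i) (vs ! j) # del_nth i (del_nth j vs)) x)
     else 0)"

definition lie_derivative :: "'a variety \<Rightarrow> 'a vfield \<Rightarrow> 'a form \<Rightarrow> 'a form" where
  "lie_derivative X D \<tau> = (\<lambda>vs x. if set vs \<subseteq> vector_fields X then
       D (\<tau> vs) x - (\<Sum>i<length vs. \<tau> (vs[i := bracket D (vs ! i)]) x)
     else 0)"

definition has_divergence ::
  "'a variety \<Rightarrow> 'a form \<Rightarrow> 'a vfield \<Rightarrow> ('a \<Rightarrow> complex) \<Rightarrow> bool" where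
  "has_divergence X \<omega> D g \<longleftrightarrow> g \<in> funs X \<and> lie_derivative X D \<omega> = (\<lambda>vs. g * \<omega> vs)"

definition AVF :: "'a variety \<Rightarrow> 'a form \<Rightarrow> 'a vfield set" where
  "AVF X \<omega> = {D \<in> vector_fields X. has_divergence X \<omega> D 0}"

definition IVF :: "'a variety \<Rightarrow> 'a form \<Rightarrow> 'a vfield set" where
  "IVF X \<omega> = {D \<in> AVF X \<omega>. complete_field X D}"

definition Lie_alg :: "'a variety \<Rightarrow> 'a form \<Rightarrow> 'a vfield set" where
  "Lie_alg X \<omega> = lie_generated (IVF X \<omega>)"

definition Theta :: "'a form \<Rightarrow> 'a vfield \<Rightarrow> 'a form" where
  "Theta \<omega> D = interior_product D \<omega>"

definition form_submodule :: "'a variety \<Rightarrow> nat \<Rightarrow> 'a form set \<Rightarrow> bool" where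
  "form_submodule X k M \<longleftrightarrow> M \<subseteq> forms X k \<and> 0 \<in> M \<and> (\<forall>\<sigma>\<in>M. \<forall>\<tau>\<in>M. \<sigma> + \<tau> \<in> M) \<and>
     (\<forall>a\<in>funs X. \<forall>\<tau>\<in>M. (\<lambda>vs. a * \<tau> vs) \<in> M)"


section \<open>Algebraic groups\<close>

text \<open>Connectedness of the group is part of \<^term>\<open>affine_variety\<close>.\<close>

definition linear_algebraic_group :: "('s, 'm) monoid_scheme \<Rightarrow> 's variety \<Rightarrow> bool" where
  "linear_algebraic_group S V \<longleftrightarrow> group S \<and> affine_variety V \<and> points V = carrier S \<and>
     regular_map (prod_variety V V) V (\<lambda>(g, h). g \<otimes>\<^bsub>S\<^esub> h) \<and>
     regular_map V V (\<lambda>g. inv\<^bsub>S\<^esub> g)"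

text \<open>Semi-simple: the radical, i.e. the largest connected solvable closed normal subgroup, is
  trivial.\<close>

definition semisimple_group :: "('s, 'm) monoid_scheme \<Rightarrow> 's variety \<Rightarrow> bool" where
  "semisimple_group S V \<longleftrightarrow> linear_algebraic_group S V \<and>
     (\<forall>H. H \<lhd> S \<and> zariski_closed V H \<and> zariski_connected V H \<and> solvable (S\<lparr>carrier := H\<rparr>) \<longrightarrow>
          H = {\<one>\<^bsub>S\<^esub>})"

definition algebraic_group_action ::
  "('s, 'm) monoid_scheme \<Rightarrow> 's variety \<Rightarrow> 'a variety \<Rightarrow> ('s \<Rightarrow> 'a \<Rightarrow> 'a) \<Rightarrow> bool" where
  "algebraic_group_action S V X \<sigma> \<longleftrightarrow> group_action S (points X) \<sigma> \<and>
     regular_map (prod_variety V X) X (\<lambda>(g, x). \<sigma> g x)"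

text \<open>A one-parameter unipotent subgroup, given by its parametrization by the additive group.\<close>

definition unipotent_subgroup ::
  "('s, 'm) monoid_scheme \<Rightarrow> 's variety \<Rightarrow> (complex \<Rightarrow> 's) \<Rightarrow> bool" where
  "unipotent_subgroup S V u \<longleftrightarrow>
     regular_map affine_line V u \<and> inj u \<and> (\<forall>s t. u (s + t) = u s \<otimes>\<^bsub>S\<^esub> u t)"

end

theory Submission
  imports Defs "HOL-Computational_Algebra.Fundamental_Theorem_Algebra"
begin

text \<open>
  If \<open>a\<close> and \<open>b\<close> have divergence zero, then \<open>d \<iota>\<^sub>a \<iota>\<^sub>b \<omega> = \<iota>\<^bsub>[a,b]\<^esub> \<omega>\<close>. So
  \<open>\<iota>\<^sub>a \<iota>\<^sub>b \<omega>\<close> lies in \<open>L = d\<^sup>-\<^sup>1(\<Theta>(Lie))\<close> whenever \<open>a\<close> and \<open>b\<close> lie in \<open>Lie\<close>, for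
  instance when they are replicas \<open>f \<xi>\<close>, \<open>f \<in> Ker \<xi>\<close>, of locally nilpotent fields: these are
  complete, and their divergence vanishes. For \<open>\<xi> = \<xi>\<^sub>j\<close> let \<open>E\<^sub>j\<close> be the span of
  \<open>Ker \<xi>\<^sub>j \<cdot> Ker \<eta>\<close>. Then \<open>L\<close> contains \<open>E\<^sub>j \<iota>\<^sub>\<xi> \<iota>\<^sub>\<eta> \<omega>\<close>, and \<open>Lie\<close> contains the fields
  \<open>curl e = \<xi>(e) \<eta> - \<eta>(e) \<xi> + e [\<xi>,\<eta>]\<close> with \<open>e \<in> E\<^sub>j\<close>.

  Now fix \<open>z = \<xi>\<^sub>i\<close>. If \<open>\<beta> \<in> Ker z\<close> and \<open>e, \<beta> e \<in> E\<^sub>j\<close>, comparing the pairs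
  \<open>(\<beta> z, curl e)\<close> and \<open>(z, curl (\<beta> e))\<close> shows that \<open>L\<close> contains
  \<open>e (\<xi>(\<beta>) \<iota>\<^sub>z \<iota>\<^sub>\<eta> - \<eta>(\<beta>) \<iota>\<^sub>z \<iota>\<^sub>\<xi>) \<omega>\<close>. Two functions \<open>\<beta>\<close> eliminate the second term, unless
  \<open>\<xi>\<close>, \<open>\<eta>\<close>, \<open>z\<close> are linearly dependent, and then \<open>\<iota>\<^sub>\<xi> \<iota>\<^sub>\<eta> \<omega>\<close> and \<open>\<iota>\<^sub>z \<iota>\<^sub>\<eta> \<omega>\<close> are
  proportional. Either way \<open>p\<^sub>j E\<^sub>j \<iota>\<^sub>z \<iota>\<^sub>\<eta> \<omega> \<subseteq> L\<close> for some \<open>p\<^sub>j \<noteq> 0\<close>.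

  The slices are functions on \<open>B\<close>, hence lie in \<open>Ker \<eta>\<close>. So every regular function lies in \<open>E\<^sub>j\<close>
  after multiplication by a high power of \<open>\<alpha>\<^sub>j\<close>. As the \<open>\<alpha>\<^sub>j\<close> have no common zeros, their powers
  generate the unit ideal of \<open>\<complex>[B]\<close>, and therefore \<open>L\<close> contains \<open>p\<^sub>1 \<cdots> p\<^sub>k f \<iota>\<^sub>z \<iota>\<^sub>\<eta> \<omega>\<close> for
  every regular function \<open>f\<close> on \<open>X\<close>.
\<close>

text \<open>\<open>L\<close> is a vector space but not a priori a
  \<open>\<complex>[X]\<close>-module, so no step may multiply a form in \<open>L\<close> by an
  arbitrary regular function. What can be multiplied is the coefficient \<open>e\<close>, and only
  within the ring \<open>E\<^sub>j\<close>. The comparison of pairs rests on \<open>curl (\<beta> e)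
  = \<beta> curl e + e (\<xi>(\<beta>) \<eta> - \<eta>(\<beta>) \<xi>)\<close>: the terms with
  \<open>curl e\<close>, which differentiate \<open>e\<close>, cancel, and the rest is linear in
  \<open>e\<close> over functions. So the coefficients of an elimination can be put into
  \<open>e\<close>, once a power of the derivative of a slice has brought them into
  \<open>E\<^sub>j\<close>. The order of choices is essential. The factor \<open>p\<^sub>j\<close>
  depends on \<open>j\<close> and \<open>z\<close> alone, while the power of
  \<open>\<alpha>\<^sub>j\<close> that brings a function into \<open>E\<^sub>j\<close> depends on
  this function. So the partition of unity comes last, for powers fitted to the function at hand;
  its coefficients lie in \<open>\<complex>[B]\<close>, hence in \<open>Ker \<eta>\<close>, and
  multiplying by them does not leave \<open>E\<^sub>j\<close>. That locally nilpotent fields have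
  divergence zero is shown algebraically, from orders of nilpotency and the Nullstellensatz.\<close>

lemma fun_sum_apply: "(\<Sum>i\<in>I. F i) x = (\<Sum>i\<in>I. F i x)"
  by (induction I rule: infinite_finite_induct) auto

lemma fun_power_apply: "(F ^ n) x = F x ^ n"
  by (induction n) auto

text \<open>Scalar multiples become products in the ring of all functions. \<open>const c\<close>
  does not vanish outside the points of a variety, so in general it is not regular.\<close>

definition const :: "complex \<Rightarrow> 'a \<Rightarrow> complex" where
  "const c = (\<lambda>_. c)"

lemma const_apply [simp]: "const c x = c"
  by (simp add: const_def)

text \<open>The unit of \<open>funs X\<close>; as regular functions vanish outside the points, the
  constant 1 cannot play this role in general.\<close>

definition one_of :: "'a variety \<Rightarrow> 'a \<Rightarrow> complex" where
  "one_of X = (\<lambda>x. if x \<in> points X then 1 else 0)"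

section \<open>Coordinate rings and the Nullstellensatz\<close>

text \<open>A countable set has countably many finite subsets. Every element of \<open>U\<close>
  lies in the span of one of them, and by independence each of these spans contains only finitely
  many elements of \<open>U\<close>.\<close>

lemma cfun_independent_countable:
  assumes ind: "cfun.independent U" and sub: "U \<subseteq> cfun.span M" and M: "countable M"
  shows "countable U"
proof -
  have "U \<subseteq> (\<Union>F\<in>{F. F \<subseteq> M \<and> finite F}. {u\<in>U. u \<in> cfun.span F})"
  proof
    fix u assume "u \<in> U"
    with sub have "u \<in> cfun.span M" by auto
    then obtain t r where t: "finite t" "t \<subseteq> M" "(\<Sum>a\<in>t. (\<lambda>x. r a * a x)) = u"
      unfolding cfun.span_explicit by auto
    then have "u \<in> cfun.span t"
      unfolding cfun.span_explicit by auto
    with t \<open>u \<in> U\<close> show "u \<in> (\<Union>F\<in>{F. F \<subseteq> M \<and> finite F}. {u\<in>U. u \<in> cfun.span F})" by blast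
  qed
  moreover have "countable (\<Union>F\<in>{F. F \<subseteq> M \<and> finite F}. {u\<in>U. u \<in> cfun.span F})"
  proof (rule countable_UN)
    show "countable {F. F \<subseteq> M \<and> finite F}"
      using M countable_Collect_finite_subset[of M] by (simp add: conj_commute)
    fix F assume "F \<in> {F. F \<subseteq> M \<and> finite F}"
    moreover have "cfun.independent {u\<in>U. u \<in> cfun.span F}"
      using ind by (rule cfun.independent_mono) auto
    ultimately have "finite {u\<in>U. u \<in> cfun.span F}"
      using cfun.independent_span_bound[of F "{u\<in>U. u \<in> cfun.span F}"] by auto
    then show "countable {u\<in>U. u \<in> cfun.span F}" by (rule countable_finite)
  qed
  ultimately show ?thesis by (rule countable_subset)
qed

lemma poly_funs_scale:
  assumes "p \<in> poly_funs" shows "(\<lambda>w. c * p w) \<in> poly_funs"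
proof -
  have "(\<lambda>w. c) * p \<in> poly_funs" by (intro poly_funs.intros assms)
  then show ?thesis by (simp add: times_fun_def)
qed

text \<open>A monomial is given by the list of its variables with repetitions: countability is that
  of lists of numbers, and multiplication is concatenation.\<close>

definition monomials :: "((nat \<Rightarrow> complex) \<Rightarrow> complex) set" where
  "monomials = range (\<lambda>l w. prod_list (map w l))"

lemma countable_monomials: "countable monomials"
  by (simp add: monomials_def)

lemma poly_funs_span_monomials: "poly_funs \<subseteq> cfun.span monomials"
proof
  fix p :: "(nat \<Rightarrow> complex) \<Rightarrow> complex"
  assume "p \<in> poly_funs"
  then show "p \<in> cfun.span monomials"
  proof induction
    case (const c)
    have "(\<lambda>w. prod_list (map w [])) \<in> monomials" unfolding monomials_def by blast
    from cfun.span_scale[OF cfun.span_base[OF this], of c] show ?case by simp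
  next
    case (coord i)
    have "(\<lambda>w. prod_list (map w [i])) \<in> monomials" unfolding monomials_def by blast
    from cfun.span_base[OF this] show ?case by simp
  next
    case (add p q)
    then show ?case by (rule_tac cfun.span_add)
  next
    case (mult p q)
    have mon: "m * m' \<in> monomials" if "m \<in> monomials" "m' \<in> monomials" for m m'
    proof -
      from that obtain l l' where "m = (\<lambda>w. prod_list (map w l))" "m' = (\<lambda>w. prod_list (map w l'))"
        unfolding monomials_def by blast
      then have "m * m' = (\<lambda>w. prod_list (map w (l @ l')))" by (auto simp: fun_eq_iff)
      then show ?thesis unfolding monomials_def by blast
    qed
    have 1: "m * q \<in> cfun.span monomials" if "m \<in> monomials" "q \<in> cfun.span monomials" for m q
      using that(2)
    proof (induction rule: cfun.span_induct_alt)
      case base then show ?case using cfun.span_zero by (simp add: zero_fun_def)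
    next
      case (step c x y)
      have "m * ((\<lambda>z. c * x z) + y) = (\<lambda>z. c * (m * x) z) + m * y"
        by (auto simp: fun_eq_iff algebra_simps)
      moreover have "(\<lambda>z. c * (m * x) z) \<in> cfun.span monomials"
        using mon[OF that(1) step(1)] by (intro cfun.span_scale cfun.span_base)
      ultimately show ?case using step(2) by (simp only: cfun.span_add)
    qed
    show ?case
      using mult.IH(1)
    proof (induction rule: cfun.span_induct_alt)
      case base then show ?case using cfun.span_zero by (simp add: zero_fun_def)
    next
      case (step c x y)
      have "((\<lambda>z. c * x z) + y) * q = (\<lambda>z. c * (x * q) z) + y * q"
        by (auto simp: fun_eq_iff algebra_simps)
      moreover have "(\<lambda>z. c * (x * q) z) \<in> cfun.span monomials"
        using 1[OF step(1) mult.IH(2)] by (intro cfun.span_scale)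
      ultimately show ?case using step(2) by (simp only: cfun.span_add)
    qed
  qed
qed

section \<open>Regular functions on an affine variety\<close>

locale affine_var =
  fixes X :: "'a variety"
  assumes aff: "affine_variety X"
begin

lemma coordinates:
  obtains m z where "inj_on z (points X)" "algebraic_set m (z ` points X)"
    "funs X = {(\<lambda>x. if x \<in> points X then p (z x) else 0) | p. p \<in> poly_funs}"
  using aff unfolding affine_variety_def by blast

lemma funs_conv:
  obtains z where "funs X = {(\<lambda>x. if x \<in> points X then p (z x) else 0) | p. p \<in> poly_funs}"
  by (rule coordinates)

lemma points_nonempty: "points X \<noteq> {}"
  using aff unfolding affine_variety_def zariski_irreducible_def by blast

lemma funs_outside: "f \<in> funs X \<Longrightarrow> x \<notin> points X \<Longrightarrow> f x = 0"
  by (rule funs_conv) auto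

lemma funs_eqI:
  "f \<in> funs X \<Longrightarrow> g \<in> funs X \<Longrightarrow> (\<And>x. x \<in> points X \<Longrightarrow> f x = g x) \<Longrightarrow> f = g"
  using funs_outside by (metis ext)

lemma one_of_funs [simp, intro]: "one_of X \<in> funs X"
proof -
  obtain z where e: "funs X = {(\<lambda>x. if x \<in> points X then p (z x) else 0) | p. p \<in> poly_funs}"
    by (rule funs_conv)
  show ?thesis unfolding one_of_def e
    by (intro CollectI exI[of _ "\<lambda>w. 1"] conjI poly_funs.const) simp
qed

lemma funs_add [simp, intro]: assumes "f \<in> funs X" "g \<in> funs X" shows "f + g \<in> funs X"
proof -
  obtain z where e: "funs X = {(\<lambda>x. if x \<in> points X then p (z x) else 0) | p. p \<in> poly_funs}"
    by (rule funs_conv)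
  then obtain p q where "p \<in> poly_funs" "q \<in> poly_funs"
    "f = (\<lambda>x. if x \<in> points X then p (z x) else 0)" "g = (\<lambda>x. if x \<in> points X then q (z x) else 0)"
    using assms by auto
  then show ?thesis unfolding e
    by (intro CollectI exI[of _ "p + q"]) (auto intro: poly_funs.intros)
qed

lemma funs_mult [simp, intro]: assumes "f \<in> funs X" "g \<in> funs X" shows "f * g \<in> funs X"
proof -
  obtain z where e: "funs X = {(\<lambda>x. if x \<in> points X then p (z x) else 0) | p. p \<in> poly_funs}"
    by (rule funs_conv)
  then obtain p q where "p \<in> poly_funs" "q \<in> poly_funs"
    "f = (\<lambda>x. if x \<in> points X then p (z x) else 0)" "g = (\<lambda>x. if x \<in> points X then q (z x) else 0)"
    using assms by auto
  then show ?thesis unfolding e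
    by (intro CollectI exI[of _ "p * q"]) (auto intro: poly_funs.intros)
qed

lemma funs_scale: assumes "f \<in> funs X" shows "(\<lambda>x. c * f x) \<in> funs X"
proof -
  obtain z where e: "funs X = {(\<lambda>x. if x \<in> points X then p (z x) else 0) | p. p \<in> poly_funs}"
    by (rule funs_conv)
  then obtain p where "p \<in> poly_funs" "f = (\<lambda>x. if x \<in> points X then p (z x) else 0)"
    using assms by auto
  then show ?thesis unfolding e
    by (intro CollectI exI[of _ "\<lambda>w. c * p w"]) (auto intro: poly_funs_scale)
qed

lemma funs_const_mult [simp, intro]: "f \<in> funs X \<Longrightarrow> const c * f \<in> funs X"
  using funs_scale[of f c] by (simp add: times_fun_def const_def)

lemma funs_mult_const [simp, intro]: "f \<in> funs X \<Longrightarrow> f * const c \<in> funs X"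
  using funs_const_mult by (simp add: mult.commute)

lemma funs_zero [simp, intro]: "0 \<in> funs X"
  using funs_scale[OF one_of_funs, of 0] by (simp add: zero_fun_def)

lemma funs_uminus [simp, intro]: "f \<in> funs X \<Longrightarrow> - f \<in> funs X"
  using funs_scale[of f "-1"] by (simp add: fun_Compl_def)

lemma funs_diff [simp, intro]: "f \<in> funs X \<Longrightarrow> g \<in> funs X \<Longrightarrow> f - g \<in> funs X"
  using funs_add[of f "- g"] by simp

lemma funs_sum [simp, intro]: "(\<And>i. i \<in> I \<Longrightarrow> F i \<in> funs X) \<Longrightarrow> (\<Sum>i\<in>I. F i) \<in> funs X"
  by (induction I rule: infinite_finite_induct) auto

text \<open>Powers occur only together with a regular factor, here and below, since
  \<open>f ^ 0\<close> is the constant 1 and need not be regular.\<close>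

lemma funs_power_mult [simp, intro]: "f \<in> funs X \<Longrightarrow> g \<in> funs X \<Longrightarrow> f ^ n * g \<in> funs X"
  by (induction n) (auto simp: mult.assoc)

lemma funs_mult_power [simp, intro]: "f \<in> funs X \<Longrightarrow> g \<in> funs X \<Longrightarrow> g * f ^ n \<in> funs X"
  using funs_power_mult by (simp add: mult.commute)

lemma one_of_mult [simp]: "f \<in> funs X \<Longrightarrow> one_of X * f = f" "f \<in> funs X \<Longrightarrow> f * one_of X = f"
  using funs_outside by (auto simp: fun_eq_iff one_of_def)

lemma one_of_nonzero [simp]: "one_of X \<noteq> 0"
  using points_nonempty by (auto simp: one_of_def fun_eq_iff)

lemma const_one_of: "f \<in> funs X \<Longrightarrow> const c * f = (const c * one_of X) * f"
  by (simp add: mult.assoc)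

text \<open>The zero sets of \<open>f\<close> and \<open>g\<close> cover the points, which are
  irreducible.\<close>

lemma funs_domain: assumes "f \<in> funs X" "g \<in> funs X" "f * g = 0" shows "f = 0 \<or> g = 0"
proof -
  let ?F = "{x \<in> points X. \<forall>h\<in>{f}. h x = 0}" and ?G = "{x \<in> points X. \<forall>h\<in>{g}. h x = 0}"
  have "zariski_closed X ?F" "zariski_closed X ?G"
    unfolding zariski_closed_def using assms by blast+
  moreover have "points X \<subseteq> ?F \<union> ?G"
    using assms(3) by (auto simp: fun_eq_iff)
  ultimately have "points X \<subseteq> ?F \<or> points X \<subseteq> ?G"
    using aff unfolding affine_variety_def zariski_irreducible_def by blast
  then show ?thesis
    using assms(1,2) funs_outside by (fastforce simp: fun_eq_iff)
qed

lemma funs_cancel: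
  assumes "c \<in> funs X" "c \<noteq> 0" "f \<in> funs X" "g \<in> funs X" "c * f = c * g" shows "f = g"
  using funs_domain[of c "f - g"] assms by (auto simp: algebra_simps)

lemma funs_mult_nonzero: "f \<in> funs X \<Longrightarrow> g \<in> funs X \<Longrightarrow> f \<noteq> 0 \<Longrightarrow> g \<noteq> 0 \<Longrightarrow> f * g \<noteq> 0"
  using funs_domain by blast

lemma funs_power_mult_nonzero:
  "f \<in> funs X \<Longrightarrow> g \<in> funs X \<Longrightarrow> f \<noteq> 0 \<Longrightarrow> g \<noteq> 0 \<Longrightarrow> f ^ n * g \<noteq> 0"
  by (induction n) (auto simp: mult.assoc funs_mult_nonzero)

text \<open>From here on the embedding enters only through its coordinate functions
  \<open>Z i\<close>. The fact about \<open>G\<close> is induction over the coordinate ring, by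
  which derivations and tangent vectors are determined on the \<open>Z i\<close>; the fact about
  \<open>w\<close> is what turns a maximal ideal into a point.\<close>

lemma generators:
  obtains m and Z :: "nat \<Rightarrow> 'a \<Rightarrow> complex" where "\<And>i. Z i \<in> funs X" "\<And>i. i \<ge> m \<Longrightarrow> Z i = 0"
    "\<forall>G. (\<forall>c. const c * one_of X \<in> G) \<and> (\<forall>i. Z i \<in> G) \<and>
       (\<forall>f g. f \<in> funs X \<and> g \<in> funs X \<and> f \<in> G \<and> g \<in> G \<longrightarrow> f + g \<in> G \<and> f * g \<in> G) \<longrightarrow> funs X \<subseteq> G"
    "\<And>w. \<lbrakk>\<And>i. i \<ge> m \<Longrightarrow> w i = 0; \<And>p. p \<in> poly_funs \<Longrightarrow> (\<And>x. x \<in> points X \<Longrightarrow> p (\<lambda>i. Z i x) = 0) \<Longrightarrow> p w = 0\<rbrakk>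
       \<Longrightarrow> \<exists>x\<in>points X. \<forall>i. w i = Z i x"
    "\<And>f. f \<in> funs X \<Longrightarrow> \<exists>p\<in>poly_funs. \<forall>x\<in>points X. f x = p (\<lambda>i. Z i x)"
    "\<And>p. p \<in> poly_funs \<Longrightarrow> (\<lambda>x. if x \<in> points X then p (\<lambda>i. Z i x) else 0) \<in> funs X"
proof -
  obtain m z where *: "inj_on z (points X)" "algebraic_set m (z ` points X)"
    "funs X = {(\<lambda>x. if x \<in> points X then p (z x) else 0) | p. p \<in> poly_funs}"
    by (rule coordinates)
  define Z where "Z = (\<lambda>i x. if x \<in> points X then z x i else 0)"
  have Zf: "Z i \<in> funs X" for i
    unfolding *(3) Z_def using poly_funs.coord[of i] by (intro CollectI exI[of _ "\<lambda>w. w i"]) auto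
  have Zz: "(\<lambda>i. Z i x) = z x" if "x \<in> points X" for x
    using that by (simp add: Z_def)
  obtain Q where Q: "Q \<subseteq> poly_funs" "z ` points X = {w \<in> affine_space m. \<forall>p\<in>Q. p w = 0}"
    using *(2) unfolding algebraic_set_def by blast
  have Z0: "Z i = 0" if "i \<ge> m" for i
  proof
    fix x
    show "Z i x = 0 x"
      using Q(2) that by (auto simp: Z_def affine_space_def)
  qed
  have ind: "P f" if h1: "\<And>c. P (const c * one_of X)" and h2: "\<And>i. P (Z i)"
       and h3: "\<And>f g. f \<in> funs X \<Longrightarrow> g \<in> funs X \<Longrightarrow> P f \<Longrightarrow> P g \<Longrightarrow> P (f + g)"
       and h4: "\<And>f g. f \<in> funs X \<Longrightarrow> g \<in> funs X \<Longrightarrow> P f \<Longrightarrow> P g \<Longrightarrow> P (f * g)" and h5: "f \<in> funs X" for P f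
  proof -
    have pf: "(\<lambda>x. if x \<in> points X then p (z x) else 0) \<in> funs X" if "p \<in> poly_funs" for p
      unfolding *(3) using that by blast
    have "P (\<lambda>x. if x \<in> points X then p (z x) else 0)" if "p \<in> poly_funs" for p
      using that
    proof induction
      case (const c)
      have "(\<lambda>x. if x \<in> points X then c else 0) = const c * one_of X"
        by (auto simp: one_of_def const_def fun_eq_iff)
      then show ?case using h1[of c] by simp
    next
      case (coord i)
      then show ?case using h2[of i] by (simp add: Z_def)
    next
      case (add p q)
      have "(\<lambda>x. if x \<in> points X then (p + q) (z x) else 0) =
        (\<lambda>x. if x \<in> points X then p (z x) else 0) + (\<lambda>x. if x \<in> points X then q (z x) else 0)"
        by auto
      then show ?case using h3[OF pf[OF add.hyps(1)] pf[OF add.hyps(2)] add.IH] by simp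
    next
      case (mult p q)
      have "(\<lambda>x. if x \<in> points X then (p * q) (z x) else 0) =
        (\<lambda>x. if x \<in> points X then p (z x) else 0) * (\<lambda>x. if x \<in> points X then q (z x) else 0)"
        by auto
      then show ?case using h4[OF pf[OF mult.hyps(1)] pf[OF mult.hyps(2)] mult.IH] by simp
    qed
    then show ?thesis using h5 unfolding *(3) by auto
  qed
  have gen: "\<forall>G. (\<forall>c. const c * one_of X \<in> G) \<and> (\<forall>i. Z i \<in> G) \<and>
       (\<forall>f g. f \<in> funs X \<and> g \<in> funs X \<and> f \<in> G \<and> g \<in> G \<longrightarrow> f + g \<in> G \<and> f * g \<in> G) \<longrightarrow> funs X \<subseteq> G"
    by (intro allI impI subsetI, elim conjE) (rule ind[where P = "\<lambda>f. f \<in> _"]; blast)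
  have pt: "\<exists>x\<in>points X. \<forall>i. w i = Z i x"
    if "\<And>i. i \<ge> m \<Longrightarrow> w i = 0" "\<And>p. p \<in> poly_funs \<Longrightarrow> (\<And>x. x \<in> points X \<Longrightarrow> p (\<lambda>i. Z i x) = 0) \<Longrightarrow> p w = 0" for w
  proof -
    have "p w = 0" if "p \<in> Q" for p
    proof (rule \<open>\<And>p. p \<in> poly_funs \<Longrightarrow> (\<And>x. x \<in> points X \<Longrightarrow> p (\<lambda>i. Z i x) = 0) \<Longrightarrow> p w = 0\<close>)
      show "p \<in> poly_funs" using that Q by auto
      show "p (\<lambda>i. Z i x) = 0" if "x \<in> points X" for x
        using Q(2) \<open>p \<in> Q\<close> that Zz[OF that] by auto
    qed
    then have "w \<in> z ` points X" using that(1) unfolding Q(2) affine_space_def by auto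
    then obtain x where "x \<in> points X" "w = z x" by blast
    then show ?thesis using Zz[of x] by (intro bexI[of _ x]) (auto simp: fun_eq_iff)
  qed
  have rep: "\<exists>p\<in>poly_funs. \<forall>x\<in>points X. f x = p (\<lambda>i. Z i x)" if "f \<in> funs X" for f
    using that Zz unfolding *(3) by auto
  have rep': "(\<lambda>x. if x \<in> points X then p (\<lambda>i. Z i x) else 0) \<in> funs X" if "p \<in> poly_funs" for p
    unfolding *(3) using that Zz by (intro CollectI exI[of _ p]) auto
  show thesis by (rule that[of Z m]) (fact Zf Z0 gen pt rep rep')+
qed

lemma funs_countable_span:
  obtains M where "countable M" "funs X \<subseteq> cfun.span M"
proof -
  obtain z where e: "funs X = {(\<lambda>x. if x \<in> points X then p (z x) else 0) | p. p \<in> poly_funs}"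
    by (rule funs_conv)
  define r where "r p = (\<lambda>x. if x \<in> points X then p (z x) else 0)" for p :: "(nat \<Rightarrow> complex) \<Rightarrow> complex"
  have "r p \<in> cfun.span (r ` monomials)" if "p \<in> cfun.span monomials" for p
    using that
  proof (induction rule: cfun.span_induct_alt)
    case base
    have "r (\<lambda>w. 0) = 0" by (auto simp: r_def)
    then show ?case using cfun.span_zero by (simp add: zero_fun_def)
  next
    case (step c p q)
    have "r ((\<lambda>z. c * p z) + q) = (\<lambda>z. c * r p z) + r q" by (auto simp: r_def)
    then show ?case using step
      by (metis cfun.span_add cfun.span_base cfun.span_scale imageI)
  qed
  then have "funs X \<subseteq> cfun.span (r ` monomials)"
    unfolding e r_def using poly_funs_span_monomials by blast
  then show thesis using that[of "r ` monomials"] countable_monomials by blast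
qed

section \<open>Ideals, maximal ideals and their zeros\<close>

lemma ideal_ofD:
  assumes "ideal_of X J"
  shows "J \<subseteq> funs X" "0 \<in> J" "f \<in> J \<Longrightarrow> g \<in> J \<Longrightarrow> f + g \<in> J" "a \<in> funs X \<Longrightarrow> f \<in> J \<Longrightarrow> a * f \<in> J"
  using assms unfolding ideal_of_def by blast+

lemma ideal_const: assumes "ideal_of X J" "f \<in> J" shows "const c * f \<in> J"
proof -
  have "(const c * one_of X) * f \<in> J" by (intro ideal_ofD(4) assms funs_const_mult one_of_funs)
  then show ?thesis using assms ideal_ofD(1) const_one_of by (metis subsetD)
qed

lemma ideal_uminus: assumes "ideal_of X J" "f \<in> J" shows "- f \<in> J"
  using ideal_const[OF assms, of "-1"] by (simp add: const_def times_fun_def fun_Compl_def)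

lemma ideal_diff: assumes "ideal_of X J" "f \<in> J" "g \<in> J" shows "f - g \<in> J"
  using ideal_ofD(3)[OF assms(1,2) ideal_uminus[OF assms(1,3)]] by simp

lemma ideal_sum: assumes "ideal_of X J" "\<And>i. i \<in> I \<Longrightarrow> F i \<in> J" shows "(\<Sum>i\<in>I. F i) \<in> J"
  using assms(2) by (induction I rule: infinite_finite_induct) (auto simp: ideal_ofD[OF assms(1)])

definition poly_of :: "complex poly \<Rightarrow> ('a \<Rightarrow> complex) \<Rightarrow> 'a \<Rightarrow> complex" where
  "poly_of q f = (\<lambda>x. if x \<in> points X then poly q (f x) else 0)"

lemma poly_of_0: "poly_of 0 f = 0"
  by (auto simp: poly_of_def)

lemma poly_of_add: "poly_of (p + q) f = poly_of p f + poly_of q f"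
  by (auto simp: poly_of_def)

lemma poly_of_smult: "poly_of (smult c p) f = const c * poly_of p f"
  by (auto simp: poly_of_def)

lemma poly_of_mult: "poly_of (p * q) f = poly_of p f * poly_of q f"
  by (auto simp: poly_of_def)

lemma poly_of_sum: "poly_of (\<Sum>i\<in>I. P i) f = (\<Sum>i\<in>I. poly_of (P i) f)"
  by (induction I rule: infinite_finite_induct) (auto simp: poly_of_add poly_of_0)

lemma poly_of_const: "poly_of [:c:] f = const c * one_of X"
  by (auto simp: poly_of_def one_of_def)

lemma poly_of_linear: "f \<in> funs X \<Longrightarrow> poly_of [:- c, 1:] f = f - const c * one_of X"
  using funs_outside by (auto simp: poly_of_def one_of_def fun_eq_iff)

lemma poly_of_funs: "f \<in> funs X \<Longrightarrow> poly_of q f \<in> funs X"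
proof (induction q)
  case (pCons c q)
  have *: "poly_of (pCons c q) f = const c * one_of X + f * poly_of q f"
    by (auto simp: poly_of_def one_of_def)
  show ?case unfolding * using pCons.IH pCons.prems by (intro funs_add funs_mult funs_const_mult one_of_funs)
qed (simp add: poly_of_0)

text \<open>The usual argument for an uncountable base field: if \<open>f\<close> had no value modulo the maximal ideal
  \<open>M\<close>, the inverses of all the \<open>f - c\<close> would be linearly independent modulo \<open>M\<close>.\<close>

lemma maximal_ideal_value:
  assumes M: "ideal_of X M" "one_of X \<notin> M"
    and max: "\<And>J. ideal_of X J \<Longrightarrow> M \<subseteq> J \<Longrightarrow> one_of X \<notin> J \<Longrightarrow> J = M"
    and f: "f \<in> funs X"
  shows "\<exists>c. f - const c * one_of X \<in> M"
proof (rule ccontr)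
  assume "\<nexists>c. f - const c * one_of X \<in> M"
  then have nM: "f - const c * one_of X \<notin> M" for c by blast
  define l where "l c = f - const c * one_of X" for c
  have lf: "l c \<in> funs X" for c using f by (auto simp: l_def)
  have lnM: "l c \<notin> M" for c using nM by (simp add: l_def)
  have MA: "g \<in> M \<Longrightarrow> g \<in> funs X" for g using ideal_ofD(1)[OF M(1)] by blast
  \<comment> \<open>By maximality \<open>M\<close> and \<open>l c\<close> generate the unit ideal,
    so \<open>l c\<close> has an inverse \<open>u c\<close> modulo \<open>M\<close>.\<close>
  have "\<exists>u\<in>funs X. one_of X - u * l c \<in> M" for c
  proof -
    define J where "J = {h + u * l c | h u. h \<in> M \<and> u \<in> funs X}"
    have J: "ideal_of X J"
      unfolding ideal_of_def
    proof (intro conjI ballI)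
      show "J \<subseteq> funs X" using MA lf by (auto simp: J_def)
      show "0 \<in> J" unfolding J_def
        by (rule CollectI, rule exI[of _ 0], rule exI[of _ 0]) (auto simp: ideal_ofD[OF M(1)])
      fix a b assume "a \<in> J" "b \<in> J"
      then obtain h u h' u' where *: "a = h + u * l c" "h \<in> M" "u \<in> funs X"
        "b = h' + u' * l c" "h' \<in> M" "u' \<in> funs X" unfolding J_def by blast
      show "a + b \<in> J" unfolding J_def
        by (rule CollectI, rule exI[of _ "h + h'"], rule exI[of _ "u + u'"])
          (auto simp: * ideal_ofD[OF M(1)] algebra_simps)
    next
      fix a b assume "a \<in> funs X" "b \<in> J"
      then obtain h u where *: "b = h + u * l c" "h \<in> M" "u \<in> funs X" unfolding J_def by blast
      show "a * b \<in> J" unfolding J_def using \<open>a \<in> funs X\<close>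
        by (intro CollectI exI[of _ "a * h"] exI[of _ "a * u"])
          (auto simp: * ideal_ofD[OF M(1)] algebra_simps)
    qed
    have "M \<subseteq> J"
    proof
      fix h assume "h \<in> M"
      then show "h \<in> J" unfolding J_def
        by (intro CollectI exI[of _ h] exI[of _ 0]) auto
    qed
    moreover have "l c \<in> J" unfolding J_def using lf
      by (intro CollectI exI[of _ 0] exI[of _ "one_of X"]) (auto simp: ideal_ofD[OF M(1)])
    ultimately have "one_of X \<in> J" using max[OF J] lnM by blast
    then obtain h u where "one_of X = h + u * l c" "h \<in> M" "u \<in> funs X"
      unfolding J_def by blast
    then show ?thesis by (intro bexI[of _ u]) auto
  qed
  then obtain u where u: "\<And>c. u c \<in> funs X" "\<And>c. one_of X - u c * l c \<in> M" by metis
  have lsub: "l c - l d = const (d - c) * one_of X" for c d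
    by (auto simp: l_def fun_eq_iff algebra_simps)
  \<comment> \<open>If \<open>u c = u d\<close>, the difference of the two congruences puts
    \<open>(c - d) u c\<close> into \<open>M\<close>; then \<open>u c\<close> and hence the unit lie
    in \<open>M\<close>. So the \<open>u c\<close> form an uncountable family in a space with a
    countable spanning set.\<close>
  have inj: "inj u"
  proof (rule injI, rule ccontr)
    fix c d assume e: "u c = u d" "c \<noteq> d"
    have "(one_of X - u c * l c) - (one_of X - u d * l d) \<in> M"
      using ideal_diff[OF M(1)] u by blast
    also have "(one_of X - u c * l c) - (one_of X - u d * l d) = u c * (l d - l c)"
      using e(1) by (simp add: algebra_simps)
    also have "\<dots> = const (c - d) * u c"
      using u(1)[of c] by (simp add: lsub mult.left_commute[of _ "const (c - d)"])
    finally have "const (1 / (c - d)) * (const (c - d) * u c) \<in> M"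
      using ideal_const[OF M(1)] by blast
    also have "const (1 / (c - d)) * (const (c - d) * u c) = u c"
      using e(2) by (auto simp: fun_eq_iff)
    finally have "l c * u c \<in> M" by (intro ideal_ofD(4)[OF M(1)] lf)
    then have "(one_of X - u c * l c) + l c * u c \<in> M" using u(2) ideal_ofD(3)[OF M(1)] by blast
    then show False using M(2) by (simp add: algebra_simps)
  qed
  obtain B where B: "countable B" "funs X \<subseteq> cfun.span B" by (rule funs_countable_span)
  have "\<not> countable (range u)"
    using inj uncountable_UNIV_complex countable_image_inj_on[of u UNIV] by blast
  then have "cfun.dependent (range u)"
    using cfun_independent_countable[of "range u" B] B u(1) by blast
  then obtain T w where T: "finite T" "T \<subseteq> range u" "(\<Sum>v\<in>T. (\<lambda>x. w v * v x)) = 0" "\<exists>v\<in>T. w v \<noteq> 0"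
    unfolding cfun.dependent_explicit by auto
  define C where "C = u -` T"
  have C: "finite C" "T = u ` C"
    using T(1,2) inj by (auto simp: C_def intro!: finite_vimageI)
  define \<mu> where "\<mu> c = w (u c)" for c
  have dep: "(\<Sum>c\<in>C. const (\<mu> c) * u c) = 0"
  proof -
    have "(\<Sum>v\<in>T. (\<lambda>x. w v * v x)) = (\<Sum>c\<in>C. (\<lambda>x. w (u c) * u c x))"
      unfolding C(2) using inj by (subst sum.reindex) (auto intro: inj_on_subset)
    then show ?thesis using T(3) by (simp add: \<mu>_def const_def times_fun_def)
  qed
  obtain c0 where c0: "c0 \<in> C" "\<mu> c0 \<noteq> 0" using T(4) C(2) by (auto simp: \<mu>_def)
  define P where "P D = (\<Prod>d\<in>D. [:- d, 1:])" for D :: "complex set"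
  \<comment> \<open>Multiplying the linear relation between the inverses \<open>u c\<close> by the
    product \<open>P C\<close> of all factors clears denominators: modulo \<open>M\<close>,
    \<open>u c\<close> times \<open>P C\<close> is \<open>P (C - {c})\<close>. At \<open>c0\<close>
    only one summand of \<open>q\<close> survives, so \<open>q\<close> is not zero.\<close>
  define q where "q = (\<Sum>c\<in>C. smult (\<mu> c) (P (C - {c})))"
  have "poly q c0 = (\<Sum>c\<in>C. \<mu> c * (\<Prod>d\<in>C - {c}. c0 - d))"
    by (simp add: q_def P_def poly_sum poly_prod)
  also have "\<dots> = (\<Sum>c\<in>C. if c = c0 then \<mu> c0 * (\<Prod>d\<in>C - {c0}. c0 - d) else 0)"
    using C(1) c0(1) by (intro sum.cong) (auto simp: prod_zero_iff)
  also have "\<dots> = \<mu> c0 * (\<Prod>d\<in>C - {c0}. c0 - d)"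
    using C(1) c0(1) by (simp add: sum.delta)
  also have "\<dots> \<noteq> 0" using C(1) c0(2) by (auto simp: prod_zero_iff)
  finally have q0: "q \<noteq> 0" by auto
  have qM: "poly_of q f \<in> M"
  proof -
    have "poly_of (P (C - {c})) f - u c * poly_of (P C) f \<in> M" if "c \<in> C" for c
    proof -
      have "P C = [:- c, 1:] * P (C - {c})"
        unfolding P_def using C(1) that by (rule prod.remove)
      then have "poly_of (P C) f = l c * poly_of (P (C - {c})) f"
        using f by (simp only: poly_of_mult poly_of_linear l_def)
      then have "poly_of (P (C - {c})) f - u c * poly_of (P C) f
          = poly_of (P (C - {c})) f * (one_of X - u c * l c)"
        using poly_of_funs[OF f, of "P (C - {c})"] by (simp add: algebra_simps)
      then show ?thesis using ideal_ofD(4)[OF M(1) poly_of_funs[OF f] u(2)] by simp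
    qed
    then have "(\<Sum>c\<in>C. const (\<mu> c) * (poly_of (P (C - {c})) f - u c * poly_of (P C) f)) \<in> M"
      by (intro ideal_sum ideal_const M(1))
    also have "(\<Sum>c\<in>C. const (\<mu> c) * (poly_of (P (C - {c})) f - u c * poly_of (P C) f))
       = poly_of q f - (\<Sum>c\<in>C. const (\<mu> c) * u c) * poly_of (P C) f"
      by (simp add: q_def poly_of_sum poly_of_smult right_diff_distrib sum_subtractf sum_distrib_right mult.assoc)
    finally show ?thesis by (simp add: dep)
  qed
  \<comment> \<open>Split off linear factors: each of them becomes some \<open>l r\<close>, which is
    invertible modulo \<open>M\<close>, until a nonzero constant remains.\<close>
  have "poly_of q f \<notin> M" if "q \<noteq> 0" for q
    using that
  proof (induction "degree q" arbitrary: q rule: less_induct)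
    case less
    show ?case
    proof (cases "degree q = 0")
      case True
      then obtain c where "q = [:c:]" by (rule degree_eq_zeroE)
      show ?thesis
      proof
        assume "poly_of q f \<in> M"
        then have "const (1 / c) * (const c * one_of X) \<in> M"
          using ideal_const[OF M(1)] \<open>q = [:c:]\<close> by (simp add: poly_of_const)
        moreover have "const (1 / c) * (const c * one_of X) = one_of X"
          using less.prems \<open>q = [:c:]\<close> by (auto simp: fun_eq_iff)
        ultimately show False using M(2) by simp
      qed
    next
      case False
      then obtain r where "poly q r = 0"
        using fundamental_theorem_of_algebra[of q] constant_degree[of q] by auto
      then obtain q' where q': "q = [:- r, 1:] * q'" by (auto simp: poly_eq_0_iff_dvd)
      then have "q' \<noteq> 0" using less.prems by auto
      then have "degree q' < degree q" unfolding q' by (subst degree_mult_eq) auto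
      show ?thesis
      proof
        assume "poly_of q f \<in> M"
        then have "u r * (l r * poly_of q' f) \<in> M"
          using ideal_ofD(4)[OF M(1) u(1)[of r]] f by (simp only: q' poly_of_mult poly_of_linear l_def)
        moreover have "poly_of q' f * (one_of X - u r * l r) \<in> M"
          using ideal_ofD(4)[OF M(1) poly_of_funs[OF f] u(2)] by simp
        ultimately have "u r * (l r * poly_of q' f) + poly_of q' f * (one_of X - u r * l r) \<in> M"
          using ideal_ofD(3)[OF M(1)] by blast
        also have "u r * (l r * poly_of q' f) + poly_of q' f * (one_of X - u r * l r) = poly_of q' f"
          using poly_of_funs[OF f, of q'] by (simp add: algebra_simps)
        finally show False using less.hyps[OF \<open>degree q' < degree q\<close> \<open>q' \<noteq> 0\<close>] by simp
      qed
    qed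
  qed
  then show False using q0 qM by blast
qed

text \<open>Otherwise Zorn's lemma gives a maximal ideal above \<open>I\<close>. Modulo this ideal
  every function is a constant, and the constants of the coordinate functions are the coordinates of
  a common zero of \<open>I\<close>.\<close>

theorem nullstellensatz:
  assumes I: "ideal_of X I" and nz: "\<And>x. x \<in> points X \<Longrightarrow> \<exists>f\<in>I. f x \<noteq> 0"
  shows "one_of X \<in> I"
proof (rule ccontr)
  assume I1: "one_of X \<notin> I"
  define \<A> where "\<A> = {J. ideal_of X J \<and> I \<subseteq> J \<and> one_of X \<notin> J}"
  have "\<exists>M\<in>\<A>. \<forall>J\<in>\<A>. M \<subseteq> J \<longrightarrow> J = M"
  proof (rule subset_Zorn_nonempty)
    show "\<A> \<noteq> {}" using I I1 by (auto simp: \<A>_def)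
    fix \<C> assume ne: "\<C> \<noteq> {}" and ch: "subset.chain \<A> \<C>"
    have sub: "\<C> \<subseteq> \<A>" and lin: "\<And>J K. J \<in> \<C> \<Longrightarrow> K \<in> \<C> \<Longrightarrow> J \<subseteq> K \<or> K \<subseteq> J"
      using ch unfolding subset.chain_def subset_chain_def by auto
    have "ideal_of X (\<Union>\<C>)"
      unfolding ideal_of_def
    proof (intro conjI ballI)
      show "\<Union>\<C> \<subseteq> funs X" "0 \<in> \<Union>\<C>"
        using sub ne by (auto simp: \<A>_def ideal_of_def)
      fix a b assume "a \<in> \<Union>\<C>" "b \<in> \<Union>\<C>"
      then obtain J K where "J \<in> \<C>" "K \<in> \<C>" "a \<in> J" "b \<in> K" by blast
      with lin obtain L where "L \<in> \<C>" "a \<in> L" "b \<in> L" by blast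
      with sub show "a + b \<in> \<Union>\<C>" unfolding \<A>_def ideal_of_def by blast
    next
      fix a b assume "a \<in> funs X" "b \<in> \<Union>\<C>"
      with sub show "a * b \<in> \<Union>\<C>" unfolding \<A>_def ideal_of_def by blast
    qed
    then show "\<Union>\<C> \<in> \<A>" using sub ne unfolding \<A>_def by blast
  qed
  then obtain M where MA: "M \<in> \<A>" and max: "\<And>J. J \<in> \<A> \<Longrightarrow> M \<subseteq> J \<Longrightarrow> J = M" by blast
  have M: "ideal_of X M" "I \<subseteq> M" "one_of X \<notin> M" using MA by (auto simp: \<A>_def)
  have "\<exists>c. f - const c * one_of X \<in> M" if "f \<in> funs X" for f
    using M max that by (intro maximal_ideal_value) (auto simp: \<A>_def)
  then obtain v where v: "\<And>f. f \<in> funs X \<Longrightarrow> f - const (v f) * one_of X \<in> M" by metis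
  have constM: "c = 0" if "const c * one_of X \<in> M" for c
  proof (rule ccontr)
    assume "c \<noteq> 0"
    have "const (1 / c) * (const c * one_of X) \<in> M" by (intro ideal_const M that)
    moreover have "const (1 / c) * (const c * one_of X) = one_of X"
      using \<open>c \<noteq> 0\<close> by (auto simp: fun_eq_iff)
    ultimately show False using M by simp
  qed
  obtain m and Z :: "nat \<Rightarrow> 'a \<Rightarrow> complex" where Z: "\<And>i. Z i \<in> funs X" "\<And>i. i \<ge> m \<Longrightarrow> Z i = 0"
    "\<And>w. \<lbrakk>\<And>i. i \<ge> m \<Longrightarrow> w i = 0; \<And>p. p \<in> poly_funs \<Longrightarrow> (\<And>x. x \<in> points X \<Longrightarrow> p (\<lambda>i. Z i x) = 0) \<Longrightarrow> p w = 0\<rbrakk>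
       \<Longrightarrow> \<exists>x\<in>points X. \<forall>i. w i = Z i x"
    "\<And>f. f \<in> funs X \<Longrightarrow> \<exists>p\<in>poly_funs. \<forall>x\<in>points X. f x = p (\<lambda>i. Z i x)"
    "\<And>p. p \<in> poly_funs \<Longrightarrow> (\<lambda>x. if x \<in> points X then p (\<lambda>i. Z i x) else 0) \<in> funs X"
    by (rule generators) blast
  define w where "w i = v (Z i)" for i
  define ev where "ev p = (\<lambda>x. if x \<in> points X then p (\<lambda>i. Z i x) else 0)" for p :: "(nat \<Rightarrow> complex) \<Rightarrow> complex"
  have evf: "ev p \<in> funs X" if "p \<in> poly_funs" for p
    using Z(5)[OF that] by (simp add: ev_def)
  \<comment> \<open>Passing to residues modulo \<open>M\<close> is evaluation at
    \<open>w\<close>.\<close>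
  have ev: "ev p - const (p w) * one_of X \<in> M" if "p \<in> poly_funs" for p
    using that
  proof induction
    case (const c)
    have *: "ev (\<lambda>w. c) - const c * one_of X = 0" by (auto simp: ev_def one_of_def)
    show ?case unfolding * by (rule ideal_ofD(2)[OF M(1)])
  next
    case (coord i)
    have *: "ev (\<lambda>w. w i) = Z i" using funs_outside[OF Z(1)] by (auto simp: ev_def)
    show ?case unfolding * w_def by (rule v[OF Z(1)])
  next
    case (add p q)
    have "ev (p + q) - const ((p + q) w) * one_of X =
      (ev p - const (p w) * one_of X) + (ev q - const (q w) * one_of X)"
      by (auto simp: ev_def fun_eq_iff algebra_simps)
    then show ?case using ideal_ofD(3)[OF M(1) add.IH] by (simp only:)
  next
    case (mult p q)
    have "ev (p * q) - const ((p * q) w) * one_of X =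
      ev q * (ev p - const (p w) * one_of X) + const (p w) * (ev q - const (q w) * one_of X)"
      by (auto simp: ev_def one_of_def fun_eq_iff algebra_simps)
    then show ?case
      using ideal_ofD(3)[OF M(1) ideal_ofD(4)[OF M(1) evf[OF mult.hyps(2)] mult.IH(1)] ideal_const[OF M(1) mult.IH(2)]]
      by (simp only:)
  qed
  \<comment> \<open>A polynomial \<open>p\<close> that vanishes on \<open>X\<close> has
    \<open>ev p = 0\<close>, so the constant \<open>p w\<close> lies in \<open>M\<close> and is 0:
    \<open>w\<close> satisfies all equations of \<open>X\<close>.\<close>
  have "\<exists>x\<in>points X. \<forall>i. w i = Z i x"
  proof (rule Z(3))
    fix i assume "m \<le> i"
    then have "const (- w i) * one_of X \<in> M"
      using v[OF Z(1)[of i]] Z(2)[of i] by (simp add: w_def const_def times_fun_def fun_Compl_def fun_diff_def)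
    then show "w i = 0" using constM by fastforce
  next
    fix p assume p: "p \<in> poly_funs" "\<And>x. x \<in> points X \<Longrightarrow> p (\<lambda>i. Z i x) = 0"
    then have "const (- p w) * one_of X = ev p - const (p w) * one_of X"
      by (auto simp: ev_def fun_eq_iff)
    then show "p w = 0" using ev[OF p(1)] constM[of "- p w"] by simp
  qed
  then obtain x where x: "x \<in> points X" "\<And>i. w i = Z i x" by blast
  obtain f where f: "f \<in> I" "f x \<noteq> 0" using nz[OF x(1)] by blast
  then have fX: "f \<in> funs X" using ideal_ofD(1)[OF I] by blast
  obtain p where p: "p \<in> poly_funs" "\<And>x. x \<in> points X \<Longrightarrow> f x = p (\<lambda>i. Z i x)"
    using Z(4)[OF fX] by blast
  have wx: "w = (\<lambda>i. Z i x)" using x(2) by auto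
  have "ev p = f" using p(2) funs_outside[OF fX] by (auto simp: ev_def)
  then have "f - const (f x) * one_of X \<in> M" using ev[OF p(1)] p(2)[OF x(1)] wx by simp
  then have "f - (f - const (f x) * one_of X) \<in> M" using ideal_diff[OF M(1)] f(1) M(2) by blast
  then have "const (f x) * one_of X \<in> M" by simp
  then show False using constM f(2) by blast
qed

end

section \<open>Derivations\<close>

text \<open>Simplification with conditional equations between functions eta-expands; without the
  pointwise rules the ring operations on functions survive this.\<close>

lemmas pointwise = plus_fun_apply times_fun_apply zero_fun_apply one_fun_apply minus_apply
  uminus_apply const_apply fun_sum_apply fun_power_apply

declare plus_fun_apply [simp del] times_fun_apply [simp del] zero_fun_apply [simp del]
  one_fun_apply [simp del] minus_apply [simp del] uminus_apply [simp del] const_apply [simp del]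

lemma vfield_apply [simp]:
  fixes D E :: "'a vfield"
  shows "(D + E) f = D f + E f" "(D - E) f = D f - E f" "(- D) f = - D f" "(0 :: 'a vfield) f = 0"
  by (simp_all add: pointwise)

text \<open>The library rewrites partially applied products of numbers to such functions.\<close>

lemma complex_fun_apply [simp]:
  fixes h :: "complex \<Rightarrow> complex"
  shows "(- h) z = - h z" "(0 :: complex \<Rightarrow> complex) z = 0" "(1 :: complex \<Rightarrow> complex) z = 1"
  by (simp_all add: pointwise)

lemma form_apply [simp]:
  fixes \<sigma> \<tau> :: "'a form"
  shows "(\<sigma> + \<tau>) vs = \<sigma> vs + \<tau> vs" "(\<sigma> - \<tau>) vs = \<sigma> vs - \<tau> vs" "(- \<tau>) vs = - \<tau> vs"
    "(0 :: 'a form) vs = 0"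
  by (simp_all add: pointwise)

context affine_var
begin

abbreviation VF :: "'a vfield set" where "VF \<equiv> vector_fields X"

lemma vf_funs [simp, intro]: "D \<in> VF \<Longrightarrow> f \<in> funs X \<Longrightarrow> D f \<in> funs X"
  unfolding vector_fields_def by blast

lemma vf_add: "D \<in> VF \<Longrightarrow> f \<in> funs X \<Longrightarrow> g \<in> funs X \<Longrightarrow> D (f + g) = D f + D g"
  unfolding vector_fields_def by blast

lemma vf_mult: "D \<in> VF \<Longrightarrow> f \<in> funs X \<Longrightarrow> g \<in> funs X \<Longrightarrow> D (f * g) = f * D g + g * D f"
  unfolding vector_fields_def by blast

lemma vf_const: "D \<in> VF \<Longrightarrow> f \<in> funs X \<Longrightarrow> D (const c * f) = const c * D f"
  unfolding vector_fields_def const_def times_fun_def by blast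

lemma vf_outside: "D \<in> VF \<Longrightarrow> f \<notin> funs X \<Longrightarrow> D f = 0"
  unfolding vector_fields_def by blast

lemma vf_zero [simp]: "D \<in> VF \<Longrightarrow> D 0 = 0"
  using vf_add[of D 0 0] by simp

lemma vf_uminus: "D \<in> VF \<Longrightarrow> f \<in> funs X \<Longrightarrow> D (- f) = - D f"
  using vf_add[of D f "- f"] by (simp add: eq_neg_iff_add_eq_0 add.commute)

lemma vf_diff: "D \<in> VF \<Longrightarrow> f \<in> funs X \<Longrightarrow> g \<in> funs X \<Longrightarrow> D (f - g) = D f - D g"
  using vf_add[of D f "- g"] by (simp add: vf_uminus)

lemma vf_one [simp]: assumes "D \<in> VF" shows "D (one_of X) = 0"
proof -
  have "D (one_of X * one_of X) = one_of X * D (one_of X) + one_of X * D (one_of X)"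
    by (intro vf_mult assms one_of_funs)
  then show ?thesis using assms by simp
qed

lemma vf_eqI: "D \<in> VF \<Longrightarrow> E \<in> VF \<Longrightarrow> (\<And>f. f \<in> funs X \<Longrightarrow> D f = E f) \<Longrightarrow> D = E"
  using vf_outside by (metis ext)

lemma vf_plus [simp, intro]: "D \<in> VF \<Longrightarrow> E \<in> VF \<Longrightarrow> D + E \<in> VF"
  unfolding vector_fields_def by (auto simp: pointwise fun_eq_iff algebra_simps)

lemma vf_times [simp, intro]: "D \<in> VF \<Longrightarrow> a \<in> funs X \<Longrightarrow> (\<lambda>f. a * D f) \<in> VF"
  unfolding vector_fields_def by (auto simp: pointwise fun_eq_iff algebra_simps)

lemma vf_const_times [simp, intro]: "D \<in> VF \<Longrightarrow> (\<lambda>f. const c * D f) \<in> VF"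
  unfolding vector_fields_def by (auto simp: pointwise fun_eq_iff algebra_simps)

lemma vf_0 [simp, intro]: "0 \<in> VF"
  unfolding vector_fields_def by (auto simp: pointwise fun_eq_iff)

lemma vf_neg [simp, intro]: "D \<in> VF \<Longrightarrow> - D \<in> VF"
  using vf_const_times[of D "-1"] by (simp add: const_def times_fun_def fun_Compl_def)

lemma vf_minus [simp, intro]: "D \<in> VF \<Longrightarrow> E \<in> VF \<Longrightarrow> D - E \<in> VF"
  using vf_plus[of D "- E"] by simp

lemma vf_bracket [simp, intro]: assumes "D \<in> VF" "E \<in> VF" shows "bracket D E \<in> VF"
  unfolding vector_fields_def
proof (intro CollectI conjI ballI allI impI)
  fix f g assume fg: "f \<in> funs X" "g \<in> funs X"
  show "bracket D E f \<in> funs X" using assms fg by (simp add: bracket_def)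
  show "bracket D E (f + g) = bracket D E f + bracket D E g"
    using assms fg by (simp add: bracket_def vf_add)
  show "bracket D E (f * g) = f * bracket D E g + g * bracket D E f"
    using assms fg by (simp add: bracket_def vf_add vf_mult algebra_simps)
next
  fix c f assume f: "f \<in> funs X"
  have "bracket D E (const c * f) = const c * bracket D E f"
    using assms f by (simp add: bracket_def vf_const right_diff_distrib)
  then show "bracket D E (\<lambda>x. c * f x) = (\<lambda>x. c * bracket D E f x)"
    by (simp add: const_def times_fun_def)
next
  fix f assume "f \<notin> funs X"
  then show "bracket D E f = 0" using assms by (simp add: bracket_def vf_outside)
qed

lemma bracket_apply: "bracket D E f = D (E f) - E (D f)"
  by (simp add: bracket_def)

lemma bracket_add_right: "D \<in> VF \<Longrightarrow> E \<in> VF \<Longrightarrow> F \<in> VF \<Longrightarrow> bracket D (E + F) = bracket D E + bracket D F"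
  by (rule vf_eqI) (auto simp: bracket_apply vf_add)

lemma bracket_add_left: "D \<in> VF \<Longrightarrow> E \<in> VF \<Longrightarrow> F \<in> VF \<Longrightarrow> bracket (D + E) F = bracket D F + bracket E F"
  by (rule vf_eqI) (auto simp: bracket_apply vf_add)

lemma bracket_times_right:
  "D \<in> VF \<Longrightarrow> E \<in> VF \<Longrightarrow> a \<in> funs X \<Longrightarrow>
   bracket D (\<lambda>f. a * E f) = (\<lambda>f. a * bracket D E f) + (\<lambda>f. D a * E f)"
  by (rule vf_eqI[OF vf_bracket[OF _ vf_times] vf_plus[OF vf_times[OF vf_bracket] vf_times[OF _ vf_funs]]])
    (simp_all add: bracket_apply vf_mult algebra_simps)

lemma bracket_times_left:
  "D \<in> VF \<Longrightarrow> E \<in> VF \<Longrightarrow> a \<in> funs X \<Longrightarrow>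
   bracket (\<lambda>f. a * D f) E = (\<lambda>f. a * bracket D E f) - (\<lambda>f. E a * D f)"
  by (rule vf_eqI[OF vf_bracket[OF vf_times] vf_minus[OF vf_times[OF vf_bracket] vf_times[OF _ vf_funs]]])
    (simp_all add: bracket_apply vf_mult algebra_simps)

lemma bracket_self [simp]: "bracket D D = 0"
  by (simp add: bracket_def fun_eq_iff)

lemma bracket_zero_right [simp]: "D \<in> VF \<Longrightarrow> bracket D 0 = 0"
  by (simp add: bracket_def fun_eq_iff)

lemma bracket_jacobi:
  "D \<in> VF \<Longrightarrow> E \<in> VF \<Longrightarrow> v \<in> VF \<Longrightarrow>
   bracket D (bracket E v) = bracket E (bracket D v) + bracket (bracket D E) v"
  by (rule vf_eqI) (auto simp: bracket_apply vf_diff algebra_simps)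

lemma vf_generators:
  obtains m and Z :: "nat \<Rightarrow> 'a \<Rightarrow> complex" where "\<And>i. Z i \<in> funs X" "\<And>i. i \<ge> m \<Longrightarrow> Z i = 0"
    "\<And>D. D \<in> VF \<Longrightarrow> \<forall>i. D (Z i) = 0 \<Longrightarrow> D = 0"
proof -
  obtain m and Z :: "nat \<Rightarrow> 'a \<Rightarrow> complex" where Z: "\<And>i. Z i \<in> funs X" "\<And>i. i \<ge> m \<Longrightarrow> Z i = 0"
    and gen: "\<forall>G. (\<forall>c. const c * one_of X \<in> G) \<and> (\<forall>i. Z i \<in> G) \<and>
       (\<forall>f g. f \<in> funs X \<and> g \<in> funs X \<and> f \<in> G \<and> g \<in> G \<longrightarrow> f + g \<in> G \<and> f * g \<in> G) \<longrightarrow> funs X \<subseteq> G"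
    by (rule generators) blast
  have "D = 0" if D: "D \<in> VF" and 0: "\<forall>i. D (Z i) = 0" for D
  proof (rule vf_eqI[OF D vf_0])
    fix f assume f: "f \<in> funs X"
    have "funs X \<subseteq> {f. D f = 0}"
      by (rule gen[rule_format]) (use D 0 in \<open>simp add: vf_const vf_add vf_mult\<close>)
    then show "D f = 0 f" using f by auto
  qed
  then show thesis using that[of Z m] Z by blast
qed

section \<open>Iterates, kernels and local nilpotency\<close>

lemma vf_funpow [simp, intro]: "D \<in> VF \<Longrightarrow> f \<in> funs X \<Longrightarrow> (D ^^ k) f \<in> funs X"
  by (induction k) auto

lemma vf_funpow_zero [simp]: "D \<in> VF \<Longrightarrow> (D ^^ k) 0 = 0"
  by (induction k) auto

lemma vf_funpow_diff: "D \<in> VF \<Longrightarrow> f \<in> funs X \<Longrightarrow> g \<in> funs X \<Longrightarrow> (D ^^ k) (f - g) = (D ^^ k) f - (D ^^ k) g"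
  by (induction k) (auto simp: vf_diff)

lemma vf_funpow_const: "D \<in> VF \<Longrightarrow> f \<in> funs X \<Longrightarrow> (D ^^ k) (const c * f) = const c * (D ^^ k) f"
  by (induction k) (auto simp: vf_const)

lemma vf_funpow_add: "D \<in> VF \<Longrightarrow> f \<in> funs X \<Longrightarrow> g \<in> funs X \<Longrightarrow> (D ^^ k) (f + g) = (D ^^ k) f + (D ^^ k) g"
  by (induction k) (auto simp: vf_add)

lemma vf_funpow_mono: "D \<in> VF \<Longrightarrow> (D ^^ k) f = 0 \<Longrightarrow> k \<le> l \<Longrightarrow> (D ^^ l) f = 0"
  by (metis comp_apply funpow_add le_add_diff_inverse2 vf_funpow_zero)

definition Ker :: "'a vfield \<Rightarrow> ('a \<Rightarrow> complex) set" where
  "Ker D = {f \<in> funs X. D f = 0}"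

lemma KerI: "f \<in> funs X \<Longrightarrow> D f = 0 \<Longrightarrow> f \<in> Ker D"
  by (simp add: Ker_def)

lemma KerD [dest]: "f \<in> Ker D \<Longrightarrow> f \<in> funs X" "f \<in> Ker D \<Longrightarrow> D f = 0"
  by (simp_all add: Ker_def)

lemma Ker_mult: "D \<in> VF \<Longrightarrow> f \<in> Ker D \<Longrightarrow> g \<in> Ker D \<Longrightarrow> f * g \<in> Ker D"
  by (simp add: Ker_def vf_mult)

lemma Ker_const: "D \<in> VF \<Longrightarrow> f \<in> Ker D \<Longrightarrow> const c * f \<in> Ker D"
  by (simp add: Ker_def vf_const)

lemma Ker_one: "D \<in> VF \<Longrightarrow> one_of X \<in> Ker D"
  by (simp add: Ker_def)

lemma vf_Ker_mult: "D \<in> VF \<Longrightarrow> a \<in> Ker D \<Longrightarrow> f \<in> funs X \<Longrightarrow> D (a * f) = a * D f"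
  by (simp add: vf_mult KerD)

lemma vf_Ker_power_mult: "D \<in> VF \<Longrightarrow> a \<in> Ker D \<Longrightarrow> f \<in> funs X \<Longrightarrow> D (a ^ n * f) = a ^ n * D f"
  by (induction n) (simp_all add: mult.assoc vf_Ker_mult KerD(1)[of a D])

lemma vf_funpow_Ker_power_mult:
  "D \<in> VF \<Longrightarrow> a \<in> Ker D \<Longrightarrow> f \<in> funs X \<Longrightarrow> (D ^^ k) (a ^ n * f) = a ^ n * (D ^^ k) f"
  by (induction k) (simp_all add: vf_Ker_power_mult)

text \<open>The algebraic form of local nilpotency. Orders of nilpotency replace the action in the
  arguments about slices and divergence.\<close>

definition nilp :: "'a vfield \<Rightarrow> bool" where
  "nilp D \<longleftrightarrow> D \<in> VF \<and> (\<forall>f\<in>funs X. \<exists>k. (D ^^ k) f = 0)"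

lemma nilpD: "nilp D \<Longrightarrow> D \<in> VF" "nilp D \<Longrightarrow> f \<in> funs X \<Longrightarrow> \<exists>k. (D ^^ k) f = 0"
  by (auto simp: nilp_def)

lemma nilp_Ker_times: assumes "nilp D" "a \<in> Ker D" shows "nilp (\<lambda>f. a * D f)"
  unfolding nilp_def
proof (intro conjI ballI)
  have D: "D \<in> VF" using assms nilpD by blast
  show VF: "(\<lambda>f. a * D f) \<in> VF" using D assms by auto
  fix f assume f: "f \<in> funs X"
  then obtain k where k: "(D ^^ k) f = 0" using nilpD assms by blast
  have "((\<lambda>f. a * D f) ^^ k) f = a ^ k * (D ^^ k) f" for k
    by (induction k) (use D f assms in \<open>simp_all add: vf_Ker_power_mult mult.assoc\<close>)
  with k show "\<exists>k. ((\<lambda>f. a * D f) ^^ k) f = 0" by (metis mult_zero_right)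
qed

text \<open>In the Leibniz expansion every other term contains too high a derivative of
  \<open>f\<close> or of \<open>g\<close>. The constant is a binomial coefficient; what counts later
  is that it is positive.\<close>

lemma leibniz_top:
  assumes D: "D \<in> VF" and "f \<in> funs X" "g \<in> funs X" "(D ^^ Suc i) f = 0" "(D ^^ Suc j) g = 0"
  shows "(\<exists>c>0. (D ^^ (i + j)) (f * g) = const (of_nat c) * ((D ^^ i) f * (D ^^ j) g)) \<and>
    (D ^^ Suc (i + j)) (f * g) = 0"
  using assms(2-)
proof (induction "i + j" arbitrary: i j f g)
  case 0
  then show ?case using D
    by (auto simp: vf_mult const_def one_fun_def[symmetric] intro!: exI[of _ 1])
next
  case (Suc n)
  have step: "(D ^^ Suc k) (f * g) = (D ^^ k) (f * D g) + (D ^^ k) (D f * g)" for k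
    using D Suc.prems by (simp add: funpow_swap1 vf_mult vf_funpow_add mult.commute)
  have L: "(\<exists>c>0. (D ^^ n) (D f * g) = const (of_nat c) * ((D ^^ i) f * (D ^^ j) g)) \<and>
      (D ^^ Suc n) (D f * g) = 0" if "i \<noteq> 0"
  proof -
    obtain i' where i': "i = Suc i'" using \<open>i \<noteq> 0\<close> by (cases i) auto
    have n: "n = i' + j" using Suc.hyps(2) i' by simp
    have "(D ^^ Suc i') (D f) = 0" using Suc.prems(3) by (simp add: i' funpow_swap1)
    from Suc.hyps(1)[OF n _ Suc.prems(2) this Suc.prems(4)] D Suc.prems(1)
    have "(\<exists>c>0. (D ^^ n) (D f * g) = const (of_nat c) * ((D ^^ i') (D f) * (D ^^ j) g)) \<and>
      (D ^^ Suc n) (D f * g) = 0" by (simp only: n vf_funs)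
    then show ?thesis by (simp add: i' funpow_swap1)
  qed
  have R: "(\<exists>c>0. (D ^^ n) (f * D g) = const (of_nat c) * ((D ^^ i) f * (D ^^ j) g)) \<and>
      (D ^^ Suc n) (f * D g) = 0" if "j \<noteq> 0"
  proof -
    obtain j' where j': "j = Suc j'" using \<open>j \<noteq> 0\<close> by (cases j) auto
    have n: "n = i + j'" using Suc.hyps(2) j' by simp
    have "(D ^^ Suc j') (D g) = 0" using Suc.prems(4) by (simp add: j' funpow_swap1)
    from Suc.hyps(1)[OF n Suc.prems(1) _ Suc.prems(3) this] D Suc.prems(2)
    have "(\<exists>c>0. (D ^^ n) (f * D g) = const (of_nat c) * ((D ^^ i) f * (D ^^ j') (D g))) \<and>
      (D ^^ Suc n) (f * D g) = 0" by (simp only: n vf_funs)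
    then show ?thesis by (simp add: j' funpow_swap1)
  qed
  have 3: "D f * g = 0" if "i = 0" using Suc.prems that by simp
  have 4: "f * D g = 0" if "j = 0" using Suc.prems that by simp
  consider "i = 0" "j \<noteq> 0" | "i \<noteq> 0" "j = 0" | "i \<noteq> 0" "j \<noteq> 0" using Suc.hyps(2) by fastforce
  then show ?case
  proof cases
    case 1
    have e: "(D ^^ Suc k) (f * g) = (D ^^ k) (f * D g)" for k
      unfolding step 3[OF 1(1)] using D by simp
    show ?thesis using R[OF 1(2)] unfolding Suc.hyps(2)[symmetric] e by (simp only:)
  next
    case 2
    have e: "(D ^^ Suc k) (f * g) = (D ^^ k) (D f * g)" for k
      unfolding step 4[OF 2(2)] using D by simp
    show ?thesis using L[OF 2(1)] unfolding Suc.hyps(2)[symmetric] e by (simp only:)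
  next
    case 3
    obtain c d where "c > 0" "d > 0"
      "(D ^^ n) (D f * g) = const (of_nat c) * ((D ^^ i) f * (D ^^ j) g)"
      "(D ^^ n) (f * D g) = const (of_nat d) * ((D ^^ i) f * (D ^^ j) g)" using L[OF 3(1)] R[OF 3(2)] by blast
    then have "c + d > 0" "(D ^^ Suc n) (f * g) = const (of_nat (c + d)) * ((D ^^ i) f * (D ^^ j) g)"
      unfolding step by (simp, simp add: pointwise fun_eq_iff algebra_simps)
    moreover have "(D ^^ Suc (Suc n)) (f * g) = 0" using L[OF 3(1)] R[OF 3(2)] step[of "Suc n"] by simp
    ultimately show ?thesis unfolding Suc.hyps(2)[symmetric] by blast
  qed
qed

lemma nilp_order:
  assumes "nilp D" "f \<in> funs X" "f \<noteq> 0"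
  obtains k where "(D ^^ k) f \<noteq> 0" "(D ^^ Suc k) f = 0"
proof -
  define k where "k = (LEAST k. (D ^^ k) f = 0)"
  have k: "(D ^^ k) f = 0" unfolding k_def using nilpD(2)[OF assms(1,2)] by (rule LeastI_ex)
  then obtain k' where "k = Suc k'" using assms(3) by (cases k) auto
  moreover from this have "(D ^^ k') f \<noteq> 0" using not_less_Least[of k' "\<lambda>k. (D ^^ k) f = 0"] k_def by auto
  ultimately show thesis using that k by blast
qed

lemma const_mult_nonzero: "c \<noteq> 0 \<Longrightarrow> f \<noteq> 0 \<Longrightarrow> const c * f \<noteq> 0"
  by (auto simp: pointwise fun_eq_iff)

text \<open>In a domain of characteristic 0 the order of nilpotency of a product is the sum of the
  orders. So \<open>y * h\<close> has at least the order of \<open>y\<close>, while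
  \<open>D y\<close> has a smaller one.\<close>

lemma nilp_eigen:
  assumes "nilp D" "y \<in> funs X" "h \<in> funs X" "D y = y * h"
  shows "D y = 0"
proof (rule ccontr)
  assume nz: "D y \<noteq> 0"
  have D: "D \<in> VF" using assms nilpD by blast
  then have "y \<noteq> 0" "h \<noteq> 0" using nz assms by auto
  obtain i where i: "(D ^^ i) y \<noteq> 0" "(D ^^ Suc i) y = 0"
    using nilp_order[OF assms(1,2) \<open>y \<noteq> 0\<close>] by blast
  obtain j where j: "(D ^^ j) h \<noteq> 0" "(D ^^ Suc j) h = 0"
    using nilp_order[OF assms(1,3) \<open>h \<noteq> 0\<close>] by blast
  obtain c where c: "c > 0" "(D ^^ (i + j)) (y * h) = const (of_nat c) * ((D ^^ i) y * (D ^^ j) h)"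
    using leibniz_top[OF D assms(2,3) i(2) j(2)] by blast
  have "(D ^^ (i + j)) (D y) = (D ^^ Suc (i + j)) y" by (simp add: funpow_swap1)
  also have "\<dots> = 0" by (rule vf_funpow_mono[OF D i(2)]) simp
  finally have "const (of_nat c) * ((D ^^ i) y * (D ^^ j) h) = 0" using c(2) assms(4) by simp
  moreover have "(D ^^ i) y * (D ^^ j) h \<noteq> 0"
    using D assms i j by (intro funs_mult_nonzero) auto
  ultimately show False using const_mult_nonzero c(1) by (metis less_irrefl of_nat_eq_0_iff)
qed

text \<open>The iterated bracket applied to \<open>f\<close> expands into terms in which
  \<open>D\<close> acts before or after \<open>v\<close>, and many applications on either side give
  0. Since \<open>D\<close> is only locally nilpotent the bound depends on \<open>f\<close>, but a
  derivation is determined by its values on finitely many generators.\<close>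

lemma bracket_funpow_nilp:
  assumes "nilp D" "v \<in> VF"
  shows "\<exists>k. (bracket D ^^ k) v = 0"
proof -
  have D: "D \<in> VF" using assms nilpD by blast
  have V: "(bracket D ^^ n) v \<in> VF" for n
    by (induction n) (use D assms in auto)
  \<comment> \<open>Each bracket moves one \<open>D\<close> either to the outside or onto
    \<open>f\<close>. The outer power \<open>m\<close> records the former and makes the induction on
    \<open>n\<close> work; \<open>a\<close> bounds the latter.\<close>
  have T: "(D ^^ m) ((bracket D ^^ n) v f) = 0"
    if "f \<in> funs X" "(D ^^ a) f = 0" "\<And>i. (D ^^ b) (v ((D ^^ i) f)) = 0" "a + b \<le> m + n" for m n f a b
    using that
  proof (induction n arbitrary: m f a)
    case 0
    show ?case
    proof (rule vf_funpow_mono[OF D, of b])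
      show "(D ^^ b) ((bracket D ^^ 0) v f) = 0" using "0"(3)[of 0] by simp
    qed (use 0 in auto)
  next
    case (Suc n)
    have "(bracket D ^^ Suc n) v f = D ((bracket D ^^ n) v f) - (bracket D ^^ n) v (D f)"
      by (simp add: bracket_def)
    then have "(D ^^ m) ((bracket D ^^ Suc n) v f) =
        (D ^^ Suc m) ((bracket D ^^ n) v f) - (D ^^ m) ((bracket D ^^ n) v (D f))"
      using D V Suc.prems(1) by (simp add: vf_funpow_diff funpow_swap1)
    moreover have "(D ^^ Suc m) ((bracket D ^^ n) v f) = 0"
      using Suc.prems by (intro Suc.IH[of f a]) auto
    moreover have "(D ^^ m) ((bracket D ^^ n) v (D f)) = 0"
    proof (cases a)
      case 0
      then show ?thesis using Suc.prems(2) D V by simp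
    next
      case (Suc a')
      show ?thesis
      proof (rule Suc.IH[of _ a'])
        show "(D ^^ a') (D f) = 0" using Suc.prems(2) \<open>a = Suc a'\<close> by (simp add: funpow_swap1)
        show "(D ^^ b) (v ((D ^^ i) (D f))) = 0" for i
          using Suc.prems(3)[of "Suc i"] by (simp add: funpow_swap1)
      qed (use Suc.prems \<open>a = Suc a'\<close> D in auto)
    qed
    ultimately show ?case by simp
  qed
  have ex: "\<exists>k. \<forall>n\<ge>k. (bracket D ^^ n) v f = 0" if f: "f \<in> funs X" for f
  proof -
    obtain a where a: "(D ^^ a) f = 0" using nilpD(2)[OF assms(1) f] by blast
    have "\<exists>b. (D ^^ b) (v ((D ^^ i) f)) = 0" for i
      using nilpD(2)[OF assms(1)] assms(2) D f by blast
    then obtain b where b: "\<And>i. (D ^^ b i) (v ((D ^^ i) f)) = 0" by metis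
    define b' where "b' = Max (b ` {..a})"
    have "(D ^^ b') (v ((D ^^ i) f)) = 0" for i
    proof (cases "i \<le> a")
      case True
      then show ?thesis unfolding b'_def by (intro vf_funpow_mono[OF D b[of i]]) auto
    next
      case False
      then have "(D ^^ i) f = 0" using vf_funpow_mono[OF D a] by simp
      then show ?thesis using D assms(2) by simp
    qed
    from T[OF f a this, of 0] show ?thesis by (intro exI[of _ "a + b'"]) auto
  qed
  obtain m and Z :: "nat \<Rightarrow> 'a \<Rightarrow> complex" where Z: "\<And>i. Z i \<in> funs X" "\<And>i. i \<ge> m \<Longrightarrow> Z i = 0"
    "\<And>D. D \<in> VF \<Longrightarrow> \<forall>i. D (Z i) = 0 \<Longrightarrow> D = 0"
    by (rule vf_generators) blast
  obtain k where k: "\<And>i n. n \<ge> k i \<Longrightarrow> (bracket D ^^ n) v (Z i) = 0" using ex[OF Z(1)] by metis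
  define K where "K = Max (k ` {..m})"
  have "(bracket D ^^ K) v = 0"
  proof (rule Z(3)[OF V], rule allI)
    fix i
    show "(bracket D ^^ K) v (Z i) = 0"
    proof (cases "i \<le> m")
      case True
      then show ?thesis unfolding K_def by (intro k) auto
    next
      case False
      then show ?thesis using Z(2) V by simp
    qed
  qed
  then show ?thesis by blast
qed

section \<open>Rank of the module of derivations\<close>

lemma tangent_spaceD:
  assumes "v \<in> tangent_space X x"
  shows "f \<in> funs X \<Longrightarrow> g \<in> funs X \<Longrightarrow> v (f + g) = v f + v g"
    "f \<in> funs X \<Longrightarrow> g \<in> funs X \<Longrightarrow> v (f * g) = f x * v g + g x * v f"
    "f \<in> funs X \<Longrightarrow> v (const c * f) = c * v f"
    "f \<notin> funs X \<Longrightarrow> v f = 0"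
  using assms unfolding tangent_space_def const_def times_fun_def by blast+

lemma value_at_tangent:
  assumes "D \<in> VF" shows "value_at x D \<in> tangent_space X x"
  unfolding tangent_space_def value_at_def
proof (intro CollectI conjI ballI allI impI)
  fix f g assume "f \<in> funs X" "g \<in> funs X"
  then show "D (f + g) x = D f x + D g x" "D (f * g) x = f x * D g x + g x * D f x"
    using assms by (simp_all add: vf_add vf_mult pointwise)
next
  fix c f assume "f \<in> funs X"
  then show "D (\<lambda>y. c * f y) x = c * D f x"
    using fun_cong[OF vf_const[OF assms, of f c], of x] by (simp add: const_def times_fun_def)
next
  fix f assume "f \<notin> funs X"
  then show "D f x = 0" using assms by (simp add: vf_outside pointwise)
qed

lemma subspace_tangent_space: "cfun.subspace (tangent_space X x)"
  unfolding cfun.subspace_def tangent_space_def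
  by (auto simp: pointwise algebra_simps)

text \<open>The values on the finitely many nonzero generators embed the tangent space into a space
  of finite dimension.\<close>

lemma tangent_independent_finite:
  assumes x: "x \<in> points X" and ind: "cfun.independent U" and sub: "U \<subseteq> tangent_space X x"
  shows "finite U"
proof -
  obtain m and Z :: "nat \<Rightarrow> 'a \<Rightarrow> complex" where Z: "\<And>i. Z i \<in> funs X" "\<And>i. i \<ge> m \<Longrightarrow> Z i = 0"
    and gen: "\<forall>G. (\<forall>c. const c * one_of X \<in> G) \<and> (\<forall>i. Z i \<in> G) \<and>
       (\<forall>f g. f \<in> funs X \<and> g \<in> funs X \<and> f \<in> G \<and> g \<in> G \<longrightarrow> f + g \<in> G \<and> f * g \<in> G) \<longrightarrow> funs X \<subseteq> G"
    by (rule generators) blast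
  define r where "r v = (\<lambda>i. v (Z i))" for v :: "('a \<Rightarrow> complex) \<Rightarrow> complex"
  have ker: "v = 0" if v: "v \<in> tangent_space X x" and 0: "r v = 0" for v
  proof
    fix f
    have *: "v (Z i) = 0" for i using fun_cong[OF 0, of i] by (simp add: r_def pointwise)
    have "v (one_of X * one_of X) = one_of X x * v (one_of X) + one_of X x * v (one_of X)"
      by (intro tangent_spaceD(2)[OF v] one_of_funs)
    moreover have "one_of X x = 1" using x by (simp add: one_of_def)
    ultimately have "v (one_of X) = 0" by simp
    then have "funs X \<subseteq> {f. v f = 0}" using *
      by (intro gen[rule_format]) (simp add: tangent_spaceD[OF v])
    then show "v f = 0 f" using tangent_spaceD(4)[OF v, of f] by (auto simp: pointwise)
  qed
  interpret r: Vector_Spaces.linear "\<lambda>c v x. c * v x" "\<lambda>c v x. c * v x" r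
    unfolding Vector_Spaces.linear_iff
    by (intro conjI cfun.vector_space_axioms) (auto simp: r_def pointwise)
  have span: "cfun.span U \<subseteq> tangent_space X x"
    using sub subspace_tangent_space by (rule cfun.span_minimal)
  have inj: "inj_on r (cfun.span U)"
    unfolding r.inj_on_iff_eq_0[OF cfun.subspace_span] using ker span by blast
  have "cfun.independent (r ` U)"
    using ind inj unfolding cfun_span_def by (rule r.independent_injective_image)
  moreover have "r ` U \<subseteq> cfun.span ((\<lambda>i j. if j = i then 1 else 0) ` {..<m})"
  proof
    fix w assume "w \<in> r ` U"
    then obtain v where v: "v \<in> tangent_space X x" "w = r v" using sub by blast
    have "w = (\<Sum>i<m. (\<lambda>j. v (Z i) * (if j = i then 1 else 0)))"
    proof
      fix j
      have "v 0 = 0" using tangent_spaceD(1)[OF v(1), of 0 0] by simp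
      then have "v (Z j) = 0" if "j \<ge> m" using Z(2)[OF that] by simp
      then show "w j = (\<Sum>i<m. (\<lambda>j. v (Z i) * (if j = i then 1 else 0))) j"
        by (simp add: v(2) r_def pointwise if_distrib[of "(*) _"] cong: if_cong)
    qed
    also have "\<dots> \<in> cfun.span ((\<lambda>i j. if j = i then 1 else 0) ` {..<m})"
      by (intro cfun.span_sum cfun.span_scale cfun.span_base) auto
    finally show "w \<in> cfun.span ((\<lambda>i j. if j = i then 1 else 0) ` {..<m})" .
  qed
  ultimately have "finite (r ` U)"
    using cfun.independent_span_bound[of "(\<lambda>i j. if j = i then 1 else 0) ` {..<m}" "r ` U"] by blast
  moreover have "inj_on r U" using inj cfun.span_superset by (rule inj_on_subset)
  ultimately show ?thesis by (rule finite_imageD)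
qed

text \<open>Gaussian elimination: fields that are independent over the ring stay independent at
  points where no pivot vanishes. The function \<open>g\<close> collects the pivots of the earlier
  steps.\<close>

lemma independent_at_point:
  fixes r :: nat
  assumes "\<And>i. i < r \<Longrightarrow> v i \<in> VF"
    and "\<And>c. (\<And>i. i < r \<Longrightarrow> c i \<in> funs X) \<Longrightarrow> (\<And>f. f \<in> funs X \<Longrightarrow> (\<Sum>i<r. c i * v i f) = 0) \<Longrightarrow> \<forall>i<r. c i = 0"
    and "g \<in> funs X" "g \<noteq> 0"
  shows "\<exists>x\<in>points X. g x \<noteq> 0 \<and>
    (\<forall>\<mu>. (\<forall>f\<in>funs X. (\<Sum>i<r. \<mu> i * v i f x) = 0) \<longrightarrow> (\<forall>i<r. \<mu> i = 0))"
  using assms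
proof (induction r arbitrary: v g)
  case 0
  have "\<exists>x\<in>points X. g x \<noteq> 0"
  proof (rule ccontr)
    assume "\<not> (\<exists>x\<in>points X. g x \<noteq> 0)"
    then have "g = 0" using 0 by (intro funs_eqI) (auto simp: pointwise)
    then show False using 0 by simp
  qed
  then show ?case by simp
next
  case (Suc r)
  have v: "v i \<in> VF" if "i \<le> r" for i using Suc.prems(1)[of i] that by simp
  have "\<exists>f\<in>funs X. v r f \<noteq> 0"
  proof (rule ccontr)
    assume n: "\<not> (\<exists>f\<in>funs X. v r f \<noteq> 0)"
    have "\<forall>i<Suc r. (if i = r then one_of X else 0) = 0"
    proof (rule Suc.prems(2))
      fix f assume "f \<in> funs X"
      then show "(\<Sum>i<Suc r. (if i = r then one_of X else 0) * v i f) = 0"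
        using n by (simp add: if_distrib[of "\<lambda>z. z * _"] cong: if_cong)
    qed auto
    then show False by auto
  qed
  then obtain h where h: "h \<in> funs X" "v r h \<noteq> 0" by blast
  have hr: "v r h \<in> funs X" using v h by auto
  \<comment> \<open>The pivot is \<open>v r h\<close>; the combination is chosen such that
    \<open>v' i h = 0\<close>.\<close>
  define v' where "v' i = (\<lambda>f. v r h * v i f) - (\<lambda>f. v i h * v r f)" for i
  have "\<exists>x\<in>points X. (g * v r h) x \<noteq> 0 \<and>
    (\<forall>\<mu>. (\<forall>f\<in>funs X. (\<Sum>i<r. \<mu> i * v' i f x) = 0) \<longrightarrow> (\<forall>i<r. \<mu> i = 0))"
  proof (rule Suc.IH)
    show "v' i \<in> VF" if "i < r" for i
      unfolding v'_def using that
      by (simp add: vf_minus[OF vf_times[OF v hr] vf_times[OF v vf_funs[OF v h(1)]]])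
    show "g * v r h \<in> funs X" using Suc.prems(3) hr by auto
    show "g * v r h \<noteq> 0" using Suc.prems(3,4) hr h by (intro funs_mult_nonzero) auto
    fix c assume c: "\<And>i. i < r \<Longrightarrow> c i \<in> funs X" "\<And>f. f \<in> funs X \<Longrightarrow> (\<Sum>i<r. c i * v' i f) = 0"
    define d where "d i = (if i = r then - (\<Sum>i<r. c i * v i h) else c i * v r h)" for i
    have "\<forall>i<Suc r. d i = 0"
    proof (rule Suc.prems(2))
      fix i assume "i < Suc r"
      then show "d i \<in> funs X"
        using c(1) hr h v unfolding d_def by (auto intro!: funs_uminus funs_sum)
    next
      fix f assume f: "f \<in> funs X"
      have "(\<Sum>i<Suc r. d i * v i f) = (\<Sum>i<r. c i * v r h * v i f) - (\<Sum>i<r. c i * v i h) * v r f"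
        by (simp add: d_def)
      also have "\<dots> = (\<Sum>i<r. c i * v' i f)"
        by (simp add: v'_def sum_distrib_left sum_distrib_right sum_subtractf algebra_simps)
      finally show "(\<Sum>i<Suc r. d i * v i f) = 0" using c(2)[OF f] by simp
    qed
    then have "c i * v r h = 0" if "i < r" for i using that by (auto simp: d_def dest: spec[of _ i])
    then show "\<forall>i<r. c i = 0" using funs_domain[OF c(1) hr] h(2) by blast
  qed
  then obtain x where x: "x \<in> points X" "g x \<noteq> 0" "v r h x \<noteq> 0"
    and IH: "\<And>\<mu>. (\<And>f. f \<in> funs X \<Longrightarrow> (\<Sum>i<r. \<mu> i * v' i f x) = 0) \<Longrightarrow> \<forall>i<r. \<mu> i = 0"
    by (auto simp: pointwise)
  have "\<forall>i<Suc r. \<mu> i = 0" if \<mu>: "\<And>f. f \<in> funs X \<Longrightarrow> (\<Sum>i<Suc r. \<mu> i * v i f x) = 0" for \<mu>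
  proof -
    have "\<forall>i<r. \<mu> i = 0"
    proof (rule IH)
      fix f assume f: "f \<in> funs X"
      have 1: "(\<Sum>i<r. \<mu> i * v i f x) = - \<mu> r * v r f x"
        if "f \<in> funs X" for f using \<mu>[OF that] by (simp add: eq_neg_iff_add_eq_0 pointwise)
      have "(\<Sum>i<r. \<mu> i * v' i f x) = v r h x * (\<Sum>i<r. \<mu> i * v i f x) - (\<Sum>i<r. \<mu> i * v i h x) * v r f x"
        by (simp add: v'_def pointwise sum_distrib_left sum_distrib_right sum_subtractf algebra_simps)
      then show "(\<Sum>i<r. \<mu> i * v' i f x) = 0"
        by (simp add: 1 f h pointwise)
    qed
    moreover from this have "\<mu> r = 0" using \<mu>[OF h(1)] x(3) by simp
    ultimately show ?thesis using less_Suc_eq by auto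
  qed
  then show ?case using x by blast
qed

text \<open>Independent derivations have independent values at some point, and there the tangent
  space has only the dimension of \<open>X\<close>.\<close>

lemma vf_dependent:
  assumes smooth: "smooth_variety X" and v: "\<And>i. i \<le> variety_dim X \<Longrightarrow> v i \<in> VF"
  shows "\<exists>c. (\<forall>i\<le>variety_dim X. c i \<in> funs X) \<and> (\<exists>i\<le>variety_dim X. c i \<noteq> 0) \<and>
    (\<forall>f. (\<Sum>i\<le>variety_dim X. c i * v i f) = 0)"
proof (rule ccontr)
  define n where "n = variety_dim X"
  assume *: "\<not> ?thesis"
  have ind: "\<forall>i<Suc n. c i = 0"
    if c: "\<And>i. i < Suc n \<Longrightarrow> c i \<in> funs X" "\<And>f. f \<in> funs X \<Longrightarrow> (\<Sum>i<Suc n. c i * v i f) = 0" for c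
  proof -
    have "(\<Sum>i\<le>n. c i * v i f) = 0" for f
    proof (cases "f \<in> funs X")
      case True
      then show ?thesis using c(2) by (simp add: lessThan_Suc_atMost)
    next
      case False
      then show ?thesis using v by (intro sum.neutral) (auto simp: vf_outside n_def)
    qed
    then show ?thesis using * c(1) unfolding n_def by (metis less_Suc_eq_le)
  qed
  have "\<exists>x\<in>points X. one_of X x \<noteq> 0 \<and>
    (\<forall>\<mu>. (\<forall>f\<in>funs X. (\<Sum>i<Suc n. \<mu> i * v i f x) = 0) \<longrightarrow> (\<forall>i<Suc n. \<mu> i = 0))"
    using v by (intro independent_at_point ind) (auto simp: n_def)
  then obtain x where x: "x \<in> points X"
    and indx: "\<And>\<mu>. (\<And>f. f \<in> funs X \<Longrightarrow> (\<Sum>i<Suc n. \<mu> i * v i f x) = 0) \<Longrightarrow> \<forall>i<Suc n. \<mu> i = 0"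
    by blast
  define w where "w i = value_at x (v i)" for i
  have inj: "inj_on w {..<Suc n}"
  proof (rule inj_onI, rule ccontr)
    fix i j assume ij: "i \<in> {..<Suc n}" "j \<in> {..<Suc n}" "w i = w j" "i \<noteq> j"
    have "\<forall>l<Suc n. (if l = i then 1 else if l = j then - 1 else 0) = (0::complex)"
    proof (rule indx)
      fix f
      have "(\<Sum>l<Suc n. (if l = i then 1 else if l = j then - 1 else 0) * v l f x)
        = (\<Sum>l<Suc n. (if l = i then v l f x else 0) - (if l = j then v l f x else 0))"
        using ij(4) by (intro sum.cong) (auto simp: pointwise)
      also have "\<dots> = v i f x - v j f x"
        using ij(1,2) by (simp only: sum_subtractf sum.delta finite_lessThan if_True)
      also have "\<dots> = 0" using fun_cong[OF ij(3), of f] by (simp add: w_def value_at_def)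
      finally show "(\<Sum>l<Suc n. (if l = i then 1 else if l = j then - 1 else 0) * v l f x) = 0" .
    qed
    from this[rule_format, of i] show False using ij(1) by simp
  qed
  have indep: "cfun.independent (w ` {..<Suc n})"
  proof
    assume "cfun.dependent (w ` {..<Suc n})"
    then obtain u where u: "\<exists>y\<in>w ` {..<Suc n}. u y \<noteq> 0" "(\<Sum>y\<in>w ` {..<Suc n}. (\<lambda>f. u y * y f)) = 0"
      by (subst (asm) cfun.dependent_finite) auto
    have "\<forall>i<Suc n. u (w i) = 0"
    proof (rule indx)
      fix f
      have "(\<Sum>i<Suc n. u (w i) * v i f x) = (\<Sum>y\<in>w ` {..<Suc n}. (\<lambda>f. u y * y f)) f"
        unfolding sum.reindex[OF inj] by (simp add: fun_sum_apply w_def value_at_def del: sum.lessThan_Suc)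
      then show "(\<Sum>i<Suc n. u (w i) * v i f x) = 0" by (simp add: u(2) pointwise del: sum.lessThan_Suc)
    qed
    then show False using u(1) by auto
  qed
  have sub: "w ` {..<Suc n} \<subseteq> tangent_space X x"
    using v value_at_tangent by (auto simp: w_def n_def)
  obtain Bs where Bs: "Bs \<subseteq> tangent_space X x" "cfun.independent Bs"
    "tangent_space X x \<subseteq> cfun.span Bs" "card Bs = cfun.dim (tangent_space X x)"
    by (rule cfun.basis_exists)
  \<comment> \<open>An infinite basis would have \<open>card\<close> 0, and the comparison of
    cardinalities would say nothing.\<close>
  have "finite Bs" using tangent_independent_finite[OF x Bs(2,1)] .
  then have "card (w ` {..<Suc n}) \<le> card Bs"
    using cfun.independent_span_bound[OF _ indep] sub Bs(3) by blast
  then have "Suc n \<le> cfun.dim (tangent_space X x)"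
    using card_image[OF inj] Bs(4) by simp
  moreover have "cfun_dim (tangent_space X x) = n"
    using smooth x unfolding smooth_variety_def n_def by blast
  ultimately show False by simp
qed

end

section \<open>Differential forms\<close>

lemma del_nth_0 [simp]: "del_nth 0 (v # vs) = vs"
  by (simp add: del_nth_def)

lemma del_nth_Suc [simp]: "del_nth (Suc i) (v # vs) = v # del_nth i vs"
  by (simp add: del_nth_def)

lemma set_del_nth: "set (del_nth i vs) \<subseteq> set vs"
  unfolding del_nth_def by (auto dest: in_set_takeD in_set_dropD)

lemma const_uminus: "const (- c) = - const c"
  by (simp add: const_def fun_Compl_def)

lemma const_one [simp]: "const 1 = 1"
  by (simp add: const_def one_fun_def)

lemma const_mult: "const (c * d) = const c * const d"
  by (simp add: const_def times_fun_def)

lemma const_minus_one_square [simp]: "const ((- 1) ^ i) * (const ((- 1) ^ i) * f) = f"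
  by (simp add: mult.assoc[symmetric] const_mult[symmetric] power_mult_distrib[symmetric])

context affine_var
begin

lemma forms_outside: "\<tau> \<in> forms X k \<Longrightarrow> \<not> (length vs = k \<and> set vs \<subseteq> VF) \<Longrightarrow> \<tau> vs = 0"
  unfolding forms_def by blast

lemma forms_funs: "\<tau> \<in> forms X k \<Longrightarrow> \<tau> vs \<in> funs X"
  by (cases "length vs = k \<and> set vs \<subseteq> VF") (auto simp: forms_def)

lemma forms_add_arg:
  "\<tau> \<in> forms X k \<Longrightarrow> D \<in> VF \<Longrightarrow> E \<in> VF \<Longrightarrow> set us \<subseteq> VF \<Longrightarrow> set ws \<subseteq> VF \<Longrightarrow>
   \<tau> (us @ (D + E) # ws) = \<tau> (us @ D # ws) + \<tau> (us @ E # ws)"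
  unfolding forms_def using funs_zero by blast

lemma forms_times_arg:
  "\<tau> \<in> forms X k \<Longrightarrow> D \<in> VF \<Longrightarrow> a \<in> funs X \<Longrightarrow> set us \<subseteq> VF \<Longrightarrow> set ws \<subseteq> VF \<Longrightarrow>
   \<tau> (us @ (\<lambda>f. a * D f) # ws) = a * \<tau> (us @ D # ws)"
  unfolding forms_def by blast

lemma forms_repeat: "\<tau> \<in> forms X k \<Longrightarrow> \<not> distinct vs \<Longrightarrow> \<tau> vs = 0"
  unfolding forms_def by blast

lemmas forms_add_hd = forms_add_arg[where us = "[]", simplified]
lemmas forms_times_hd = forms_times_arg[where us = "[]", simplified]

lemma forms_zero_arg:
  assumes "\<tau> \<in> forms X k" "set us \<subseteq> VF" "set ws \<subseteq> VF" shows "\<tau> (us @ 0 # ws) = 0"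
  using forms_add_arg[OF assms(1) vf_0 vf_0 assms(2,3)] by simp

lemma forms_uminus_arg:
  assumes "\<tau> \<in> forms X k" "D \<in> VF" "set us \<subseteq> VF" "set ws \<subseteq> VF"
  shows "\<tau> (us @ (- D) # ws) = - \<tau> (us @ D # ws)"
  using forms_add_arg[OF assms(1,2) vf_neg[OF assms(2)] assms(3,4)] forms_zero_arg[OF assms(1,3,4)]
  by (simp add: eq_neg_iff_add_eq_0 add.commute)

lemma forms_diff_arg:
  assumes "\<tau> \<in> forms X k" "D \<in> VF" "E \<in> VF" "set us \<subseteq> VF" "set ws \<subseteq> VF"
  shows "\<tau> (us @ (D - E) # ws) = \<tau> (us @ D # ws) - \<tau> (us @ E # ws)"
  using forms_add_arg[OF assms(1,2) vf_neg[OF assms(3)] assms(4,5)] forms_uminus_arg[OF assms(1,3,4,5)]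
  by simp

lemma forms_sum_arg:
  assumes "\<tau> \<in> forms X k" "set us \<subseteq> VF" "set ws \<subseteq> VF"
    and "\<And>i. i \<in> I \<Longrightarrow> c i \<in> funs X" "\<And>i. i \<in> I \<Longrightarrow> v i \<in> VF" "finite I"
  shows "(\<lambda>f. \<Sum>i\<in>I. c i * v i f) \<in> VF \<and>
    \<tau> (us @ (\<lambda>f. \<Sum>i\<in>I. c i * v i f) # ws) = (\<Sum>i\<in>I. c i * \<tau> (us @ v i # ws))"
  using assms(6,4,5)
proof (induction I)
  case empty
  have "(\<lambda>f. 0) = (0 :: 'a vfield)" by (simp add: fun_eq_iff)
  then show ?case using forms_zero_arg[OF assms(1,2,3)] by simp
next
  case (insert i I)
  have e: "(\<lambda>f. \<Sum>i\<in>insert i I. c i * v i f) = (\<lambda>f. c i * v i f) + (\<lambda>f. \<Sum>i\<in>I. c i * v i f)"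
    using insert.hyps by (simp add: fun_eq_iff)
  have IH: "(\<lambda>f. \<Sum>i\<in>I. c i * v i f) \<in> VF"
    "\<tau> (us @ (\<lambda>f. \<Sum>i\<in>I. c i * v i f) # ws) = (\<Sum>i\<in>I. c i * \<tau> (us @ v i # ws))"
    using insert by auto
  have VFi: "(\<lambda>f. c i * v i f) \<in> VF" using insert.prems by (intro vf_times) auto
  show ?case
    unfolding e forms_add_arg[OF assms(1) VFi IH(1) assms(2,3)] IH(2)
    using insert.prems insert.hyps forms_times_arg[OF assms(1) _ _ assms(2,3), of "v i" "c i"]
      vf_plus[OF VFi IH(1)] by simp
qed

lemma forms_swap:
  assumes \<tau>: "\<tau> \<in> forms X k" and D: "D \<in> VF" and E: "E \<in> VF" and us: "set us \<subseteq> VF" and ws: "set ws \<subseteq> VF"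
  shows "\<tau> (us @ D # E # ws) = - \<tau> (us @ E # D # ws)"
proof -
  have DE: "D + E \<in> VF" using D E by simp
  have r: "\<tau> (us @ F # F # ws) = 0" for F by (intro forms_repeat[OF \<tau>]) simp
  have "0 = \<tau> (us @ (D + E) # (D + E) # ws)" by (simp add: r)
  also have "\<dots> = \<tau> (us @ D # (D + E) # ws) + \<tau> (us @ E # (D + E) # ws)"
    using D E DE us ws by (intro forms_add_arg[OF \<tau>]) auto
  also have "\<tau> (us @ D # (D + E) # ws) = \<tau> (us @ D # D # ws) + \<tau> (us @ D # E # ws)"
    using forms_add_arg[OF \<tau> D E, of "us @ [D]" ws] D us ws by simp
  also have "\<tau> (us @ E # (D + E) # ws) = \<tau> (us @ E # D # ws) + \<tau> (us @ E # E # ws)"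
    using forms_add_arg[OF \<tau> D E, of "us @ [E]" ws] E us ws by simp
  finally show ?thesis by (simp add: r eq_neg_iff_add_eq_0)
qed

lemma forms_move:
  assumes \<tau>: "\<tau> \<in> forms X k" and D: "D \<in> VF" and us: "set us \<subseteq> VF" and ps: "set ps \<subseteq> VF" and ws: "set ws \<subseteq> VF"
  shows "\<tau> (us @ D # ps @ ws) = const ((- 1) ^ length ps) * \<tau> (us @ ps @ D # ws)"
  using us ps
proof (induction ps arbitrary: us)
  case Nil
  then show ?case by simp
next
  case (Cons p ps)
  have "\<tau> (us @ D # p # ps @ ws) = - \<tau> (us @ p # D # ps @ ws)"
    using Cons.prems D ws by (intro forms_swap[OF \<tau>]) auto
  also have "\<tau> (us @ p # D # ps @ ws) = const ((- 1) ^ length ps) * \<tau> (us @ (p # ps) @ D # ws)"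
    using Cons.IH[of "us @ [p]"] Cons.prems by simp
  finally show ?case by (simp add: const_uminus)
qed

lemma forms_move_zero:
  assumes "\<tau> \<in> forms X k" "D \<in> VF" "set us \<subseteq> VF" "set ps \<subseteq> VF" "set ws \<subseteq> VF"
  shows "\<tau> (us @ D # ps @ ws) = 0 \<longleftrightarrow> \<tau> (us @ ps @ D # ws) = 0"
  unfolding forms_move[OF assms] using const_minus_one_square[of "length ps" "\<tau> (us @ ps @ D # ws)"]
  by (metis mult_zero_right)

text \<open>Only vanishing is compared, so the sign of the permutation need not be tracked.\<close>

lemma forms_mset_zero:
  assumes \<tau>: "\<tau> \<in> forms X k" and "set ps \<subseteq> VF" "set us \<subseteq> VF" "mset us = mset us'"
  shows "\<tau> (ps @ us) = 0 \<longleftrightarrow> \<tau> (ps @ us') = 0"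
  using assms(2-)
proof (induction us arbitrary: ps us')
  case Nil
  then show ?case by simp
next
  case (Cons x xs)
  have "x \<in> set us'" using Cons.prems(3) by (metis list.set_intros(1) set_mset_mset)
  then obtain l r where us': "us' = l @ x # r" by (meson split_list)
  have m: "mset xs = mset (l @ r)" using Cons.prems(3) by (simp add: us')
  have sub: "set (l @ r) \<subseteq> VF" using Cons.prems(2) m by (metis list.set_intros(2) set_mset_mset subset_code(1))
  have "\<tau> (ps @ x # xs) = 0 \<longleftrightarrow> \<tau> (ps @ x # l @ r) = 0"
    using Cons.IH[of "ps @ [x]" "l @ r"] Cons.prems m by simp
  also have "\<dots> \<longleftrightarrow> \<tau> (ps @ l @ x # r) = 0"
    using Cons.prems sub by (intro forms_move_zero[OF \<tau>]) auto
  finally show ?case by (simp add: us')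
qed

lemma forms_zero [simp, intro]: "0 \<in> forms X k"
  unfolding forms_def by auto

lemma forms_plus [simp, intro]: "\<sigma> \<in> forms X k \<Longrightarrow> \<tau> \<in> forms X k \<Longrightarrow> \<sigma> + \<tau> \<in> forms X k"
  unfolding forms_def by (simp add: algebra_simps)

lemma forms_times [simp, intro]: "\<tau> \<in> forms X k \<Longrightarrow> a \<in> funs X \<Longrightarrow> (\<lambda>vs. a * \<tau> vs) \<in> forms X k"
  unfolding forms_def by (simp add: algebra_simps)

lemma forms_uminus: "\<tau> \<in> forms X k \<Longrightarrow> - \<tau> \<in> forms X k"
  unfolding forms_def by simp

lemma forms_minus [simp, intro]: "\<sigma> \<in> forms X k \<Longrightarrow> \<tau> \<in> forms X k \<Longrightarrow> \<sigma> - \<tau> \<in> forms X k"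
  using forms_plus[of \<sigma> k "- \<tau>"] forms_uminus by simp

lemma interior_apply [simp]: "interior_product D \<tau> vs = \<tau> (D # vs)"
  by (simp add: interior_product_def)

lemma interior_forms [simp, intro]:
  assumes \<tau>: "\<tau> \<in> forms X (Suc k)" and D: "D \<in> VF"
  shows "interior_product D \<tau> \<in> forms X k"
  unfolding forms_def
proof (intro CollectI conjI allI impI ballI)
  fix vs show "\<not> (length vs = k \<and> set vs \<subseteq> VF) \<Longrightarrow> interior_product D \<tau> vs = 0"
    using forms_outside[OF \<tau>, of "D # vs"] D by auto
  show "\<not> distinct vs \<Longrightarrow> interior_product D \<tau> vs = 0"
    using forms_repeat[OF \<tau>] by auto
  show "interior_product D \<tau> vs \<in> funs X" using forms_funs[OF \<tau>] by simp
next
  fix us ws E F a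
  assume "E \<in> VF" "F \<in> VF" "a \<in> funs X" "set us \<subseteq> VF \<and> set ws \<subseteq> VF"
  then show "interior_product D \<tau> (us @ (E + F) # ws) =
       interior_product D \<tau> (us @ E # ws) + interior_product D \<tau> (us @ F # ws)"
    "interior_product D \<tau> (us @ (\<lambda>f. a * E f) # ws) = a * interior_product D \<tau> (us @ E # ws)"
    using forms_add_arg[OF \<tau>, of E F "D # us" ws] forms_times_arg[OF \<tau>, of E a "D # us" ws] D
    by simp_all
qed

lemma interior_forms_0: "\<tau> \<in> forms X 0 \<Longrightarrow> interior_product D \<tau> = 0"
  by (rule ext) (simp add: forms_outside)

text \<open>For induction on the degree: the interior products account for all arguments but the
  first, which leaves linearity in the first argument and a repetition in the first two
  places.\<close>

lemma formsI:
  assumes out: "\<And>vs. \<not> (length vs = Suc k \<and> set vs \<subseteq> VF) \<Longrightarrow> T vs = 0"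
    and tail: "\<And>v. v \<in> VF \<Longrightarrow> interior_product v T \<in> forms X k"
    and add: "\<And>v w vs. v \<in> VF \<Longrightarrow> w \<in> VF \<Longrightarrow> set vs \<subseteq> VF \<Longrightarrow> T ((v + w) # vs) = T (v # vs) + T (w # vs)"
    and times: "\<And>v a vs. v \<in> VF \<Longrightarrow> a \<in> funs X \<Longrightarrow> set vs \<subseteq> VF \<Longrightarrow> T ((\<lambda>f. a * v f) # vs) = a * T (v # vs)"
    and alt: "\<And>v vs. v \<in> VF \<Longrightarrow> set vs \<subseteq> VF \<Longrightarrow> T (v # v # vs) = 0"
  shows "T \<in> forms X (Suc k)"
  unfolding forms_def
proof (intro CollectI conjI allI impI ballI)
  fix vs
  show "\<not> (length vs = Suc k \<and> set vs \<subseteq> VF) \<Longrightarrow> T vs = 0" by (rule out)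
  show "T vs \<in> funs X" if "length vs = Suc k \<and> set vs \<subseteq> VF"
    using that forms_funs[OF tail] by (cases vs) auto
  show "T vs = 0" if nd: "\<not> distinct vs"
  proof (cases "set vs \<subseteq> VF")
    case True
    then obtain v ws where vs: "vs = v # ws" using nd by (cases vs) auto
    have VF: "v \<in> VF" "set ws \<subseteq> VF" using True vs by auto
    have swap: "T (v # w # us) = - T (w # v # us)" if "w \<in> VF" "set us \<subseteq> VF" for w us
    proof -
      have vw: "v + w \<in> VF" using VF that by simp
      have "0 = T ((v + w) # (v + w) # us)" using alt[OF vw that(2)] by simp
      also have "\<dots> = T (v # (v + w) # us) + T (w # (v + w) # us)"
        using VF that by (intro add) auto
      also have "T (v # (v + w) # us) = T (v # v # us) + T (v # w # us)"
        using forms_add_hd[OF tail[OF VF(1)] VF(1) that] by simp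
      also have "T (w # (v + w) # us) = T (w # v # us) + T (w # w # us)"
        using forms_add_hd[OF tail[OF that(1)] VF(1) that] by simp
      finally show ?thesis using alt VF that by (simp add: eq_neg_iff_add_eq_0)
    qed
    show ?thesis
    proof (cases "distinct ws")
      case False
      then show ?thesis using forms_repeat[OF tail[OF VF(1)], of ws] by (simp add: vs)
    next
      case True
      then have "v \<in> set ws" using nd vs by simp
      then obtain ps qs where ws: "ws = ps @ v # qs" by (meson split_list)
      show ?thesis
      proof (cases ps)
        case Nil
        then show ?thesis using alt VF by (simp add: vs ws)
      next
        case (Cons p ps')
        \<comment> \<open>After exchanging the first two entries, both copies of \<open>v\<close>
          stand behind \<open>p\<close> and are seen by the interior product with
          \<open>p\<close>.\<close>
        have "T vs = - T (p # v # ps' @ v # qs)"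
          using swap[of p "ps' @ v # qs"] VF by (simp add: vs ws Cons)
        also have "T (p # v # ps' @ v # qs) = 0"
          using forms_repeat[OF tail, of p "v # ps' @ v # qs"] VF by (simp add: ws Cons)
        finally show ?thesis by simp
      qed
    qed
  next
    case False
    then show ?thesis using out by blast
  qed
next
  fix us ws D E a
  assume "D \<in> VF" "E \<in> VF" "a \<in> funs X" "set us \<subseteq> VF \<and> set ws \<subseteq> VF"
  then show "T (us @ (D + E) # ws) = T (us @ D # ws) + T (us @ E # ws)"
    "T (us @ (\<lambda>f. a * D f) # ws) = a * T (us @ D # ws)"
    using forms_add_arg[OF tail, of _ D E "tl us" ws] forms_times_arg[OF tail, of _ D a "tl us" ws]
      add[of D E ws] times[of D a ws] by (cases us; simp)+
qed

section \<open>Lie derivatives\<close>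

lemma lie_derivative_eq:
  "lie_derivative X D \<tau> vs = (if set vs \<subseteq> VF then
     D (\<tau> vs) - (\<Sum>i<length vs. \<tau> (vs[i := bracket D (vs ! i)])) else 0)"
  by (auto simp: lie_derivative_def pointwise fun_eq_iff)

lemma lie_derivative_Nil: "lie_derivative X D \<tau> [] = D (\<tau> [])"
  by (simp add: lie_derivative_eq)

lemma lie_derivative_Cons:
  assumes "v \<in> VF" "set vs \<subseteq> VF"
  shows "lie_derivative X D \<tau> (v # vs) =
    lie_derivative X D (interior_product v \<tau>) vs - \<tau> (bracket D v # vs)"
  using assms by (simp add: lie_derivative_eq sum.lessThan_Suc_shift del: sum.lessThan_Suc)

lemma lie_derivative_outside: "\<not> set vs \<subseteq> VF \<Longrightarrow> lie_derivative X D \<tau> vs = 0"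
  by (simp add: lie_derivative_eq)

lemma lie_derivative_zero [simp]: "D \<in> VF \<Longrightarrow> lie_derivative X D 0 = 0"
  by (simp add: fun_eq_iff[where f = "lie_derivative X D 0"] lie_derivative_eq)

lemma lie_derivative_diff:
  assumes "D \<in> VF" "\<And>vs. \<sigma> vs \<in> funs X" "\<And>vs. \<tau> vs \<in> funs X"
  shows "lie_derivative X D (\<sigma> - \<tau>) = lie_derivative X D \<sigma> - lie_derivative X D \<tau>"
proof
  fix vs
  show "lie_derivative X D (\<sigma> - \<tau>) vs = (lie_derivative X D \<sigma> - lie_derivative X D \<tau>) vs"
    using assms by (simp add: lie_derivative_eq vf_diff sum_subtractf algebra_simps)
qed

lemma lie_derivative_plus:
  assumes "D \<in> VF" "\<And>vs. \<sigma> vs \<in> funs X" "\<And>vs. \<tau> vs \<in> funs X"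
  shows "lie_derivative X D (\<sigma> + \<tau>) = lie_derivative X D \<sigma> + lie_derivative X D \<tau>"
proof
  fix vs
  show "lie_derivative X D (\<sigma> + \<tau>) vs = (lie_derivative X D \<sigma> + lie_derivative X D \<tau>) vs"
    using assms by (simp add: lie_derivative_eq vf_add sum.distrib algebra_simps)
qed

lemma lie_derivative_times:
  assumes "D \<in> VF" "a \<in> funs X" "\<And>vs. \<tau> vs \<in> funs X"
  shows "lie_derivative X D (\<lambda>vs. a * \<tau> vs) = (\<lambda>vs. a * lie_derivative X D \<tau> vs + (if set vs \<subseteq> VF then D a * \<tau> vs else 0))"
proof
  fix vs
  show "lie_derivative X D (\<lambda>vs. a * \<tau> vs) vs = a * lie_derivative X D \<tau> vs + (if set vs \<subseteq> VF then D a * \<tau> vs else 0)"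
    using assms by (simp add: lie_derivative_eq vf_mult sum_distrib_left algebra_simps)
qed

lemma interior_plus:
  "\<tau> \<in> forms X k \<Longrightarrow> v \<in> VF \<Longrightarrow> w \<in> VF \<Longrightarrow>
   interior_product (v + w) \<tau> = interior_product v \<tau> + interior_product w \<tau>"
proof
  fix vs assume "\<tau> \<in> forms X k" "v \<in> VF" "w \<in> VF"
  then show "interior_product (v + w) \<tau> vs = (interior_product v \<tau> + interior_product w \<tau>) vs"
    by (cases "set vs \<subseteq> VF") (simp_all add: forms_add_hd forms_outside)
qed

lemma interior_times:
  "\<tau> \<in> forms X k \<Longrightarrow> v \<in> VF \<Longrightarrow> a \<in> funs X \<Longrightarrow>
   interior_product (\<lambda>f. a * v f) \<tau> = (\<lambda>vs. a * interior_product v \<tau> vs)"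
proof
  fix vs assume "\<tau> \<in> forms X k" "v \<in> VF" "a \<in> funs X"
  then show "interior_product (\<lambda>f. a * v f) \<tau> vs = a * interior_product v \<tau> vs"
    by (cases "set vs \<subseteq> VF") (simp_all add: forms_times_hd forms_outside)
qed

lemma interior_lie_derivative:
  assumes "v \<in> VF" "D \<in> VF" "\<tau> \<in> forms X k"
  shows "interior_product v (lie_derivative X D \<tau>) =
    lie_derivative X D (interior_product v \<tau>) - interior_product (bracket D v) \<tau>"
proof
  fix vs
  show "interior_product v (lie_derivative X D \<tau>) vs =
    (lie_derivative X D (interior_product v \<tau>) - interior_product (bracket D v) \<tau>) vs"
    using assms by (cases "set vs \<subseteq> VF")
      (simp_all add: lie_derivative_Cons lie_derivative_outside forms_outside)
qed

lemma lie_derivative_forms: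
  assumes "D \<in> VF" "\<tau> \<in> forms X k" shows "lie_derivative X D \<tau> \<in> forms X k"
  using assms(2)
proof (induction k arbitrary: \<tau>)
  case 0
  have out: "lie_derivative X D \<tau> vs = 0" if "vs \<noteq> []" for vs
    using that assms(1) forms_outside[OF 0] by (simp add: lie_derivative_eq)
  have rep: "lie_derivative X D \<tau> vs = 0" if "\<not> distinct vs" for vs
    using that out[of vs] by (cases "vs = []") simp_all
  show ?case
    unfolding forms_def
    using assms(1) forms_funs[OF 0, of "[]"] by (auto simp: lie_derivative_Nil out rep)
next
  case (Suc k)
  note \<tau> = Suc.prems and D = assms(1)
  have \<tau>f: "\<tau> vs \<in> funs X" for vs using forms_funs[OF \<tau>] .
  show ?case
  proof (rule formsI)
    fix vs assume n: "\<not> (length vs = Suc k \<and> set vs \<subseteq> VF)"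
    show "lie_derivative X D \<tau> vs = 0"
    proof (cases "set vs \<subseteq> VF")
      case True
      then have "\<tau> ws = 0" if "length ws = length vs" for ws
        using n that forms_outside[OF \<tau>] by simp
      then show ?thesis using D by (simp add: lie_derivative_eq)
    qed (simp add: lie_derivative_outside)
  next
    fix v assume v: "v \<in> VF"
    show "interior_product v (lie_derivative X D \<tau>) \<in> forms X k"
      unfolding interior_lie_derivative[OF v D \<tau>]
      using Suc.IH[OF interior_forms[OF \<tau> v]] interior_forms[OF \<tau> vf_bracket[OF D v]] by (rule forms_minus)
  next
    fix v w vs assume vw: "v \<in> VF" "w \<in> VF" and vs: "set vs \<subseteq> VF"
    have "lie_derivative X D (interior_product v \<tau> + interior_product w \<tau>) =
      lie_derivative X D (interior_product v \<tau>) + lie_derivative X D (interior_product w \<tau>)"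
      using D \<tau>f by (intro lie_derivative_plus) simp_all
    then show "lie_derivative X D \<tau> ((v + w) # vs) = lie_derivative X D \<tau> (v # vs) + lie_derivative X D \<tau> (w # vs)"
      using vw vs D by (simp add: lie_derivative_Cons interior_plus[OF \<tau>] bracket_add_right forms_add_hd[OF \<tau>])
  next
    fix v a vs assume v: "v \<in> VF" and a: "a \<in> funs X" and vs: "set vs \<subseteq> VF"
    have "lie_derivative X D (\<lambda>vs. a * interior_product v \<tau> vs) vs =
      a * lie_derivative X D (interior_product v \<tau>) vs + D a * \<tau> (v # vs)"
      using D \<tau>f a vs by (subst lie_derivative_times) simp_all
    then show "lie_derivative X D \<tau> ((\<lambda>f. a * v f) # vs) = a * lie_derivative X D \<tau> (v # vs)"
      using v vs D a
      by (simp add: lie_derivative_Cons interior_times[OF \<tau>] bracket_times_right forms_add_hd[OF \<tau>]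
          forms_times_hd[OF \<tau>] algebra_simps)
  next
    fix v vs assume v: "v \<in> VF" and vs: "set vs \<subseteq> VF"
    have "interior_product v (interior_product v \<tau>) = 0"
      using forms_repeat[OF \<tau>] by (simp add: fun_eq_iff[where f = "interior_product v (interior_product v \<tau>)"])
    moreover have "\<tau> (v # bracket D v # vs) = - \<tau> (bracket D v # v # vs)"
      using forms_swap[OF \<tau>, of v "bracket D v" "[]" vs] v vs D by simp
    ultimately show "lie_derivative X D \<tau> (v # v # vs) = 0"
      using v vs D by (simp add: lie_derivative_Cons)
  qed
qed

text \<open>Removing the first argument reduces the claim to an interior product of lower degree;
  the correction terms match by the Jacobi identity.\<close>

lemma lie_derivative_bracket:
  assumes "D \<in> VF" "E \<in> VF" "\<tau> \<in> forms X k"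
  shows "lie_derivative X (bracket D E) \<tau> =
    lie_derivative X D (lie_derivative X E \<tau>) - lie_derivative X E (lie_derivative X D \<tau>)"
proof
  have *: "lie_derivative X (bracket D E) \<tau> vs =
      lie_derivative X D (lie_derivative X E \<tau>) vs - lie_derivative X E (lie_derivative X D \<tau>) vs"
    if "\<tau> \<in> forms X k" "set vs \<subseteq> VF" for vs k \<tau>
    using that
  proof (induction vs arbitrary: k \<tau>)
    case Nil
    then show ?case by (simp add: lie_derivative_Nil bracket_apply)
  next
    case (Cons v vs)
    note \<tau> = Cons.prems(1)
    have v: "v \<in> VF" and vs: "set vs \<subseteq> VF" using Cons.prems(2) by auto
    show ?case
    proof (cases k)
      case 0
      have L: "lie_derivative X F \<sigma> (v # vs) = 0" if "F \<in> VF" "\<sigma> \<in> forms X 0" for F \<sigma>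
        using forms_outside[OF lie_derivative_forms[OF that]] by simp
      show ?thesis using L \<tau> 0 assms lie_derivative_forms by simp
    next
      case (Suc k')
      note \<tau>' = \<tau>[unfolded Suc]
      have f: "lie_derivative X F (interior_product w \<tau>) us \<in> funs X" "\<tau> us \<in> funs X" if "F \<in> VF" "w \<in> VF" for F w us
        using forms_funs[OF lie_derivative_forms[OF that(1) interior_forms[OF \<tau>' that(2)]]] forms_funs[OF \<tau>] by auto
      \<comment> \<open>The two middle terms are exchanged by exchanging \<open>F\<close> and
        \<open>G\<close>, so they cancel in the commutator. The last terms combine to the bracket of
        \<open>bracket D E\<close> with \<open>v\<close>.\<close>
      have 1: "lie_derivative X F (lie_derivative X G \<tau>) (v # vs) =
        lie_derivative X F (lie_derivative X G (interior_product v \<tau>)) vs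
        - lie_derivative X F (interior_product (bracket G v) \<tau>) vs
        - lie_derivative X G (interior_product (bracket F v) \<tau>) vs
        + \<tau> (bracket G (bracket F v) # vs)" if F: "F \<in> VF" and G: "G \<in> VF" for F G
      proof -
        have "lie_derivative X F (lie_derivative X G \<tau>) (v # vs) =
          lie_derivative X F (interior_product v (lie_derivative X G \<tau>)) vs - lie_derivative X G \<tau> (bracket F v # vs)"
          using v vs by (rule lie_derivative_Cons)
        also have "lie_derivative X F (interior_product v (lie_derivative X G \<tau>)) =
          lie_derivative X F (lie_derivative X G (interior_product v \<tau>)) - lie_derivative X F (interior_product (bracket G v) \<tau>)"
          unfolding interior_lie_derivative[OF v G \<tau>]
          using F G v f by (intro lie_derivative_diff) simp_all
        also have "lie_derivative X G \<tau> (bracket F v # vs) =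
          lie_derivative X G (interior_product (bracket F v) \<tau>) vs - \<tau> (bracket G (bracket F v) # vs)"
          using F v vs by (intro lie_derivative_Cons) auto
        finally show ?thesis by (simp add: algebra_simps del: interior_apply)
      qed
      have "bracket (bracket D E) v = bracket D (bracket E v) - bracket E (bracket D v)"
        using bracket_jacobi[OF assms(1,2) v] by simp
      then have "\<tau> (bracket (bracket D E) v # vs) = \<tau> (bracket D (bracket E v) # vs) - \<tau> (bracket E (bracket D v) # vs)"
        using forms_diff_arg[OF \<tau>, of "bracket D (bracket E v)" "bracket E (bracket D v)" "[]" vs] assms v vs
        by simp
      then show ?thesis
        using Cons.IH[OF interior_forms[OF \<tau>' v] vs] 1[OF assms(1,2)] 1[OF assms(2,1)]
          lie_derivative_Cons[OF v vs, of "bracket D E" \<tau>] by (simp del: interior_apply)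
    qed
  qed
  fix vs
  show "lie_derivative X (bracket D E) \<tau> vs =
    (lie_derivative X D (lie_derivative X E \<tau>) - lie_derivative X E (lie_derivative X D \<tau>)) vs"
    using *[OF assms(3), of vs] by (cases "set vs \<subseteq> VF") (simp_all add: lie_derivative_outside)
qed

section \<open>The exterior differential\<close>

lemma ext_d_eq:
  "ext_d X \<tau> vs = (if set vs \<subseteq> VF then
     (\<Sum>i<length vs. const ((-1) ^ i) * (vs ! i) (\<tau> (del_nth i vs))) +
     (\<Sum>j<length vs. \<Sum>i<j. const ((-1) ^ (i + j)) *
        \<tau> (bracket (vs ! i) (vs ! j) # del_nth i (del_nth j vs))) else 0)"
  by (auto simp: ext_d_def pointwise fun_eq_iff)

lemma ext_d_outside: "\<not> set vs \<subseteq> VF \<Longrightarrow> ext_d X \<tau> vs = 0"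
  by (simp add: ext_d_eq)

lemma set_del_nth_VF: "set vs \<subseteq> VF \<Longrightarrow> set (del_nth i vs) \<subseteq> VF"
  using set_del_nth by fastforce

lemma nth_VF: "set vs \<subseteq> VF \<Longrightarrow> i < length vs \<Longrightarrow> vs ! i \<in> VF"
  by (meson nth_mem subset_iff)

lemma forms_update:
  assumes "\<tau> \<in> forms X k" "D \<in> VF" "set vs \<subseteq> VF" "i < length vs"
  shows "\<tau> (vs[i := D]) = const ((-1) ^ i) * \<tau> (D # del_nth i vs)"
proof -
  have "\<tau> (D # take i vs @ drop (Suc i) vs) = const ((-1) ^ i) * \<tau> (take i vs @ D # drop (Suc i) vs)"
    using forms_move[OF assms(1,2), of "[]" "take i vs" "drop (Suc i) vs"] assms(3,4)
    by (force dest: in_set_takeD in_set_dropD)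
  then show ?thesis using assms(4) by (simp add: del_nth_def upd_conv_take_nth_drop)
qed

text \<open>Cartan's formula, read as a recursion for the exterior differential.\<close>

lemma ext_d_Cons:
  assumes \<tau>: "\<tau> \<in> forms X k" and v: "v \<in> VF" and vs: "set vs \<subseteq> VF"
  shows "ext_d X \<tau> (v # vs) = lie_derivative X v \<tau> vs - ext_d X (interior_product v \<tau>) vs"
proof -
  let ?n = "length vs"
  have VF: "vs ! i \<in> VF" if "i < ?n" for i using nth_VF[OF vs that] .
  have A: "(\<Sum>i<Suc ?n. const ((-1) ^ i) * ((v # vs) ! i) (\<tau> (del_nth i (v # vs)))) =
    v (\<tau> vs) - (\<Sum>i<?n. const ((-1) ^ i) * (vs ! i) (interior_product v \<tau> (del_nth i vs)))"
    by (simp add: sum.lessThan_Suc_shift const_uminus sum_negf del: sum.lessThan_Suc)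
  have B: "(\<Sum>i<Suc j. const ((-1) ^ (i + Suc j)) *
        \<tau> (bracket ((v # vs) ! i) ((v # vs) ! Suc j) # del_nth i (del_nth (Suc j) (v # vs)))) =
     - \<tau> (vs[j := bracket v (vs ! j)]) -
     (\<Sum>i<j. const ((-1) ^ (i + j)) * interior_product v \<tau> (bracket (vs ! i) (vs ! j) # del_nth i (del_nth j vs)))"
    if j: "j < ?n" for j
  proof -
    have "\<tau> (bracket (vs ! i) (vs ! j) # v # del_nth i (del_nth j vs)) =
      - \<tau> (v # bracket (vs ! i) (vs ! j) # del_nth i (del_nth j vs))" if "i < j" for i
      using forms_swap[OF \<tau>, of "bracket (vs ! i) (vs ! j)" v "[]" "del_nth i (del_nth j vs)"]
        VF[of i] VF[of j] j that v vs by (simp add: set_del_nth_VF)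
    then have "(\<Sum>i<j. const ((-1) ^ (i + j)) * \<tau> (bracket (vs ! i) (vs ! j) # v # del_nth i (del_nth j vs))) =
      - (\<Sum>i<j. const ((-1) ^ (i + j)) * \<tau> (v # bracket (vs ! i) (vs ! j) # del_nth i (del_nth j vs)))"
      by (simp add: sum_negf[symmetric])
    moreover have "\<tau> (vs[j := bracket v (vs ! j)]) = const ((-1) ^ j) * \<tau> (bracket v (vs ! j) # del_nth j vs)"
      using forms_update[OF \<tau> _ vs j] v VF[OF j] by simp
    ultimately show ?thesis
      by (simp add: sum.lessThan_Suc_shift const_uminus del: sum.lessThan_Suc)
  qed
  have "(\<Sum>j<Suc ?n. \<Sum>i<j. const ((-1) ^ (i + j)) *
        \<tau> (bracket ((v # vs) ! i) ((v # vs) ! j) # del_nth i (del_nth j (v # vs)))) =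
    (\<Sum>j<?n. \<Sum>i<Suc j. const ((-1) ^ (i + Suc j)) *
        \<tau> (bracket ((v # vs) ! i) ((v # vs) ! Suc j) # del_nth i (del_nth (Suc j) (v # vs))))"
    by (subst sum.lessThan_Suc_shift) simp
  also have "\<dots> = (\<Sum>j<?n. - \<tau> (vs[j := bracket v (vs ! j)]) -
     (\<Sum>i<j. const ((-1) ^ (i + j)) * interior_product v \<tau> (bracket (vs ! i) (vs ! j) # del_nth i (del_nth j vs))))"
    by (intro sum.cong refl B) simp
  finally show ?thesis
    using v vs A by (simp add: ext_d_eq lie_derivative_eq sum_subtractf sum_negf del: sum.lessThan_Suc)
qed

lemma ext_d_plus:
  assumes "\<And>vs. \<sigma> vs \<in> funs X" "\<And>vs. \<tau> vs \<in> funs X"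
  shows "ext_d X (\<sigma> + \<tau>) = ext_d X \<sigma> + ext_d X \<tau>"
proof
  fix vs
  have "(vs ! i) (\<sigma> (del_nth i vs) + \<tau> (del_nth i vs)) = (vs ! i) (\<sigma> (del_nth i vs)) + (vs ! i) (\<tau> (del_nth i vs))"
    if "set vs \<subseteq> VF" "i < length vs" for i
    using assms nth_VF[OF that] by (simp add: vf_add)
  then show "ext_d X (\<sigma> + \<tau>) vs = (ext_d X \<sigma> + ext_d X \<tau>) vs"
    by (simp add: ext_d_eq sum.distrib algebra_simps)
qed

lemma ext_d_const:
  assumes "\<And>vs. \<tau> vs \<in> funs X"
  shows "ext_d X (\<lambda>vs. const c * \<tau> vs) = (\<lambda>vs. const c * ext_d X \<tau> vs)"
proof
  fix vs
  have "(vs ! i) (const c * \<tau> (del_nth i vs)) = const c * (vs ! i) (\<tau> (del_nth i vs))"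
    if "set vs \<subseteq> VF" "i < length vs" for i
    using assms nth_VF[OF that] by (simp add: vf_const)
  then show "ext_d X (\<lambda>vs. const c * \<tau> vs) vs = const c * ext_d X \<tau> vs"
    by (simp add: ext_d_eq sum_distrib_left algebra_simps)
qed

text \<open>The sum is \<open>da \<and> \<tau>\<close> written out on \<open>vs\<close>.\<close>

lemma ext_d_times:
  assumes "\<And>vs. \<tau> vs \<in> funs X" "a \<in> funs X" "set vs \<subseteq> VF"
  shows "ext_d X (\<lambda>vs. a * \<tau> vs) vs =
    a * ext_d X \<tau> vs + (\<Sum>i<length vs. const ((-1) ^ i) * ((vs ! i) a * \<tau> (del_nth i vs)))"
proof -
  have "(vs ! i) (a * \<tau> (del_nth i vs)) = a * (vs ! i) (\<tau> (del_nth i vs)) + (vs ! i) a * \<tau> (del_nth i vs)"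
    if "i < length vs" for i
    using assms nth_VF[OF assms(3) that] by (simp add: vf_mult mult.commute)
  then show ?thesis
    using assms(3) by (simp add: ext_d_eq sum_distrib_left sum.distrib algebra_simps)
qed

text \<open>Here the sum is \<open>da\<close> wedge the interior product of \<open>v\<close> with
  \<open>\<tau>\<close>. It agrees with the correction term of \<open>ext_d_times\<close> for that
  interior product, so the two cancel in Cartan's formula.\<close>

lemma lie_derivative_times_left:
  assumes \<tau>: "\<tau> \<in> forms X k" and v: "v \<in> VF" and a: "a \<in> funs X" and vs: "set vs \<subseteq> VF"
  shows "lie_derivative X (\<lambda>f. a * v f) \<tau> vs =
    a * lie_derivative X v \<tau> vs + (\<Sum>i<length vs. const ((-1) ^ i) * ((vs ! i) a * \<tau> (v # del_nth i vs)))"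
proof -
  have *: "\<tau> (vs[i := bracket (\<lambda>f. a * v f) (vs ! i)]) =
    a * \<tau> (vs[i := bracket v (vs ! i)]) - const ((-1) ^ i) * ((vs ! i) a * \<tau> (v # del_nth i vs))"
    if i: "i < length vs" for i
  proof -
    have w: "vs ! i \<in> VF" using nth_VF[OF vs i] .
    have d: "set (del_nth i vs) \<subseteq> VF" using set_del_nth_VF[OF vs] .
    have "\<tau> (bracket (\<lambda>f. a * v f) (vs ! i) # del_nth i vs) =
      a * \<tau> (bracket v (vs ! i) # del_nth i vs) - (vs ! i) a * \<tau> (v # del_nth i vs)"
      unfolding bracket_times_left[OF v w a]
      using forms_diff_arg[OF \<tau>, of "\<lambda>f. a * bracket v (vs ! i) f" "\<lambda>f. (vs ! i) a * v f" "[]" "del_nth i vs"]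
        v w a d by (simp add: forms_times_hd[OF \<tau>])
    then show ?thesis
      unfolding forms_update[OF \<tau> vf_bracket[OF vf_times[OF v a] w] vs i] forms_update[OF \<tau> vf_bracket[OF v w] vs i]
      by (simp only: right_diff_distrib mult.left_commute[of a])
  qed
  show ?thesis
    using vs by (simp add: lie_derivative_eq * sum_subtractf sum_distrib_left right_diff_distrib)
qed

lemma lie_derivative_plus_left:
  assumes \<tau>: "\<tau> \<in> forms X k" and v: "v \<in> VF" "w \<in> VF" and vs: "set vs \<subseteq> VF"
  shows "lie_derivative X (v + w) \<tau> vs = lie_derivative X v \<tau> vs + lie_derivative X w \<tau> vs"
proof -
  have "\<tau> (vs[i := bracket (v + w) (vs ! i)]) = \<tau> (vs[i := bracket v (vs ! i)]) + \<tau> (vs[i := bracket w (vs ! i)])"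
    if i: "i < length vs" for i
  proof -
    have u: "vs ! i \<in> VF" using nth_VF[OF vs i] .
    show ?thesis
      using v u set_del_nth_VF[OF vs, of i]
      by (simp add: forms_update[OF \<tau> _ vs i] bracket_add_left forms_add_hd[OF \<tau>] algebra_simps)
  qed
  then show ?thesis
    using vs by (simp add: lie_derivative_eq sum.distrib algebra_simps)
qed

lemma ext_d_zero [simp]: "ext_d X 0 = 0"
proof
  fix vs
  have "(vs ! i) 0 = 0" if "set vs \<subseteq> VF" "i < length vs" for i
    using nth_VF[OF that] by simp
  then show "ext_d X 0 vs = 0 vs" by (simp add: ext_d_eq)
qed

text \<open>Linearity over functions is not visible in the Koszul formula. In Cartan's recursion the
  defects of the Lie derivative and of the differential of the interior product cancel. The
  induction hypothesis is an assumption because degree 0, where all interior products vanish, is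
  treated by the same argument.\<close>

lemma ext_d_forms_step:
  assumes \<tau>: "\<tau> \<in> forms X k" and IH: "\<And>v. v \<in> VF \<Longrightarrow> ext_d X (interior_product v \<tau>) \<in> forms X k"
  shows "ext_d X \<tau> \<in> forms X (Suc k)"
proof (rule formsI)
  note \<tau>f = forms_funs[OF \<tau>]
  have L: "lie_derivative X v \<tau> \<in> forms X k" if "v \<in> VF" for v
    using lie_derivative_forms[OF that \<tau>] .
  have int: "interior_product v (ext_d X \<tau>) = lie_derivative X v \<tau> - ext_d X (interior_product v \<tau>)"
    if v: "v \<in> VF" for v
  proof
    fix vs
    show "interior_product v (ext_d X \<tau>) vs = (lie_derivative X v \<tau> - ext_d X (interior_product v \<tau>)) vs"
      using ext_d_Cons[OF \<tau> v, of vs] lie_derivative_outside[of vs] ext_d_outside[of vs] ext_d_outside[of "v # vs"]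
      by (cases "set vs \<subseteq> VF") auto
  qed
  fix v assume v: "v \<in> VF"
  show "interior_product v (ext_d X \<tau>) \<in> forms X k"
    unfolding int[OF v] using L[OF v] IH[OF v] by (rule forms_minus)
  show "ext_d X \<tau> (v # v # vs) = 0" if vs: "set vs \<subseteq> VF" for vs
  proof (cases k)
    case 0
    then show ?thesis
      using ext_d_Cons[OF \<tau> v, of "v # vs"] vs v L[OF v] \<tau> by (simp add: interior_forms_0 forms_outside)
  next
    case (Suc k')
    note \<tau>' = \<tau>[unfolded Suc]
    have "interior_product v (interior_product v \<tau>) = 0"
      using forms_repeat[OF \<tau>] by (simp add: fun_eq_iff[where f = "interior_product v (interior_product v \<tau>)"])
    then show ?thesis
      using ext_d_Cons[OF \<tau> v, of "v # vs"] ext_d_Cons[OF interior_forms[OF \<tau>' v] v vs]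
        lie_derivative_Cons[OF v vs, of v \<tau>] forms_zero_arg[OF \<tau>, of "[]" vs] v vs by simp
  qed
  fix w vs assume w: "w \<in> VF" and vs: "set vs \<subseteq> VF"
  have "ext_d X (interior_product (v + w) \<tau>) = ext_d X (interior_product v \<tau>) + ext_d X (interior_product w \<tau>)"
    unfolding interior_plus[OF \<tau> v w] by (rule ext_d_plus) (simp_all add: \<tau>f)
  then show "ext_d X \<tau> ((v + w) # vs) = ext_d X \<tau> (v # vs) + ext_d X \<tau> (w # vs)"
    using v w vs by (simp add: ext_d_Cons[OF \<tau>] lie_derivative_plus_left[OF \<tau>])
next
  fix v a vs assume v: "v \<in> VF" and a: "a \<in> funs X" and vs: "set vs \<subseteq> VF"
  have "ext_d X (interior_product (\<lambda>f. a * v f) \<tau>) vs = a * ext_d X (interior_product v \<tau>) vs +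
    (\<Sum>i<length vs. const ((-1) ^ i) * ((vs ! i) a * \<tau> (v # del_nth i vs)))"
    unfolding interior_times[OF \<tau> v a] using a vs by (subst ext_d_times) (simp_all add: forms_funs[OF \<tau>])
  then show "ext_d X \<tau> ((\<lambda>f. a * v f) # vs) = a * ext_d X \<tau> (v # vs)"
    using v a vs by (simp add: ext_d_Cons[OF \<tau>] lie_derivative_times_left[OF \<tau>] algebra_simps)
next
  fix vs assume n: "\<not> (length vs = Suc k \<and> set vs \<subseteq> VF)"
  show "ext_d X \<tau> vs = 0"
  proof (cases "set vs \<subseteq> VF")
    case True
    show ?thesis
    proof (cases vs)
      case Nil
      then show ?thesis by (simp add: ext_d_eq)
    next
      case (Cons v ws)
      then show ?thesis
        using True n ext_d_Cons[OF \<tau>, of v ws] forms_outside[OF lie_derivative_forms[OF _ \<tau>], of v ws]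
          forms_outside[OF IH, of v ws] by simp
    qed
  qed (simp add: ext_d_outside)
qed

lemma ext_d_forms: "\<tau> \<in> forms X k \<Longrightarrow> ext_d X \<tau> \<in> forms X (Suc k)"
proof (induction k arbitrary: \<tau>)
  case 0
  then show ?case by (intro ext_d_forms_step) (simp_all add: interior_forms_0)
next
  case (Suc k)
  show ?case using Suc.prems by (rule ext_d_forms_step) (use Suc interior_forms in blast)
qed

section \<open>Fields of divergence zero\<close>

text \<open>Inserting a linear relation into one place of the form leaves a single term, and its
  coefficient cancels in a domain.\<close>

lemma forms_relation:
  assumes \<kappa>: "\<kappa> \<in> forms X k" and us: "set us \<subseteq> VF" and ws: "set ws \<subseteq> VF"
    and c: "\<And>i. i \<le> n \<Longrightarrow> c i \<in> funs X" and v: "\<And>i. i \<le> (n::nat) \<Longrightarrow> v i \<in> VF"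
    and 0: "\<And>f. (\<Sum>i\<le>n. c i * v i f) = 0"
    and k: "k' \<le> n" "c k' \<noteq> 0" and rest: "\<And>i. i \<le> n \<Longrightarrow> i \<noteq> k' \<Longrightarrow> c i * \<kappa> (us @ v i # ws) = 0"
  shows "\<kappa> (us @ v k' # ws) = 0"
proof -
  have "(\<lambda>f. \<Sum>i\<in>{..n}. c i * v i f) = (0 :: 'a vfield)" by (simp add: fun_eq_iff 0)
  then have "0 = \<kappa> (us @ (\<lambda>f. \<Sum>i\<in>{..n}. c i * v i f) # ws)"
    using forms_zero_arg[OF \<kappa> us ws] by simp
  also have "\<dots> = (\<Sum>i\<in>{..n}. c i * \<kappa> (us @ v i # ws))"
    using c v by (intro conjunct2[OF forms_sum_arg[OF \<kappa> us ws]]) auto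
  also have "\<dots> = (\<Sum>i\<in>{..n}. if i = k' then c k' * \<kappa> (us @ v k' # ws) else 0)"
    using rest by (intro sum.cong) auto
  also have "\<dots> = c k' * \<kappa> (us @ v k' # ws)" using k by simp
  finally show ?thesis using funs_domain[OF c[OF k(1)] forms_funs[OF \<kappa>]] k(2) by metis
qed

text \<open>One entry more than the dimension makes the entries dependent; replacing an entry whose
  coefficient is nonzero by any other entry creates a repetition. This is why a volume form is
  closed.\<close>

lemma forms_above_dim:
  assumes smooth: "smooth_variety X" and \<kappa>: "\<kappa> \<in> forms X (Suc (variety_dim X))"
  shows "\<kappa> = 0"
proof
  fix vs
  let ?n = "variety_dim X"
  show "\<kappa> vs = 0 vs"
  proof (cases "length vs = Suc ?n \<and> set vs \<subseteq> VF")
    case True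
    then have VF: "vs ! i \<in> VF" if "i \<le> ?n" for i using that by (intro nth_VF) auto
    obtain c k where c: "\<And>i. i \<le> ?n \<Longrightarrow> c i \<in> funs X" "k \<le> ?n" "c k \<noteq> 0"
      "\<And>f. (\<Sum>i\<le>?n. c i * (vs ! i) f) = 0"
      using vf_dependent[OF smooth, of "\<lambda>i. vs ! i"] VF by blast
    have vs: "vs = take k vs @ vs ! k # drop (Suc k) vs"
      using True c(2) by (intro id_take_nth_drop) auto
    have "\<kappa> (take k vs @ vs ! k # drop (Suc k) vs) = 0"
    proof (rule forms_relation[OF \<kappa>, where n = ?n and c = c and v = "\<lambda>i. vs ! i"])
      show "set (take k vs) \<subseteq> VF" "set (drop (Suc k) vs) \<subseteq> VF"
        using True by (auto dest: in_set_takeD in_set_dropD)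
      fix i assume i: "i \<le> ?n" "i \<noteq> k"
      have "vs ! i \<in> set (take k vs) \<union> set (drop (Suc k) vs)"
      proof (cases "i < k")
        case True
        then have "take k vs ! i = vs ! i" "i < length (take k vs)" using i \<open>length vs = _ \<and> _\<close> by auto
        then show ?thesis by (metis UnI1 nth_mem)
      next
        case False
        then have "drop (Suc k) vs ! (i - Suc k) = vs ! i" "i - Suc k < length (drop (Suc k) vs)"
          using i True by auto
        then show ?thesis by (metis UnI2 nth_mem)
      qed
      then have "\<not> distinct (take k vs @ vs ! i # drop (Suc k) vs)" by auto
      then show "c i * \<kappa> (take k vs @ vs ! i # drop (Suc k) vs) = 0"
        using forms_repeat[OF \<kappa>] by simp
    qed (use c VF in auto)
    then show ?thesis using vs by simp
  next
    case False
    then show ?thesis using forms_outside[OF \<kappa>] by simp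
  qed
qed

text \<open>Since \<open>\<omega> vs\<close> is nonzero, \<open>vs\<close> is a basis of the
  derivations over the field of fractions, and a top form is determined by its value on a
  basis.\<close>

lemma top_form_zero:
  assumes smooth: "smooth_variety X" and \<omega>: "\<omega> \<in> forms X (variety_dim X)" and \<kappa>: "\<kappa> \<in> forms X (variety_dim X)"
    and v: "\<omega> vs \<noteq> 0" "\<kappa> vs = 0"
  shows "\<kappa> = 0"
proof -
  let ?n = "variety_dim X"
  have vs: "length vs = ?n" "set vs \<subseteq> VF" using v(1) forms_outside[OF \<omega>] by blast+
  have dist: "distinct vs" using v(1) forms_repeat[OF \<omega>] by blast
  have VF: "vs ! i \<in> VF" if "i < ?n" for i using that vs by (intro nth_VF) auto
  \<comment> \<open>The entries of \<open>us\<close> already belong to the basis, those of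
    \<open>ws\<close> are still arbitrary and are replaced one after the other.\<close>
  have *: "\<kappa> (ws @ us) = 0" if "set ws \<subseteq> VF" "set us \<subseteq> set vs" "length ws + length us = ?n" for ws us
    using that
  proof (induction ws arbitrary: us)
    case Nil
    show ?case
    proof (cases "distinct us")
      case True
      then have "set us = set vs"
        using Nil dist vs by (intro card_subset_eq) (auto simp: distinct_card)
      then have "mset us = mset vs" using True dist by (simp add: set_eq_iff_mset_eq_distinct)
      then show ?thesis using forms_mset_zero[OF \<kappa>, of "[]" us vs] Nil vs v(2) by auto
    next
      case False
      then show ?thesis using forms_repeat[OF \<kappa>] by simp
    qed
  next
    case (Cons w ws)
    have sub: "set ws \<subseteq> VF" "set us \<subseteq> VF" "w \<in> VF" using Cons.prems vs(2) by auto
    define u where "u i = (if i < ?n then vs ! i else w)" for i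
    have u: "u i \<in> VF" for i using VF sub by (simp add: u_def)
    obtain c k where c: "\<And>i. i \<le> ?n \<Longrightarrow> c i \<in> funs X" "k \<le> ?n" "c k \<noteq> 0"
      "\<And>f. (\<Sum>i\<le>?n. c i * u i f) = 0"
      using vf_dependent[OF smooth, of u] u by blast
    \<comment> \<open>Otherwise the relation would involve the basis alone, and
      \<open>forms_relation\<close> would give \<open>\<omega> vs = 0\<close>.\<close>
    have cn: "c ?n \<noteq> 0"
    proof
      assume 0: "c ?n = 0"
      with c have k: "k < ?n" by (metis le_neq_implies_less)
      have vs': "vs = take k vs @ vs ! k # drop (Suc k) vs"
        using vs k by (intro id_take_nth_drop) auto
      have "\<omega> (take k vs @ u k # drop (Suc k) vs) = 0"
      proof (rule forms_relation[OF \<omega>, where n = ?n and c = c and v = u])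
        show "set (take k vs) \<subseteq> VF" "set (drop (Suc k) vs) \<subseteq> VF"
          using vs by (auto dest: in_set_takeD in_set_dropD)
        fix i assume i: "i \<le> ?n" "i \<noteq> k"
        show "c i * \<omega> (take k vs @ u i # drop (Suc k) vs) = 0"
        proof (cases "i = ?n")
          case False
          then have "u i \<in> set (take k vs) \<union> set (drop (Suc k) vs)"
          proof (cases "i < k")
            case True
            then have "take k vs ! i = u i" "i < length (take k vs)" using i k vs by (auto simp: u_def)
            then show ?thesis by (metis UnI1 nth_mem)
          next
            case nl: False
            then have "drop (Suc k) vs ! (i - Suc k) = u i" "i - Suc k < length (drop (Suc k) vs)"
              using i False vs by (auto simp: u_def)
            then show ?thesis by (metis UnI2 nth_mem)
          qed
          then have "\<not> distinct (take k vs @ u i # drop (Suc k) vs)" by auto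
          then show ?thesis using forms_repeat[OF \<omega>] by simp
        qed (simp add: 0)
      qed (use c u in auto)
      then show False using v(1) vs' k by (simp add: u_def)
    qed
    have "\<kappa> ([] @ u ?n # ws @ us) = 0"
    proof (rule forms_relation[OF \<kappa>, where n = ?n and c = c and v = u])
      fix i assume i: "i \<le> ?n" "i \<noteq> ?n"
      have ui: "u i \<in> set vs" using i vs by (simp add: u_def)
      have "\<kappa> (ws @ u i # us) = 0"
        using Cons.IH[of "u i # us"] Cons.prems ui by simp
      then have "\<kappa> (u i # ws @ us) = 0"
        using forms_move_zero[OF \<kappa> u, of "[]" ws us i] sub by simp
      then show "c i * \<kappa> ([] @ u i # ws @ us) = 0" by simp
    qed (use c u cn sub in auto)
    then show ?case by (simp add: u_def)
  qed
  show ?thesis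
  proof
    fix ws
    show "\<kappa> ws = 0 ws"
      using *[of ws "[]"] forms_outside[OF \<kappa>, of ws]
      by (cases "length ws = ?n \<and> set ws \<subseteq> VF") auto
  qed
qed

text \<open>In a tuple on which the volume form is nonzero and whose total order of nilpotency under
  \<open>bracket D\<close> is minimal, replacing an entry by its bracket with \<open>D\<close> makes the form vanish. So \<open>D\<close>
  maps the value \<open>y\<close> of the form on this tuple to \<open>y\<close> times the divergence of \<open>D\<close>.\<close>

lemma nilp_lie_derivative:
  assumes smooth: "smooth_variety X" and vol: "volume_form X \<omega>" and nilp: "nilp D"
  shows "lie_derivative X D \<omega> = 0"
proof -
  let ?n = "variety_dim X"
  have \<omega>: "\<omega> \<in> forms X ?n" and nv: "nowhere_vanishing X \<omega>" using vol by (auto simp: volume_form_def)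
  have D: "D \<in> VF" using nilpD nilp by blast
  have L: "lie_derivative X D \<omega> \<in> forms X ?n" using D \<omega> by (rule lie_derivative_forms)
  define ord where "ord v = (LEAST k. (bracket D ^^ k) v = 0)" for v
  have ord: "ord (bracket D v) < ord v" if v: "v \<in> VF" "v \<noteq> 0" for v
  proof -
    have 0: "(bracket D ^^ ord v) v = 0"
      unfolding ord_def by (rule LeastI_ex[OF bracket_funpow_nilp[OF nilp v(1)]])
    then obtain k where k: "ord v = Suc k" using v(2) by (cases "ord v") auto
    then have "(bracket D ^^ k) (bracket D v) = 0" using 0 by (simp add: funpow_swap1)
    then have "ord (bracket D v) \<le> k" unfolding ord_def by (rule Least_le)
    then show ?thesis using k by simp
  qed
  have "\<exists>vs. \<omega> vs \<noteq> 0"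
    using points_nonempty nv unfolding nowhere_vanishing_def by (metis all_not_in_conv zero_fun_apply)
  then obtain vs where vs: "\<omega> vs \<noteq> 0" and min: "\<And>ws. \<omega> ws \<noteq> 0 \<Longrightarrow> sum_list (map ord vs) \<le> sum_list (map ord ws)"
    using ex_has_least_nat[of "\<lambda>ws. \<omega> ws \<noteq> 0" _ "\<lambda>ws. sum_list (map ord ws)"] by blast
  have VF: "set vs \<subseteq> VF" using vs forms_outside[OF \<omega>] by blast
  define y where "y = \<omega> vs"
  have yf: "y \<in> funs X" "y \<noteq> 0" using forms_funs[OF \<omega>] vs by (auto simp: y_def)
  have "\<omega> (vs[i := bracket D (vs ! i)]) = 0" if i: "i < length vs" for i
  proof (rule ccontr)
    assume nz: "\<omega> (vs[i := bracket D (vs ! i)]) \<noteq> 0"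
    have "vs ! i \<noteq> 0"
    proof
      assume "vs ! i = 0"
      then have "vs = take i vs @ 0 # drop (Suc i) vs" using id_take_nth_drop[OF i] by simp
      then show False using vs forms_zero_arg[OF \<omega>, of "take i vs" "drop (Suc i) vs"] VF
        by (metis order_trans set_drop_subset set_take_subset)
    qed
    then have o: "ord (bracket D (vs ! i)) < ord (vs ! i)" using ord nth_VF[OF VF i] by blast
    have "sum_list (map ord (vs[i := bracket D (vs ! i)])) =
      sum_list (map ord vs) + ord (bracket D (vs ! i)) - ord (vs ! i)"
      using i by (simp add: map_update sum_list_update)
    moreover have "ord (vs ! i) \<le> sum_list (map ord vs)" using i
      by (metis elem_le_sum_list length_map nth_map)
    ultimately have "sum_list (map ord (vs[i := bracket D (vs ! i)])) < sum_list (map ord vs)"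
      using o by linarith
    then show False using min[OF nz] by simp
  qed
  then have Lvs: "lie_derivative X D \<omega> vs = D y"
    using VF by (simp add: lie_derivative_eq y_def)
  have Dyf: "D y \<in> funs X" using D yf by auto
  \<comment> \<open>Both terms are top forms with the same value on \<open>vs\<close>.\<close>
  have zero: "(\<lambda>ws. y * lie_derivative X D \<omega> ws) - (\<lambda>ws. D y * \<omega> ws) = 0"
  proof (rule top_form_zero[OF smooth \<omega> _ vs])
    show "(\<lambda>ws. y * lie_derivative X D \<omega> ws) - (\<lambda>ws. D y * \<omega> ws) \<in> forms X ?n"
      using L \<omega> yf(1) Dyf by (intro forms_minus forms_times) auto
  qed (simp add: Lvs y_def[symmetric])
  have proportional: "y * lie_derivative X D \<omega> ws = D y * \<omega> ws" for ws
    using fun_cong[OF zero, of ws] by simp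
  \<comment> \<open>A priori the divergence is only the fraction \<open>D y / y\<close>, and
    \<open>I\<close> consists of its denominators. By proportionality \<open>I\<close> contains the
    values of \<open>\<omega>\<close>, which have no common zero; so the fraction is regular and
    \<open>nilp_eigen\<close> applies.\<close>
  define I where "I = {g \<in> funs X. \<exists>h\<in>funs X. g * D y = y * h}"
  have "one_of X \<in> I"
  proof (rule nullstellensatz)
    show "ideal_of X I"
      unfolding ideal_of_def
    proof (intro conjI ballI)
      show "I \<subseteq> funs X" by (auto simp: I_def)
      show "0 \<in> I" unfolding I_def by (intro CollectI conjI bexI[of _ 0]) auto
      fix a b assume "a \<in> I" "b \<in> I"
      then obtain h h' where "a \<in> funs X" "b \<in> funs X" "h \<in> funs X" "h' \<in> funs X" "a * D y = y * h" "b * D y = y * h'"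
        unfolding I_def by blast
      then show "a + b \<in> I" unfolding I_def
        by (intro CollectI conjI bexI[of _ "h + h'"]) (auto simp: algebra_simps)
    next
      fix a b assume a: "a \<in> funs X" and "b \<in> I"
      then obtain h where "b \<in> funs X" "h \<in> funs X" "b * D y = y * h"
        unfolding I_def by blast
      then show "a * b \<in> I" unfolding I_def using a
        by (intro CollectI conjI bexI[of _ "a * h"]) (simp_all add: mult.assoc mult.left_commute[of a y])
    qed
    fix x assume "x \<in> points X"
    then obtain ws where "\<omega> ws x \<noteq> 0" using nv unfolding nowhere_vanishing_def by blast
    moreover have "\<omega> ws \<in> I" unfolding I_def
      using forms_funs[OF \<omega>] forms_funs[OF L] proportional
      by (intro CollectI conjI bexI[of _ "lie_derivative X D \<omega> ws"]) (simp_all add: mult.commute)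
    ultimately show "\<exists>f\<in>I. f x \<noteq> 0" by blast
  qed
  then obtain h where h: "h \<in> funs X" "D y = y * h" using Dyf unfolding I_def by auto
  have Dy: "D y = 0" using nilp_eigen[OF nilp yf(1) h] .
  show ?thesis
  proof
    fix ws
    have "y * lie_derivative X D \<omega> ws = 0" using proportional Dy by simp
    then show "lie_derivative X D \<omega> ws = 0 ws"
      using funs_domain[OF yf(1) forms_funs[OF L]] yf(2) by auto
  qed
qed

section \<open>Fields in the generated Lie algebra\<close>

lemma AVF_iff: "D \<in> AVF X \<omega> \<longleftrightarrow> D \<in> VF \<and> lie_derivative X D \<omega> = 0"
  by (auto simp: AVF_def has_divergence_def zero_fun_def[symmetric])

lemma vf_const_eq:
  assumes "D \<in> VF" shows "(\<lambda>f. const c * D f) = (\<lambda>f. (const c * one_of X) * D f)"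
proof
  fix f
  have "D f \<in> funs X" using assms vf_outside[of D f] by (cases "f \<in> funs X") auto
  then show "const c * D f = (const c * one_of X) * D f" by (rule const_one_of)
qed

lemma lie_generated_scale:
  assumes "D \<in> lie_generated G" shows "(\<lambda>f. const c * D f) \<in> lie_generated G"
  using lie_generated.scale[OF assms, of c] by (simp add: const_def times_fun_def)

lemma lie_generated_uminus: assumes "D \<in> lie_generated G" shows "- D \<in> lie_generated G"
  using lie_generated_scale[OF assms, of "-1"] by (simp add: const_def times_fun_def fun_Compl_def)

lemma Lie_alg_AVF:
  assumes \<omega>: "\<omega> \<in> forms X k" and D: "D \<in> Lie_alg X \<omega>"
  shows "D \<in> VF" "lie_derivative X D \<omega> = 0"
proof -
  have "D \<in> VF \<and> lie_derivative X D \<omega> = 0"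
    using D unfolding Lie_alg_def
  proof induction
    case (gen D)
    then show ?case by (simp add: IVF_def AVF_iff)
  next
    case zero
    have "lie_derivative X 0 \<omega> vs = 0" for vs
    proof (cases "set vs \<subseteq> VF")
      case True
      then show ?thesis using lie_derivative_plus_left[OF \<omega> vf_0 vf_0] by simp
    qed (simp add: lie_derivative_outside)
    then have "lie_derivative X 0 \<omega> = 0" by (simp add: fun_eq_iff[where f = "lie_derivative X 0 \<omega>"])
    then show ?case using vf_0 by blast
  next
    case (add D E)
    have "lie_derivative X (D + E) \<omega> vs = 0" for vs
      using add lie_derivative_plus_left[OF \<omega>, of D E vs]
      by (cases "set vs \<subseteq> VF") (simp_all add: lie_derivative_outside)
    then have "lie_derivative X (D + E) \<omega> = 0" by (intro ext) simp
    then show ?case using add vf_plus by blast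
  next
    case (scale D c)
    have D: "D \<in> VF" and e: "(\<lambda>f x. c * D f x) = (\<lambda>f. (const c * one_of X) * D f)"
      using scale vf_const_eq[of D c] by (auto simp: const_def times_fun_def)
    have "lie_derivative X (\<lambda>f. (const c * one_of X) * D f) \<omega> vs = 0" for vs
    proof (cases "set vs \<subseteq> VF")
      case True
      have "(vs ! i) (const c * one_of X) = 0" if "i < length vs" for i
        using nth_VF[OF True that] by (simp add: vf_const)
      then show ?thesis
        using scale lie_derivative_times_left[OF \<omega> D, of "const c * one_of X" vs] True by simp
    qed (simp add: lie_derivative_outside)
    then have "lie_derivative X (\<lambda>f. (const c * one_of X) * D f) \<omega> = 0" by (intro ext) simp
    then show ?case unfolding e using vf_times[OF D, of "const c * one_of X"] by blast
  next
    case (bracket D E)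
    then have DE: "D \<in> VF" "E \<in> VF" "lie_derivative X D \<omega> = 0" "lie_derivative X E \<omega> = 0" by auto
    have "lie_derivative X (bracket D E) \<omega> = 0"
      unfolding lie_derivative_bracket[OF DE(1,2) \<omega>] DE(3,4) by (simp only: lie_derivative_zero DE(1,2) diff_self)
    then show ?case using DE vf_bracket by blast
  qed
  then show "D \<in> VF" "lie_derivative X D \<omega> = 0" by auto
qed

text \<open>By Cartan's formula the differential is the Lie derivative along \<open>a\<close> of the
  interior product of \<open>b\<close> with \<open>\<omega>\<close>, minus a term with the
  differential of that interior product. The latter is 0, since \<open>\<omega>\<close> is closed
  and \<open>b\<close> preserves it; the former has only the bracket term, since \<open>a\<close>
  preserves \<open>\<omega>\<close>.\<close>

lemma ext_d_interior_interior:
  assumes smooth: "smooth_variety X" and \<omega>: "\<omega> \<in> forms X (variety_dim X)"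
    and a: "a \<in> VF" "lie_derivative X a \<omega> = 0" and b: "b \<in> VF" "lie_derivative X b \<omega> = 0"
  shows "ext_d X (interior_product a (interior_product b \<omega>)) = interior_product (bracket a b) \<omega>"
proof
  fix vs
  show "ext_d X (interior_product a (interior_product b \<omega>)) vs = interior_product (bracket a b) \<omega> vs"
  proof (cases "set vs \<subseteq> VF")
    case vs: True
    show ?thesis
    proof (cases "variety_dim X")
      case 0
      have "interior_product a (interior_product b \<omega>) = 0" "\<omega> (bracket a b # vs) = 0"
        using forms_outside[OF \<omega>] 0 by (simp_all add: fun_eq_iff[where f = "interior_product a _"])
      then show ?thesis by simp
    next
      case (Suc m)
      have \<sigma>: "interior_product b \<omega> \<in> forms X m" using \<omega> b unfolding Suc by auto
      have "lie_derivative X a (interior_product b \<omega>) vs = \<omega> (bracket a b # vs)"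
        using lie_derivative_Cons[OF b(1) vs, of a \<omega>] a(2) by simp
      moreover have "ext_d X \<omega> = 0"
        using ext_d_forms[OF \<omega>] by (rule forms_above_dim[OF smooth])
      then have "ext_d X (interior_product b \<omega>) (a # vs) = 0"
        using ext_d_Cons[OF \<omega> b(1), of "a # vs"] a(1) vs b(2) by simp
      ultimately show ?thesis
        using ext_d_Cons[OF \<sigma> a(1) vs] by simp
    qed
  next
    case False
    then show ?thesis using forms_outside[OF \<omega>] by (simp add: ext_d_outside)
  qed
qed

end

section \<open>Locally nilpotent fields and their replicas\<close>

lemma pderiv_funpow_eq_0: "degree q \<le> d \<Longrightarrow> (pderiv ^^ Suc d) (q :: complex poly) = 0"
proof (induction d arbitrary: q)
  case 0
  then show ?case by (simp add: pderiv_eq_0_iff)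
next
  case (Suc d)
  then have "degree (pderiv q) \<le> d" by (simp add: degree_pderiv)
  from Suc.IH[OF this] show ?case by (simp add: funpow_swap1)
qed

lemma prod_variety_funsI:
  assumes "finite I" "\<And>i. i \<in> I \<Longrightarrow> a i \<in> funs V" "\<And>i. i \<in> I \<Longrightarrow> b i \<in> funs W"
  shows "(\<lambda>(x, y). \<Sum>i\<in>I. a i x * b i y) \<in> funs (prod_variety V W)"
proof -
  obtain h where h: "bij_betw h {0..<card I} I" using ex_bij_betw_nat_finite[OF assms(1)] by blast
  have "(\<lambda>(x, y). \<Sum>i\<in>I. a i x * b i y) = (\<lambda>(x, y). \<Sum>i<card I. a (h i) x * b (h i) y)"
    by (simp add: fun_eq_iff sum.reindex_bij_betw[OF h, symmetric] atLeast0LessThan)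
  moreover have "\<forall>i<card I. a (h i) \<in> funs V \<and> b (h i) \<in> funs W"
    using assms(2,3) bij_betwE[OF h] by auto
  ultimately show ?thesis unfolding prod_variety_def by fastforce
qed

context affine_var
begin

text \<open>A regular function on the product with the line is a finite sum of products, so along
  all orbits \<open>f\<close> is polynomial in \<open>t\<close> with finitely many common
  polynomials \<open>P i\<close>.\<close>

lemma algebraic_action_poly:
  assumes \<Phi>: "algebraic_additive_action X \<Phi>" and f: "f \<in> funs X"
  obtains m :: nat and P and g where "\<And>i. i < m \<Longrightarrow> g i \<in> funs X"
    "\<And>t x. x \<in> points X \<Longrightarrow> f (\<Phi> t x) = (\<Sum>i<m. poly (P i) t * g i x)"
proof -
  have "pullback (prod_variety affine_line X) (\<lambda>(t, x). \<Phi> t x) f \<in> funs (prod_variety affine_line X)"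
    using \<Phi> f unfolding algebraic_additive_action_def regular_map_def by blast
  then obtain m :: nat and p g where *: "\<forall>i<m. p i \<in> funs affine_line \<and> g i \<in> funs X"
    "pullback (prod_variety affine_line X) (\<lambda>(t, x). \<Phi> t x) f = (\<lambda>(t, x). \<Sum>i<m. p i t * g i x)"
    unfolding prod_variety_def by auto
  then have "\<forall>i<m. \<exists>q. p i = poly q" by (auto simp: affine_line_def)
  then obtain P where P: "\<And>i. i < m \<Longrightarrow> p i = poly (P i)" by metis
  show thesis
  proof (rule that[of m g P])
    show "g i \<in> funs X" if "i < m" for i using * that by blast
    fix t x assume x: "x \<in> points X"
    have "f (\<Phi> t x) = pullback (prod_variety affine_line X) (\<lambda>(t, x). \<Phi> t x) f (t, x)"
      using x by (simp add: pullback_def restrict_fun_def prod_variety_def affine_line_def)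
    then show "f (\<Phi> t x) = (\<Sum>i<m. poly (P i) t * g i x)" using P by (simp add: *(2))
  qed
qed

text \<open>The group law turns the derivative at time 0 into the derivative at every time
  \<open>t\<close>.\<close>

lemma locally_nilpotent_flow:
  assumes D: "D \<in> VF" and \<Phi>: "algebraic_additive_action X \<Phi>" and gen: "generated_by_action X \<Phi> D"
    and f: "f \<in> funs X" and Q: "\<And>t x. x \<in> points X \<Longrightarrow> f (\<Phi> t x) = poly (Q x) t"
    and x: "x \<in> points X"
  shows "(D ^^ k) f (\<Phi> t x) = poly ((pderiv ^^ k) (Q x)) t"
proof (induction k arbitrary: t)
  case 0
  then show ?case using Q x by simp
next
  case (Suc k)
  have act: "\<Phi> t x \<in> points X" "\<And>s. \<Phi> s (\<Phi> t x) = \<Phi> (s + t) x"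
    using \<Phi> x unfolding algebraic_additive_action_def additive_action_def by auto
  let ?R = "(pderiv ^^ k) (Q x)"
  have "((\<lambda>s. (D ^^ k) f (\<Phi> s (\<Phi> t x))) has_field_derivative D ((D ^^ k) f) (\<Phi> t x)) (at 0)"
    using gen act(1) vf_funpow[OF D f] unfolding generated_by_action_def by blast
  then have "((\<lambda>s. poly ?R (s + t)) has_field_derivative D ((D ^^ k) f) (\<Phi> t x)) (at 0)"
    by (simp add: act(2) Suc.IH)
  moreover have "((\<lambda>s. poly ?R (s + t)) has_field_derivative poly (pderiv ?R) t) (at 0)"
    by (auto intro!: derivative_eq_intros)
  ultimately show ?case using DERIV_unique by fastforce
qed

lemma locally_nilpotent_nilp:
  assumes "locally_nilpotent X D" shows "nilp D"
  unfolding nilp_def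
proof (intro conjI ballI)
  obtain \<Phi> where D: "D \<in> VF" and \<Phi>: "algebraic_additive_action X \<Phi>" "generated_by_action X \<Phi> D"
    using assms unfolding locally_nilpotent_def by blast
  show "D \<in> VF" by (rule D)
  fix f assume f: "f \<in> funs X"
  obtain m :: nat and P and g where g: "\<And>i. i < m \<Longrightarrow> g i \<in> funs X"
    "\<And>t x. x \<in> points X \<Longrightarrow> f (\<Phi> t x) = (\<Sum>i<m. poly (P i) t * g i x)"
    by (rule algebraic_action_poly[OF \<Phi>(1) f]) blast
  define Q where "Q x = (\<Sum>i<m. smult (g i x) (P i))" for x
  have Q: "f (\<Phi> t x) = poly (Q x) t" if "x \<in> points X" for t x
    using g(2)[OF that] by (simp add: Q_def poly_sum mult.commute)
  \<comment> \<open>The bound is the same for all points \<open>x\<close>, so one power of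
    \<open>D\<close> annihilates \<open>f\<close> everywhere.\<close>
  define d where "d = Max (insert 0 ((\<lambda>i. degree (P i)) ` {..<m}))"
  have "degree (Q x) \<le> d" for x
    unfolding Q_def
  proof (rule degree_sum_le)
    fix i assume "i \<in> {..<m}"
    then show "degree (smult (g i x) (P i)) \<le> d"
      by (intro order_trans[OF degree_smult_le]) (auto simp: d_def intro!: Max_ge)
  qed simp
  then have *: "(pderiv ^^ Suc d) (Q x) = 0" for x by (rule pderiv_funpow_eq_0)
  have "(D ^^ Suc d) f x = 0" if x: "x \<in> points X" for x
  proof -
    have "\<Phi> 0 x = x" using \<Phi>(1) x unfolding algebraic_additive_action_def additive_action_def by auto
    then show ?thesis
      using locally_nilpotent_flow[OF D \<Phi> f Q x, of "Suc d" 0] * by simp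
  qed
  then have "(D ^^ Suc d) f = 0"
    using vf_funpow[OF D f, of "Suc d"] by (intro funs_eqI) (auto simp: pointwise)
  then show "\<exists>k. (D ^^ k) f = 0" by blast
qed

lemma Ker_invariant:
  assumes D: "D \<in> VF" and \<Phi>: "algebraic_additive_action X \<Phi>" "generated_by_action X \<Phi> D"
    and f: "f \<in> Ker D" and x: "x \<in> points X"
  shows "f (\<Phi> t x) = f x"
proof -
  obtain m :: nat and P and g where g: "\<And>i. i < m \<Longrightarrow> g i \<in> funs X"
    "\<And>t x. x \<in> points X \<Longrightarrow> f (\<Phi> t x) = (\<Sum>i<m. poly (P i) t * g i x)"
    by (rule algebraic_action_poly[OF \<Phi>(1) KerD(1)[OF f]]) blast
  define Q where "Q x = (\<Sum>i<m. smult (g i x) (P i))" for x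
  have Q: "f (\<Phi> t x) = poly (Q x) t" if "x \<in> points X" for t x
    using g(2)[OF that] by (simp add: Q_def poly_sum mult.commute)
  have "poly (pderiv (Q x)) t = 0" for t
    using locally_nilpotent_flow[OF D \<Phi> KerD(1)[OF f] Q x, of 1 t] KerD(2)[OF f] by (simp add: pointwise)
  then have "pderiv (Q x) = 0" using poly_all_0_iff_0 by blast
  then obtain c where "Q x = [:c:]" using pderiv_eq_0_iff degree_eq_zeroE by metis
  moreover have "\<Phi> 0 x = x" using \<Phi>(1) x unfolding algebraic_additive_action_def additive_action_def by auto
  ultimately show ?thesis using Q[OF x, of t] Q[OF x, of 0] by simp
qed

text \<open>The function itself serves as the only local coordinate, followed by the projection to
  coordinate 0.\<close>

lemma holomorphic_function_regular:
  assumes "H \<in> funs V" "\<And>x. x \<in> points V \<Longrightarrow> h x = H x"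
  shows "holomorphic_function V h"
  unfolding holomorphic_function_def
proof
  fix x assume "x \<in> points V"
  have "(\<lambda>t. (w(i := t)) 0) holomorphic_on UNIV" for w :: "nat \<Rightarrow> complex" and i
    by (cases "i = 0") (auto intro: holomorphic_intros)
  then have "holomorphic_several UNIV (\<lambda>w. w 0)"
    unfolding holomorphic_several_def by (simp add: continuous_on_product_coordinates)
  then show "\<exists>m (z :: nat \<Rightarrow> _ \<Rightarrow> complex) W H.
     (\<forall>i<m. z i \<in> funs V) \<and> holomorphic_several W H \<and>
     (\<lambda>i. if i < m then z i x else 0) \<in> W \<and>
     (\<forall>y\<in>points V. (\<lambda>i. if i < m then z i y else 0) \<in> W \<longrightarrow>
        h y = H (\<lambda>i. if i < m then z i y else 0))"
    using assms by (intro exI[of _ 1] exI[of _ "\<lambda>_. H"] exI[of _ UNIV] exI[of _ "\<lambda>w. w 0"]) auto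
qed

text \<open>As \<open>f\<close> is constant along the orbits of \<open>D\<close>, rescaling time by
  \<open>f x\<close> gives an action again; it is even algebraic.\<close>

lemma complete_Ker_times:
  assumes nil: "locally_nilpotent X D" and f: "f \<in> Ker D"
  shows "complete_field X (\<lambda>g. f * D g)"
proof -
  obtain \<Phi> where D: "D \<in> VF" and \<Phi>: "algebraic_additive_action X \<Phi>" and gen: "generated_by_action X \<Phi> D"
    using nil unfolding locally_nilpotent_def by blast
  have ff: "f \<in> funs X" using f by blast
  have act: "\<Phi> t x \<in> points X" "\<Phi> 0 x = x" "\<Phi> s (\<Phi> t x) = \<Phi> (s + t) x" if "x \<in> points X" for s t x
    using \<Phi> that unfolding algebraic_additive_action_def additive_action_def by auto
  have inv: "f (\<Phi> t x) = f x" if "x \<in> points X" for t x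
    using Ker_invariant[OF D \<Phi> gen f that] .
  define \<Psi> where "\<Psi> t x = \<Phi> (t * f x) x" for t x
  have "additive_action X \<Psi>"
    unfolding additive_action_def using act inv by (simp add: \<Psi>_def distrib_right)
  moreover have "holomorphic_map (prod_variety affine_line X) X (\<lambda>(t, x). \<Psi> t x)"
    unfolding holomorphic_map_def
  proof (intro conjI ballI)
    show "(\<lambda>(t, x). \<Psi> t x) ` points (prod_variety affine_line X) \<subseteq> points X"
      using act by (auto simp: \<Psi>_def prod_variety_def)
    fix h assume h: "h \<in> funs X"
    obtain m :: nat and P and g where g: "\<And>i. i < m \<Longrightarrow> g i \<in> funs X"
      "\<And>t x. x \<in> points X \<Longrightarrow> h (\<Phi> t x) = (\<Sum>i<m. poly (P i) t * g i x)"
      by (rule algebraic_action_poly[OF \<Phi> h]) blast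
    \<comment> \<open>Expanding each \<open>P i\<close> into monomials separates \<open>t\<close>
      from \<open>f x\<close> in the powers of \<open>t * f x\<close>.\<close>
    let ?I = "SIGMA i:{..<m}. {..degree (P i)}"
    let ?a = "\<lambda>(i, j). poly (monom (coeff (P i) j) j)" and ?b = "\<lambda>(i, j). f ^ j * g i"
    show "holomorphic_function (prod_variety affine_line X) (h \<circ> (\<lambda>(t, x). \<Psi> t x))"
    proof (rule holomorphic_function_regular)
      show "(\<lambda>(t, x). \<Sum>ij\<in>?I. ?a ij t * ?b ij x) \<in> funs (prod_variety affine_line X)"
        using g(1) ff by (intro prod_variety_funsI) (auto simp: affine_line_def)
      fix tx assume "tx \<in> points (prod_variety affine_line X)"
      then obtain t x where tx: "tx = (t, x)" "x \<in> points X" by (auto simp: prod_variety_def)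
      have "h (\<Psi> t x) = (\<Sum>i<m. \<Sum>j\<le>degree (P i). coeff (P i) j * (t * f x) ^ j * g i x)"
        using g(2)[OF tx(2)] by (simp add: \<Psi>_def poly_altdef sum_distrib_right)
      also have "\<dots> = (\<Sum>ij\<in>?I. ?a ij t * ?b ij x)"
        by (subst sum.Sigma) (auto simp: poly_monom pointwise power_mult_distrib intro!: sum.cong)
      finally show "(h \<circ> (\<lambda>(t, x). \<Psi> t x)) tx = (\<lambda>(t, x). \<Sum>ij\<in>?I. ?a ij t * ?b ij x) tx"
        by (simp add: tx)
    qed
  qed
  moreover have "generated_by_action X \<Psi> (\<lambda>g. f * D g)"
    unfolding generated_by_action_def
  proof (intro ballI)
    fix h x assume h: "h \<in> funs X" and x: "x \<in> points X"
    have "((\<lambda>t. h (\<Phi> t x)) has_field_derivative D h x) (at (0 * f x))"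
      using gen h x unfolding generated_by_action_def by simp
    moreover have "((\<lambda>t. t * f x) has_field_derivative f x) (at 0)"
      by (auto intro!: derivative_eq_intros)
    ultimately have "((\<lambda>t. h (\<Phi> (t * f x) x)) has_field_derivative D h x * f x) (at 0)"
      by (rule DERIV_chain2)
    then show "((\<lambda>t. h (\<Psi> t x)) has_field_derivative (f * D h) x) (at 0)"
      by (simp add: \<Psi>_def pointwise mult.commute)
  qed
  ultimately show ?thesis
    unfolding complete_field_def holomorphic_additive_action_def using vf_times[OF D ff] by blast
qed

lemma Ker_times_IVF:
  assumes "smooth_variety X" "volume_form X \<omega>" "locally_nilpotent X D" "f \<in> Ker D"
  shows "(\<lambda>g. f * D g) \<in> IVF X \<omega>"
proof -
  have "nilp (\<lambda>g. f * D g)" using nilp_Ker_times locally_nilpotent_nilp assms by blast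
  then show ?thesis
    using nilp_lie_derivative[OF assms(1,2)] complete_Ker_times[OF assms(3,4)] nilpD(1)
    by (simp add: IVF_def AVF_iff)
qed

text \<open>The coordinate on the line is a function on the principal open set with derivative 1.
  Clearing its denominator, a power of the invariant function \<open>\<alpha>\<close>, gives a local
  slice on all of \<open>X\<close>.\<close>

lemma slice_on_principal_open:
  assumes E: "E \<in> VF" and \<alpha>: "\<alpha> \<in> funs X" "E \<alpha> = 0" and slice: "admits_slice_on X \<alpha> E"
  shows "\<exists>s\<in>funs X. \<exists>r. E s = \<alpha> ^ Suc r" "\<exists>x\<in>points X. \<alpha> x \<noteq> 0"
proof -
  define U where "U = principal_open X \<alpha>"
  obtain D' \<Phi> and R :: "(nat \<Rightarrow> complex) variety" and \<psi> where
    D': "D' \<in> vector_fields U" "\<And>f. f \<in> funs X \<Longrightarrow> D' (restrict_fun U f) = restrict_fun U (E f)"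
    and \<Phi>: "algebraic_additive_action U \<Phi>" "generated_by_action U \<Phi> D'"
    and R: "affine_variety R" and \<psi>: "variety_iso U (prod_variety R affine_line) \<psi>"
    and tr: "\<And>t x. x \<in> points U \<Longrightarrow> \<psi> (\<Phi> t x) = (fst (\<psi> x), snd (\<psi> x) + t)"
    using slice unfolding admits_slice_on_def U_def by blast
  interpret R: affine_var R by standard (rule R)
  have ptU: "x \<in> points U \<longleftrightarrow> x \<in> points X \<and> \<alpha> x \<noteq> 0" for x
    by (simp add: U_def principal_open_def)
  have "points U \<noteq> {}"
    using \<psi> R.points_nonempty unfolding variety_iso_def bij_betw_def
    by (auto simp: prod_variety_def affine_line_def)
  then show "\<exists>x\<in>points X. \<alpha> x \<noteq> 0" using ptU by blast
  have funsU: "g \<in> funs U \<longleftrightarrow> (\<exists>f m. f \<in> funs X \<and> g = (\<lambda>x. if x \<in> points X \<and> \<alpha> x \<noteq> 0 then f x / \<alpha> x ^ m else 0))" for g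
    unfolding U_def principal_open_def by auto
  define q where "q = (\<lambda>(x, y). \<Sum>i\<in>{0::nat}. one_of R x * poly [:0, 1:] y)"
  have "q \<in> funs (prod_variety R affine_line)"
    unfolding q_def by (rule prod_variety_funsI) (simp_all add: affine_line_def del: poly_pCons)
  then have s: "pullback U \<psi> q \<in> funs U" using \<psi> unfolding variety_iso_def regular_map_def by blast
  define \<sigma> where "\<sigma> = pullback U \<psi> q"
  have \<sigma>: "\<sigma> x = snd (\<psi> x)" if "x \<in> points U" for x
  proof -
    have "\<psi> x \<in> points (prod_variety R affine_line)"
      using \<psi> that unfolding variety_iso_def regular_map_def by blast
    then show ?thesis using that
      by (cases "\<psi> x") (simp add: \<sigma>_def pullback_def restrict_fun_def q_def one_of_def prod_variety_def)
  qed
  have act: "\<Phi> t x \<in> points U" if "x \<in> points U" for t x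
    using \<Phi>(1) that unfolding algebraic_additive_action_def additive_action_def by blast
  have D'\<sigma>: "D' \<sigma> x = 1" if x: "x \<in> points U" for x
  proof -
    have "((\<lambda>t. \<sigma> (\<Phi> t x)) has_field_derivative D' \<sigma> x) (at 0)"
      using \<Phi>(2) s x unfolding generated_by_action_def \<sigma>_def by blast
    then have "((\<lambda>t. snd (\<psi> x) + t) has_field_derivative D' \<sigma> x) (at 0)"
      using \<sigma>[OF act[OF x]] tr[OF x] by simp
    moreover have "((\<lambda>t. snd (\<psi> x) + t) has_field_derivative 1) (at 0)"
      by (auto intro!: derivative_eq_intros)
    ultimately show ?thesis by (rule DERIV_unique)
  qed
  obtain f m where f: "f \<in> funs X" "\<sigma> = (\<lambda>x. if x \<in> points X \<and> \<alpha> x \<noteq> 0 then f x / \<alpha> x ^ m else 0)"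
    using s unfolding \<sigma>_def[symmetric] funsU by blast
  define \<rho> where "\<rho> = restrict_fun U \<alpha>"
  have \<rho>f: "\<rho> \<in> funs U" unfolding funsU
    by (intro exI[of _ \<alpha>] exI[of _ 0]) (auto simp: \<rho>_def restrict_fun_def ptU \<alpha>)
  have \<rho>0: "D' \<rho> = 0"
    unfolding \<rho>_def D'(2)[OF \<alpha>(1)] \<alpha>(2) by (rule ext) (simp add: restrict_fun_def pointwise)
  have \<rho>m: "g * \<rho> \<in> funs U" if g: "g \<in> funs U" for g
  proof -
    obtain h k where h: "h \<in> funs X" "g = (\<lambda>x. if x \<in> points X \<and> \<alpha> x \<noteq> 0 then h x / \<alpha> x ^ k else 0)"
      using g unfolding funsU by (elim exE conjE)
    have "g * \<rho> = (\<lambda>x. if x \<in> points X \<and> \<alpha> x \<noteq> 0 then (h * \<alpha>) x / \<alpha> x ^ k else 0)"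
      by (rule ext) (simp add: h(2) \<rho>_def restrict_fun_def ptU pointwise)
    then show ?thesis unfolding funsU by (intro exI conjI) (rule funs_mult[OF h(1) \<alpha>(1)])
  qed
  have D'm: "D' (g * h) = g * D' h + h * D' g" if "g \<in> funs U" "h \<in> funs U" for g h
    using D'(1) that unfolding vector_fields_def by blast
  have pw: "\<sigma> * \<rho> ^ j \<in> funs U \<and> D' (\<sigma> * \<rho> ^ j) = D' \<sigma> * \<rho> ^ j" for j
  proof (induction j)
    case 0
    then show ?case using s by (simp add: \<sigma>_def)
  next
    case (Suc j)
    have e: "\<sigma> * \<rho> ^ Suc j = \<sigma> * \<rho> ^ j * \<rho>" by (simp add: mult.commute mult.left_commute)
    show ?case unfolding e using \<rho>m[of "\<sigma> * \<rho> ^ j"] D'm[of "\<sigma> * \<rho> ^ j" \<rho>] Suc \<rho>f \<rho>0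
      by (simp add: mult.commute mult.left_commute)
  qed
  have "restrict_fun U f = \<sigma> * \<rho> ^ m"
    by (auto simp: fun_eq_iff pointwise \<rho>_def restrict_fun_def ptU f(2))
  then have "restrict_fun U (E f) = D' \<sigma> * \<rho> ^ m" using D'(2)[OF f(1)] pw[of m] by simp
  then have Ef: "E f x = \<alpha> x ^ m" if "x \<in> points X" "\<alpha> x \<noteq> 0" for x
    using that D'\<sigma>[of x] by (auto simp: fun_eq_iff pointwise \<rho>_def restrict_fun_def ptU dest!: spec[of _ x])
  \<comment> \<open>The additional factor \<open>\<alpha>\<close> makes both sides vanish where
    \<open>\<alpha>\<close> does, since \<open>E f\<close> has been computed only elsewhere. It is
    the reason for \<open>Suc r\<close> in the exponent.\<close>
  have "E (\<alpha> * f) = \<alpha> * E f" using vf_Ker_mult[OF E KerI[of \<alpha> E]] \<alpha> f(1) by simp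
  also have "\<dots> = \<alpha> ^ Suc m"
  proof
    fix x
    show "(\<alpha> * E f) x = (\<alpha> ^ Suc m) x"
      using Ef[of x] funs_outside[OF \<alpha>(1), of x]
      by (cases "x \<in> points X \<and> \<alpha> x \<noteq> 0") (auto simp: pointwise)
  qed
  finally show "\<exists>s\<in>funs X. \<exists>r. E s = \<alpha> ^ Suc r" using \<alpha>(1) f(1) by blast
qed

end

section \<open>Products of kernels\<close>

text \<open>For subalgebras \<open>K\<close> and \<open>L\<close> this is the ring they generate
  together, the image of their tensor product.\<close>

inductive_set prodspan :: "('a \<Rightarrow> complex) set \<Rightarrow> ('a \<Rightarrow> complex) set \<Rightarrow> ('a \<Rightarrow> complex) set"
  for K L :: "('a \<Rightarrow> complex) set" where
  zero: "0 \<in> prodspan K L"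
| add: "f \<in> K \<Longrightarrow> g \<in> L \<Longrightarrow> e \<in> prodspan K L \<Longrightarrow> f * g + e \<in> prodspan K L"

lemma prodspan_plus: "d \<in> prodspan K L \<Longrightarrow> e \<in> prodspan K L \<Longrightarrow> d + e \<in> prodspan K L"
  by (induction rule: prodspan.induct) (auto simp: add.assoc intro: prodspan.add)

lemma prodspan_base: "f \<in> K \<Longrightarrow> g \<in> L \<Longrightarrow> f * g \<in> prodspan K L"
  using prodspan.add[OF _ _ prodspan.zero] by fastforce

lemma prodspan_mult:
  assumes K: "\<And>f g. f \<in> K \<Longrightarrow> g \<in> K \<Longrightarrow> f * g \<in> K" and L: "\<And>f g. f \<in> L \<Longrightarrow> g \<in> L \<Longrightarrow> f * g \<in> L"
    and "d \<in> prodspan K L" "e \<in> prodspan K L"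
  shows "d * e \<in> prodspan K L"
proof -
  have 1: "(f * g) * e \<in> prodspan K L" if "f \<in> K" "g \<in> L" "e \<in> prodspan K L" for f g e
    using that(3)
  proof induction
    case zero
    then show ?case using prodspan.zero by simp
  next
    case (add f' g' e)
    have "(f * g) * (f' * g' + e) = (f * f') * (g * g') + (f * g) * e" by (simp add: algebra_simps)
    then show ?case using prodspan.add[OF K[OF that(1) add(1)] L[OF that(2) add(2)] add.IH] by simp
  qed
  show ?thesis using assms(3)
  proof induction
    case zero
    then show ?case using prodspan.zero by simp
  next
    case (add f g d)
    then show ?case using prodspan_plus[OF 1[OF add(1,2) assms(4)] add.IH] by (simp add: distrib_right)
  qed
qed

context affine_var
begin

text \<open>For \<open>\<xi> = \<xi>\<^sub>j\<close> this is the ring \<open>E\<^sub>j\<close> of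
  the overview.\<close>

abbreviation PK :: "'a vfield \<Rightarrow> 'a vfield \<Rightarrow> ('a \<Rightarrow> complex) set" where
  "PK \<xi> \<eta> \<equiv> prodspan (Ker \<xi>) (Ker \<eta>)"

lemma PK_funs: "e \<in> PK \<xi> \<eta> \<Longrightarrow> e \<in> funs X"
  by (induction rule: prodspan.induct) (auto intro!: funs_add funs_mult)

lemma PK_mult: "\<xi> \<in> VF \<Longrightarrow> \<eta> \<in> VF \<Longrightarrow> d \<in> PK \<xi> \<eta> \<Longrightarrow> e \<in> PK \<xi> \<eta> \<Longrightarrow> d * e \<in> PK \<xi> \<eta>"
  using prodspan_mult Ker_mult by blast

lemma PK_Ker_left: assumes "\<eta> \<in> VF" "f \<in> Ker \<xi>" shows "f \<in> PK \<xi> \<eta>"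
  using prodspan_base[OF assms(2) Ker_one[OF assms(1)]] KerD(1)[OF assms(2)] by simp

lemma PK_Ker_right: assumes "\<xi> \<in> VF" "f \<in> Ker \<eta>" shows "f \<in> PK \<xi> \<eta>"
  using prodspan_base[OF Ker_one[OF assms(1)] assms(2)] KerD(1)[OF assms(2)] by simp

lemma PK_power_mult:
  "\<xi> \<in> VF \<Longrightarrow> \<eta> \<in> VF \<Longrightarrow> d \<in> PK \<xi> \<eta> \<Longrightarrow> e \<in> PK \<xi> \<eta> \<Longrightarrow> d ^ n * e \<in> PK \<xi> \<eta>"
  by (induction n) (auto simp: mult.assoc intro: PK_mult)

lemma PK_power_mono:
  assumes "\<xi> \<in> VF" "\<eta> \<in> VF" "a \<in> Ker \<xi>" "a ^ m * y \<in> PK \<xi> \<eta>" "m \<le> n"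
  shows "a ^ n * y \<in> PK \<xi> \<eta>"
proof -
  have "a ^ n * y = a ^ (n - m) * (a ^ m * y)"
    using assms(5) by (simp add: mult.assoc[symmetric] power_add[symmetric])
  then show ?thesis using PK_power_mult[OF assms(1,2) PK_Ker_left[OF assms(2,3)] assms(4)] by simp
qed

text \<open>After inverting \<open>a\<close>, the ring of functions consists of the polynomials in
  the slice \<open>s\<close> over \<open>Ker \<xi>\<close>. The set \<open>L\<close> is general
  because it is used both as \<open>Ker \<eta>\<close> and as the set on which two derivations are
  compared.\<close>

lemma slice_localization:
  assumes nil: "nilp \<xi>" and L: "L \<subseteq> funs X" "one_of X \<in> L" "\<And>f g. f \<in> L \<Longrightarrow> g \<in> L \<Longrightarrow> f * g \<in> L"
    and s: "s \<in> L" "\<xi> s = a" and a: "a \<in> Ker \<xi>" and y: "y \<in> funs X"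
  shows "\<exists>m. a ^ m * y \<in> prodspan (Ker \<xi>) L"
proof -
  let ?P = "prodspan (Ker \<xi>) L"
  have \<xi>: "\<xi> \<in> VF" using nil nilpD by blast
  have af: "a \<in> funs X" and sf: "s \<in> funs X" using a s L by auto
  have mult: "d * e \<in> ?P" if "d \<in> ?P" "e \<in> ?P" for d e
    using prodspan_mult[OF Ker_mult[OF \<xi>] L(3) that] by blast
  have pow_mult: "d ^ n * e \<in> ?P" if "d \<in> ?P" "e \<in> ?P" for d e n
    by (induction n) (auto simp: mult.assoc intro: mult that)
  have left: "f \<in> ?P" if "f \<in> Ker \<xi>" for f
    using prodspan_base[OF that L(2)] KerD(1)[OF that] by simp
  have right: "f \<in> ?P" if "f \<in> L" for f
    using prodspan_base[OF Ker_one[OF \<xi>] that] L(1) that by (simp add: subset_iff)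
  \<comment> \<open>The constant built up in the induction is \<open>k!\<close>.\<close>
  have pow: "\<exists>c>0. (\<xi> ^^ k) (b * s ^ k) = const (of_nat c) * (a ^ k * b) \<and> (\<xi> ^^ Suc k) (b * s ^ k) = 0"
    if b: "b \<in> Ker \<xi>" for b k
  proof (induction k)
    case 0
    show ?case using b KerD by (intro exI[of _ 1]) simp
  next
    case (Suc k)
    then obtain c where c: "c > 0" "(\<xi> ^^ k) (b * s ^ k) = const (of_nat c) * (a ^ k * b)"
      "(\<xi> ^^ Suc k) (b * s ^ k) = 0" by blast
    have "(\<xi> ^^ Suc 1) s = 0" using s(2) KerD(2)[OF a] by simp
    moreover have "b * s ^ k \<in> funs X" using b sf by auto
    ultimately obtain d where d: "d > 0"
      "(\<xi> ^^ (1 + k)) (s * (b * s ^ k)) = const (of_nat d) * ((\<xi> ^^ 1) s * (\<xi> ^^ k) (b * s ^ k))"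
      "(\<xi> ^^ Suc (1 + k)) (s * (b * s ^ k)) = 0"
      using leibniz_top[OF \<xi> sf, of "b * s ^ k" 1 k] c(3) by blast
    have "(\<xi> ^^ Suc k) (b * s ^ Suc k) = const (of_nat (d * c)) * (a ^ Suc k * b)"
      using d(2) by (simp add: c(2) s(2) const_mult mult_ac)
    moreover have "(\<xi> ^^ Suc (Suc k)) (b * s ^ Suc k) = 0" using d(3) by (simp add: mult_ac)
    ultimately show ?case using c(1) d(1) by (intro exI[of _ "d * c"]) simp
  qed
  obtain k where "(\<xi> ^^ k) y = 0" using nilpD(2)[OF nil y] by blast
  then show ?thesis using y
  proof (induction k arbitrary: y)
    case 0
    then show ?case using prodspan.zero by auto
  next
    case (Suc k)
    define b where "b = (\<xi> ^^ k) y"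
    have b: "b \<in> Ker \<xi>" using Suc.prems \<xi> by (intro KerI) (auto simp: b_def)
    obtain c where c: "c > 0" "(\<xi> ^^ k) (b * s ^ k) = const (of_nat c) * (a ^ k * b)" using pow[OF b] by blast
    \<comment> \<open>\<open>w\<close> has the same \<open>k\<close>-th derivative as
      \<open>a ^ k * y\<close>, so their difference has smaller order; it is the leading term in the
      expansion of \<open>y\<close> in powers of \<open>s\<close>.\<close>
    define w where "w = const (1 / of_nat c) * (b * s ^ k)"
    have bs: "b * s ^ k \<in> funs X" using b sf by auto
    have w: "w \<in> funs X" unfolding w_def using bs by (rule funs_const_mult)
    have "(\<xi> ^^ k) w = const (1 / of_nat c) * (const (of_nat c) * (a ^ k * b))"
      unfolding w_def vf_funpow_const[OF \<xi> bs] c(2) ..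
    also have "\<dots> = a ^ k * b" using c(1) by (simp add: mult.assoc[symmetric] const_mult[symmetric])
    finally have "(\<xi> ^^ k) (a ^ k * y - w) = 0"
      using vf_funpow_Ker_power_mult[OF \<xi> a Suc.prems(2), of k k] w Suc.prems(2) af \<xi>
      by (simp add: vf_funpow_diff b_def)
    then obtain m where m: "a ^ m * (a ^ k * y - w) \<in> ?P"
      using Suc.IH[of "a ^ k * y - w"] w Suc.prems(2) af by auto
    have "s ^ k * b \<in> ?P" using pow_mult[OF right[OF s(1)] left[OF b]] .
    moreover have "const (1 / of_nat c) * one_of X \<in> ?P"
      using left[OF Ker_const[OF \<xi> Ker_one[OF \<xi>]]] .
    ultimately have "(const (1 / of_nat c) * one_of X) * (s ^ k * b) \<in> ?P" using mult by blast
    also have "(const (1 / of_nat c) * one_of X) * (s ^ k * b) = w"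
      unfolding w_def using const_one_of[OF bs, of "1 / of_nat c"] by (simp add: mult.commute)
    finally have "a ^ m * w \<in> ?P" using pow_mult[OF left[OF a]] by blast
    from prodspan_plus[OF m this] have "a ^ m * (a ^ k * y) \<in> ?P" by (simp add: algebra_simps)
    then have "a ^ (m + k) * y \<in> ?P" by (simp add: power_add mult.assoc)
    then show ?case by blast
  qed
qed

text \<open>A derivation of the domain of regular functions is determined by its values on the kernel of
  \<open>z\<close> and on a local slice of \<open>z\<close>.\<close>

lemma derivation_vanishing_on_Ker:
  assumes nil: "nilp z" and s: "s \<in> funs X" "z s = a" and a: "a \<in> Ker z" "a \<noteq> 0"
    and D: "D \<in> VF" "\<And>b. b \<in> Ker z \<Longrightarrow> D b = 0" and y: "y \<in> funs X"
  shows "a * D y = D s * z y"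
proof -
  have z: "z \<in> VF" using nil nilpD by blast
  have af: "a \<in> funs X" using a by blast
  define G where "G = {y \<in> funs X. a * D y = D s * z y}"
  have G_mult: "f * g \<in> G" if "f \<in> G" "g \<in> G" for f g
  proof -
    from that have *: "f \<in> funs X" "g \<in> funs X" "a * D f = D s * z f" "a * D g = D s * z g"
      by (auto simp: G_def)
    have "a * D (f * g) = f * (a * D g) + g * (a * D f)"
      using *(1,2) D(1) by (simp add: vf_mult algebra_simps)
    also have "\<dots> = D s * z (f * g)"
      unfolding *(3,4) using *(1,2) z by (simp add: vf_mult algebra_simps)
    finally show ?thesis using * by (simp add: G_def)
  qed
  have G_add: "f + g \<in> G" if "f \<in> G" "g \<in> G" for f g
    using that D z by (auto simp: G_def vf_add distrib_left)
  have KG: "b \<in> G" if "b \<in> Ker z" for b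
    using that D(2)[OF that] KerD[OF that] by (simp add: G_def)
  have sG: "s \<in> G" using s by (simp add: G_def mult.commute)
  have sub: "e \<in> G" if "e \<in> prodspan (Ker z) G" for e
    using that by induction (use D z G_add G_mult KG in \<open>auto simp: G_def\<close>)
  have "\<exists>m. a ^ m * y \<in> prodspan (Ker z) G"
  proof (rule slice_localization[OF nil _ _ G_mult sG s(2) a(1) y])
    show "G \<subseteq> funs X" by (auto simp: G_def)
    show "one_of X \<in> G" using KG Ker_one[OF z] by blast
  qed
  then obtain m where "a ^ m * y \<in> G" using sub by blast
  then have "a * D (a ^ m * y) = D s * z (a ^ m * y)" by (simp add: G_def)
  then have "a ^ m * (a * D y) = a ^ m * (D s * z y)"
    using vf_Ker_power_mult[OF D(1) KerI[of a D, OF af D(2)[OF a(1)]] y] vf_Ker_power_mult[OF z a(1) y]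
    by (simp add: mult_ac)
  then have "a ^ m * (a * D y - D s * z y) = 0" by (simp add: right_diff_distrib)
  moreover have "a * D y - D s * z y \<in> funs X" using af D z s y by auto
  ultimately have "a * D y - D s * z y = 0"
    using funs_power_mult_nonzero[OF af _ a(2)] by blast
  then show ?thesis by simp
qed

text \<open>The space \<open>L\<close> of the overview without the condition on the degree. Regular
  values suffice for the additivity of \<open>ext_d\<close>; membership in the forms of degree
  \<open>n - 2\<close> is established separately.\<close>

definition exact_lie :: "'a form \<Rightarrow> 'a form set" where
  "exact_lie \<omega> = {\<tau>. (\<forall>vs. \<tau> vs \<in> funs X) \<and> ext_d X \<tau> \<in> Theta \<omega> ` Lie_alg X \<omega>}"

lemma exact_lie_plus:
  assumes \<omega>: "\<omega> \<in> forms X k" and "\<sigma> \<in> exact_lie \<omega>" "\<tau> \<in> exact_lie \<omega>"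
  shows "\<sigma> + \<tau> \<in> exact_lie \<omega>"
proof -
  obtain D E where *: "D \<in> Lie_alg X \<omega>" "E \<in> Lie_alg X \<omega>" "ext_d X \<sigma> = Theta \<omega> D" "ext_d X \<tau> = Theta \<omega> E"
    using assms unfolding exact_lie_def by blast
  have f: "\<sigma> vs \<in> funs X" "\<tau> vs \<in> funs X" for vs using assms by (auto simp: exact_lie_def)
  have "ext_d X (\<sigma> + \<tau>) = Theta \<omega> (D + E)"
    unfolding ext_d_plus[OF f] *(3,4) Theta_def
    using interior_plus[OF \<omega>] Lie_alg_AVF(1)[OF \<omega>] * by simp
  moreover have "D + E \<in> Lie_alg X \<omega>" using * unfolding Lie_alg_def by (intro lie_generated.add)
  ultimately show ?thesis using f unfolding exact_lie_def by auto
qed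

lemma exact_lie_uminus:
  assumes \<omega>: "\<omega> \<in> forms X k" and "\<tau> \<in> exact_lie \<omega>"
  shows "- \<tau> \<in> exact_lie \<omega>"
proof -
  obtain D where *: "D \<in> Lie_alg X \<omega>" "ext_d X \<tau> = Theta \<omega> D"
    using assms unfolding exact_lie_def by blast
  have f: "\<tau> vs \<in> funs X" for vs using assms by (auto simp: exact_lie_def)
  have D: "D \<in> VF" using Lie_alg_AVF(1)[OF \<omega> *(1)] .
  have e: "- \<tau> = (\<lambda>vs. const (- 1) * \<tau> vs)" by (simp add: fun_eq_iff[where f = "- \<tau>"] const_uminus)
  have "ext_d X (- \<tau>) = Theta \<omega> (- D)"
  proof
    fix vs
    have "ext_d X (- \<tau>) vs = - \<omega> (D # vs)"
      unfolding e ext_d_const[OF f] using *(2) by (simp add: Theta_def const_uminus)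
    also have "\<dots> = \<omega> (- D # vs)"
      using forms_uminus_arg[OF \<omega> D, of "[]" vs] forms_outside[OF \<omega>]
      by (cases "set vs \<subseteq> VF") auto
    finally show "ext_d X (- \<tau>) vs = Theta \<omega> (- D) vs" by (simp add: Theta_def)
  qed
  moreover have "- D \<in> Lie_alg X \<omega>" using * unfolding Lie_alg_def by (intro lie_generated_uminus)
  ultimately show ?thesis using f unfolding exact_lie_def by auto
qed

lemma exact_lie_minus:
  assumes \<omega>: "\<omega> \<in> forms X k" and "\<sigma> \<in> exact_lie \<omega>" "\<tau> \<in> exact_lie \<omega>"
  shows "\<sigma> - \<tau> \<in> exact_lie \<omega>"
  using exact_lie_plus[OF \<omega> assms(2) exact_lie_uminus[OF \<omega> assms(3)]] by simp

lemma exact_lie_zero: "0 \<in> exact_lie \<omega>" if "\<omega> \<in> forms X k"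
proof -
  have "Theta \<omega> 0 = 0"
  proof
    fix vs
    show "Theta \<omega> 0 vs = 0 vs"
      using forms_zero_arg[OF that, of "[]" vs] forms_outside[OF that]
      by (cases "set vs \<subseteq> VF") (auto simp: Theta_def)
  qed
  moreover have "0 \<in> Lie_alg X \<omega>" unfolding Lie_alg_def by (rule lie_generated.zero)
  ultimately show ?thesis unfolding exact_lie_def using ext_d_zero by (auto intro!: image_eqI[of _ _ 0])
qed

lemma exact_lie_sum:
  assumes "\<omega> \<in> forms X k" "\<And>i. i \<in> I \<Longrightarrow> T i \<in> exact_lie \<omega>"
  shows "(\<Sum>i\<in>I. T i) \<in> exact_lie \<omega>"
  using assms(2)
  by (induction I rule: infinite_finite_induct) (auto intro: exact_lie_zero[OF assms(1)] exact_lie_plus[OF assms(1)])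

lemma forms_two_outside:
  assumes "\<omega> \<in> forms X k" "\<not> set vs \<subseteq> VF" shows "\<omega> (a # b # vs) = 0"
  using forms_outside[OF assms(1), of "a # b # vs"] assms(2) by auto

end

section \<open>Forms obtained from pairs of locally nilpotent fields\<close>

locale volume_var = affine_var X for X :: "'a variety" +
  fixes \<omega> :: "'a form"
  assumes smooth: "smooth_variety X" and volume: "volume_form X \<omega>"
begin

lemma \<omega>_forms: "\<omega> \<in> forms X (variety_dim X)"
  using volume by (simp add: volume_form_def)

lemma exact_lie_interior:
  assumes "a \<in> Lie_alg X \<omega>" "b \<in> Lie_alg X \<omega>"
  shows "interior_product a (interior_product b \<omega>) \<in> exact_lie \<omega>"
proof -
  note A = Lie_alg_AVF[OF \<omega>_forms assms(1)] and B = Lie_alg_AVF[OF \<omega>_forms assms(2)]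
  have "ext_d X (interior_product a (interior_product b \<omega>)) = Theta \<omega> (bracket a b)"
    unfolding Theta_def by (rule ext_d_interior_interior[OF smooth \<omega>_forms A B])
  moreover have "bracket a b \<in> Lie_alg X \<omega>" using assms unfolding Lie_alg_def by (rule lie_generated.bracket)
  ultimately show ?thesis unfolding exact_lie_def using forms_funs[OF \<omega>_forms] by auto
qed

lemma Ker_times_Lie: "locally_nilpotent X D \<Longrightarrow> f \<in> Ker D \<Longrightarrow> (\<lambda>g. f * D g) \<in> Lie_alg X \<omega>"
  unfolding Lie_alg_def by (intro lie_generated.gen Ker_times_IVF smooth volume)

lemma locally_nilpotent_VF: "locally_nilpotent X D \<Longrightarrow> D \<in> VF"
  by (simp add: locally_nilpotent_def)

lemma \<omega>_times_args:
  assumes "D \<in> VF" "E \<in> VF" "f \<in> funs X" "g \<in> funs X"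
  shows "\<omega> ((\<lambda>h. f * D h) # (\<lambda>h. g * E h) # vs) = f * (g * \<omega> (D # E # vs))"
proof (cases "set vs \<subseteq> VF")
  case True
  have "\<omega> ((\<lambda>h. f * D h) # (\<lambda>h. g * E h) # vs) = f * \<omega> (D # (\<lambda>h. g * E h) # vs)"
    using assms True by (intro forms_times_hd[OF \<omega>_forms]) auto
  also have "\<omega> (D # (\<lambda>h. g * E h) # vs) = g * \<omega> (D # E # vs)"
    using forms_times_arg[OF \<omega>_forms assms(2,4), of "[D]" vs] assms True by simp
  finally show ?thesis .
next
  case False
  then show ?thesis using forms_two_outside[OF \<omega>_forms] by simp
qed

lemma PK_exact:
  assumes \<xi>: "locally_nilpotent X \<xi>" and \<eta>: "locally_nilpotent X \<eta>" and e: "e \<in> PK \<xi> \<eta>"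
  shows "(\<lambda>vs. e * \<omega> (\<eta> # \<xi> # vs)) \<in> exact_lie \<omega>"
  using e
proof induction
  case zero
  then show ?case using exact_lie_zero[OF \<omega>_forms] by (simp add: zero_fun_def[where 'b = "'a \<Rightarrow> complex"])
next
  case (add f c e)
  have "interior_product (\<lambda>g. f * \<xi> g) (interior_product (\<lambda>g. c * \<eta> g) \<omega>) \<in> exact_lie \<omega>"
    using add \<xi> \<eta> by (intro exact_lie_interior Ker_times_Lie)
  from exact_lie_plus[OF \<omega>_forms this add.IH]
  have "interior_product (\<lambda>g. f * \<xi> g) (interior_product (\<lambda>g. c * \<eta> g) \<omega>) + (\<lambda>vs. e * \<omega> (\<eta> # \<xi> # vs)) \<in> exact_lie \<omega>" .
  also have "interior_product (\<lambda>g. f * \<xi> g) (interior_product (\<lambda>g. c * \<eta> g) \<omega>) + (\<lambda>vs. e * \<omega> (\<eta> # \<xi> # vs)) =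
    (\<lambda>vs. (f * c + e) * \<omega> (\<eta> # \<xi> # vs))"
    using \<omega>_times_args[OF locally_nilpotent_VF[OF \<eta>] locally_nilpotent_VF[OF \<xi>] KerD(1)[OF add(2)] KerD(1)[OF add(1)]]
    by (intro ext) (simp add: algebra_simps)
  finally show ?case .
qed

text \<open>If \<open>\<xi>\<close> and \<open>\<eta>\<close> have divergence zero, then \<open>d (e \<iota>\<^sub>\<xi> \<iota>\<^sub>\<eta> \<omega>)\<close> is the interior product of
  \<open>curl \<xi> \<eta> e\<close> with \<open>\<omega>\<close>.\<close>

definition curl :: "'a vfield \<Rightarrow> 'a vfield \<Rightarrow> ('a \<Rightarrow> complex) \<Rightarrow> 'a vfield" where
  "curl \<xi> \<eta> e = (\<lambda>f. \<xi> e * \<eta> f) - (\<lambda>f. \<eta> e * \<xi> f) + (\<lambda>f. e * bracket \<xi> \<eta> f)"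

lemma curl_VF: "\<xi> \<in> VF \<Longrightarrow> \<eta> \<in> VF \<Longrightarrow> e \<in> funs X \<Longrightarrow> curl \<xi> \<eta> e \<in> VF"
  unfolding curl_def by (rule vf_plus[OF vf_minus[OF vf_times vf_times] vf_times[OF vf_bracket]]) simp_all

lemma curl_apply: "curl \<xi> \<eta> e f = \<xi> e * \<eta> f - \<eta> e * \<xi> f + e * bracket \<xi> \<eta> f"
  by (simp add: curl_def)

text \<open>On a product of \<open>f \<in> Ker \<xi>\<close> and \<open>c \<in> Ker \<eta>\<close>
  the curl is the bracket of the replicas \<open>f \<xi>\<close> and
  \<open>c \<eta>\<close>.\<close>

lemma curl_Lie:
  assumes \<xi>: "locally_nilpotent X \<xi>" and \<eta>: "locally_nilpotent X \<eta>" and e: "e \<in> PK \<xi> \<eta>"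
  shows "curl \<xi> \<eta> e \<in> Lie_alg X \<omega>"
  using e
proof induction
  note V = locally_nilpotent_VF[OF \<xi>] locally_nilpotent_VF[OF \<eta>]
  case zero
  have "curl \<xi> \<eta> 0 = 0" using V by (intro ext) (simp add: curl_def)
  show ?case unfolding \<open>curl \<xi> \<eta> 0 = 0\<close> Lie_alg_def by (rule lie_generated.zero)
next
  note V = locally_nilpotent_VF[OF \<xi>] locally_nilpotent_VF[OF \<eta>]
  case (add f c e)
  note fc = KerD[OF add(1)] KerD[OF add(2)]
  have ef: "e \<in> funs X" using PK_funs add by blast
  have eq: "curl \<xi> \<eta> (f * c + e) = bracket (\<lambda>g. f * \<xi> g) (\<lambda>g. c * \<eta> g) + curl \<xi> \<eta> e"
  proof (rule vf_eqI)
    show "curl \<xi> \<eta> (f * c + e) \<in> VF" using V fc ef by (intro curl_VF) auto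
    show "bracket (\<lambda>g. f * \<xi> g) (\<lambda>g. c * \<eta> g) + curl \<xi> \<eta> e \<in> VF"
      using vf_plus[OF vf_bracket[OF vf_times[OF V(1) fc(1)] vf_times[OF V(2) fc(3)]] curl_VF[OF V ef]] .
    fix g assume g: "g \<in> funs X"
    show "curl \<xi> \<eta> (f * c + e) g = (bracket (\<lambda>g. f * \<xi> g) (\<lambda>g. c * \<eta> g) + curl \<xi> \<eta> e) g"
      using V fc ef g by (simp add: curl_apply bracket_apply vf_add vf_mult algebra_simps)
  qed
  have "bracket (\<lambda>g. f * \<xi> g) (\<lambda>g. c * \<eta> g) \<in> Lie_alg X \<omega>"
    using Ker_times_Lie[OF \<xi> add(1)] Ker_times_Lie[OF \<eta> add(2)] unfolding Lie_alg_def by (rule lie_generated.bracket)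
  then show ?case using add.IH unfolding eq Lie_alg_def by (rule lie_generated.add)
qed

lemma Ker_transfer_exact:
  assumes \<xi>: "locally_nilpotent X \<xi>" and \<eta>: "locally_nilpotent X \<eta>" and z: "locally_nilpotent X z"
    and \<beta>: "\<beta> \<in> Ker z" and e: "e \<in> PK \<xi> \<eta>" "\<beta> * e \<in> PK \<xi> \<eta>"
  shows "(\<lambda>vs. e * (\<xi> \<beta> * \<omega> (\<eta> # z # vs) - \<eta> \<beta> * \<omega> (\<xi> # z # vs))) \<in> exact_lie \<omega>"
proof -
  note V = locally_nilpotent_VF[OF \<xi>] locally_nilpotent_VF[OF \<eta>] and zV = locally_nilpotent_VF[OF z]
  have ef: "e \<in> funs X" using PK_funs e by blast
  have \<beta>f: "\<beta> \<in> funs X" using \<beta> by blast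
  have c: "curl \<xi> \<eta> e \<in> VF" using V ef by (rule curl_VF)
  let ?A = "\<lambda>f. \<beta> * curl \<xi> \<eta> e f" and ?B = "\<lambda>f. (e * \<xi> \<beta>) * \<eta> f" and ?C = "\<lambda>f. (e * \<eta> \<beta>) * \<xi> f"
  have ABC: "?A \<in> VF" "?B \<in> VF" "?C \<in> VF"
    using vf_times[OF c \<beta>f] vf_times[OF V(2), of "e * \<xi> \<beta>"] vf_times[OF V(1), of "e * \<eta> \<beta>"] V ef \<beta>f by auto
  have eq: "curl \<xi> \<eta> (\<beta> * e) = ?A + (?B - ?C)"
  proof (rule vf_eqI)
    show "curl \<xi> \<eta> (\<beta> * e) \<in> VF" using V ef \<beta>f by (intro curl_VF) auto
    show "?A + (?B - ?C) \<in> VF" using vf_plus[OF ABC(1) vf_minus[OF ABC(2,3)]] .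
    fix f
    show "curl \<xi> \<eta> (\<beta> * e) f = (?A + (?B - ?C)) f"
      using V ef \<beta>f by (simp add: curl_apply vf_mult algebra_simps)
  qed
  \<comment> \<open>This exhibits \<open>z\<close> itself as a replica, hence as an element of the
    Lie algebra.\<close>
  have z1: "z = (\<lambda>f. one_of X * z f)"
  proof
    fix f show "z f = one_of X * z f"
      using zV vf_outside[OF zV, of f] by (cases "f \<in> funs X") auto
  qed
  have zL: "z \<in> Lie_alg X \<omega>" using Ker_times_Lie[OF z Ker_one[OF zV]] z1 by simp
  have T: "interior_product z (interior_product (curl \<xi> \<eta> (\<beta> * e)) \<omega>) -
      interior_product (\<lambda>f. \<beta> * z f) (interior_product (curl \<xi> \<eta> e) \<omega>) \<in> exact_lie \<omega>"
    using exact_lie_interior[OF zL curl_Lie[OF \<xi> \<eta> e(2)]]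
      exact_lie_interior[OF Ker_times_Lie[OF z \<beta>] curl_Lie[OF \<xi> \<eta> e(1)]]
    by (rule exact_lie_minus[OF \<omega>_forms])
  have "interior_product z (interior_product (curl \<xi> \<eta> (\<beta> * e)) \<omega>) -
      interior_product (\<lambda>f. \<beta> * z f) (interior_product (curl \<xi> \<eta> e) \<omega>) =
    (\<lambda>vs. e * (\<xi> \<beta> * \<omega> (\<eta> # z # vs) - \<eta> \<beta> * \<omega> (\<xi> # z # vs)))" (is "?l = ?r")
  proof
    fix vs
    show "?l vs = ?r vs"
    proof (cases "set vs \<subseteq> VF")
      case True
      then have zvs: "set (z # vs) \<subseteq> VF" using zV by simp
      have "\<omega> (curl \<xi> \<eta> (\<beta> * e) # z # vs) = \<omega> (?A # z # vs) + \<omega> ((?B - ?C) # z # vs)"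
        unfolding eq by (rule forms_add_hd[OF \<omega>_forms ABC(1) vf_minus[OF ABC(2,3)] zvs])
      also have "\<omega> ((?B - ?C) # z # vs) = \<omega> (?B # z # vs) - \<omega> (?C # z # vs)"
        using forms_diff_arg[OF \<omega>_forms ABC(2,3), of "[]" "z # vs"] zvs by simp
      also have "\<omega> (?A # z # vs) = \<beta> * \<omega> (curl \<xi> \<eta> e # z # vs)"
        by (rule forms_times_hd[OF \<omega>_forms c \<beta>f zvs])
      also have "\<omega> (?B # z # vs) = (e * \<xi> \<beta>) * \<omega> (\<eta> # z # vs)"
        using V ef \<beta>f by (intro forms_times_hd[OF \<omega>_forms V(2) _ zvs]) auto
      also have "\<omega> (?C # z # vs) = (e * \<eta> \<beta>) * \<omega> (\<xi> # z # vs)"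
        using V ef \<beta>f by (intro forms_times_hd[OF \<omega>_forms V(1) _ zvs]) auto
      finally have 1: "\<omega> (curl \<xi> \<eta> (\<beta> * e) # z # vs) = \<beta> * \<omega> (curl \<xi> \<eta> e # z # vs) +
        ((e * \<xi> \<beta>) * \<omega> (\<eta> # z # vs) - (e * \<eta> \<beta>) * \<omega> (\<xi> # z # vs))" .
      have 2: "\<omega> (curl \<xi> \<eta> e # (\<lambda>f. \<beta> * z f) # vs) = \<beta> * \<omega> (curl \<xi> \<eta> e # z # vs)"
        using forms_times_arg[OF \<omega>_forms zV \<beta>f, of "[curl \<xi> \<eta> e]" vs] c True by simp
      show ?thesis by (simp add: 1 2 algebra_simps)
    next
      case False
      then show ?thesis using forms_two_outside[OF \<omega>_forms] by simp
    qed
  qed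
  then show ?thesis using T by simp
qed

text \<open>\<open>\<Delta> \<beta> \<gamma>\<close> is the determinant of \<open>\<xi>\<close> and
  \<open>\<eta>\<close> on the functions \<open>\<beta>\<close> and \<open>\<gamma>\<close>. Either
  it is nonzero for some pair in \<open>Ker z\<close>, and the unwanted term can be eliminated, or
  \<open>\<xi>\<close> and \<open>\<eta>\<close> are proportional on \<open>Ker z\<close>, which
  makes \<open>\<xi>\<close>, \<open>\<eta>\<close>, \<open>z\<close> dependent.\<close>

lemma transfer_PK_exact:
  assumes \<xi>: "locally_nilpotent X \<xi>" and \<eta>: "locally_nilpotent X \<eta>" "\<eta> \<noteq> 0" and z: "locally_nilpotent X z"
    and s: "s \<in> Ker \<eta>" "\<xi> s = a" "a \<in> Ker \<xi>" "a \<noteq> 0"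
    and t: "t \<in> Ker \<eta>" "z t = b" "b \<in> Ker z" "b \<in> Ker \<eta>" "b \<noteq> 0"
  shows "\<exists>p\<in>funs X. p \<noteq> 0 \<and> (\<forall>e\<in>PK \<xi> \<eta>. (\<lambda>vs. (p * e) * \<omega> (\<eta> # z # vs)) \<in> exact_lie \<omega>)"
proof -
  note \<xi>V = locally_nilpotent_VF[OF \<xi>] and \<eta>V = locally_nilpotent_VF[OF \<eta>(1)] and zV = locally_nilpotent_VF[OF z]
  have tf: "t \<in> funs X" and sf: "s \<in> funs X" and af: "a \<in> funs X" and bf: "b \<in> funs X" using s t by auto
  have \<omega>f: "\<omega> vs \<in> funs X" for vs using forms_funs[OF \<omega>_forms] .
  note vanish = derivation_vanishing_on_Ker[OF locally_nilpotent_nilp[OF z] tf t(2,3,5)]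
  define \<Delta> where "\<Delta> \<beta> \<gamma> = \<xi> \<beta> * \<eta> \<gamma> - \<xi> \<gamma> * \<eta> \<beta>" for \<beta> \<gamma>
  show ?thesis
  proof (cases "\<exists>\<beta>\<in>Ker z. \<exists>\<gamma>\<in>Ker z. \<Delta> \<beta> \<gamma> \<noteq> 0")
    case True
    then obtain \<beta> \<gamma> where \<beta>: "\<beta> \<in> Ker z" and \<gamma>: "\<gamma> \<in> Ker z" and \<Delta>: "\<Delta> \<beta> \<gamma> \<noteq> 0" by blast
    have f: "\<beta> \<in> funs X" "\<gamma> \<in> funs X" using \<beta> \<gamma> by auto
    have \<Delta>f: "\<Delta> \<beta> \<gamma> \<in> funs X" using f \<xi>V \<eta>V by (simp add: \<Delta>_def)
    have "\<exists>m. a ^ m * y \<in> PK \<xi> \<eta>" if "y \<in> funs X" for y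
    proof (rule slice_localization[OF locally_nilpotent_nilp[OF \<xi>] _ Ker_one[OF \<eta>V] Ker_mult[OF \<eta>V] s(1-3) that])
      show "Ker \<eta> \<subseteq> funs X" by auto
    qed
    then obtain m where m: "\<And>y. y \<in> funs X \<Longrightarrow> a ^ m y * y \<in> PK \<xi> \<eta>" by metis
    \<comment> \<open>One exponent for all weights of the elimination and for their products with
      \<open>\<beta>\<close> or \<open>\<gamma>\<close>: \<open>Ker_transfer_exact\<close> needs
      both \<open>e\<close> and \<open>\<beta> * e\<close> in the ring.\<close>
    define M where "M = m (\<eta> \<gamma>) + m (\<beta> * \<eta> \<gamma>) + m (\<eta> \<beta>) + m (\<gamma> * \<eta> \<beta>)"
    note mono = PK_power_mono[OF \<xi>V \<eta>V s(3) m, where n = M]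
    have E: "a ^ M * \<eta> \<gamma> \<in> PK \<xi> \<eta>" "a ^ M * (\<beta> * \<eta> \<gamma>) \<in> PK \<xi> \<eta>"
      "a ^ M * \<eta> \<beta> \<in> PK \<xi> \<eta>" "a ^ M * (\<gamma> * \<eta> \<beta>) \<in> PK \<xi> \<eta>"
      using f \<eta>V mono[of "\<eta> \<gamma>"] mono[of "\<beta> * \<eta> \<gamma>"] mono[of "\<eta> \<beta>"] mono[of "\<gamma> * \<eta> \<beta>"]
      by (simp_all add: M_def)
    show ?thesis
    proof (intro bexI[of _ "a ^ M * \<Delta> \<beta> \<gamma>"] conjI ballI)
      show "a ^ M * \<Delta> \<beta> \<gamma> \<in> funs X" using af \<Delta>f by auto
      show "a ^ M * \<Delta> \<beta> \<gamma> \<noteq> 0" using funs_power_mult_nonzero[OF af \<Delta>f s(4) \<Delta>] .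
      fix e assume e: "e \<in> PK \<xi> \<eta>"
      have 1: "(a ^ M * \<eta> \<gamma>) * e \<in> PK \<xi> \<eta>" "(a ^ M * \<eta> \<beta>) * e \<in> PK \<xi> \<eta>"
        using PK_mult[OF \<xi>V \<eta>V E(1) e] PK_mult[OF \<xi>V \<eta>V E(3) e] .
      have 2: "\<beta> * ((a ^ M * \<eta> \<gamma>) * e) \<in> PK \<xi> \<eta>" "\<gamma> * ((a ^ M * \<eta> \<beta>) * e) \<in> PK \<xi> \<eta>"
        using PK_mult[OF \<xi>V \<eta>V E(2) e] PK_mult[OF \<xi>V \<eta>V E(4) e] by (simp_all add: mult_ac)
      \<comment> \<open>As in Cramer's rule, the weights \<open>\<eta> \<gamma>\<close> and
        \<open>\<eta> \<beta>\<close> cancel the terms with \<open>\<xi>\<close> and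
        \<open>z\<close> and leave the determinant as coefficient.\<close>
      have "(\<lambda>vs. ((a ^ M * \<eta> \<gamma>) * e) * (\<xi> \<beta> * \<omega> (\<eta> # z # vs) - \<eta> \<beta> * \<omega> (\<xi> # z # vs))) -
        (\<lambda>vs. ((a ^ M * \<eta> \<beta>) * e) * (\<xi> \<gamma> * \<omega> (\<eta> # z # vs) - \<eta> \<gamma> * \<omega> (\<xi> # z # vs))) \<in> exact_lie \<omega>"
        by (intro exact_lie_minus[OF \<omega>_forms] Ker_transfer_exact[OF \<xi> \<eta>(1) z] \<beta> \<gamma> 1 2)
      also have "(\<lambda>vs. ((a ^ M * \<eta> \<gamma>) * e) * (\<xi> \<beta> * \<omega> (\<eta> # z # vs) - \<eta> \<beta> * \<omega> (\<xi> # z # vs))) -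
        (\<lambda>vs. ((a ^ M * \<eta> \<beta>) * e) * (\<xi> \<gamma> * \<omega> (\<eta> # z # vs) - \<eta> \<gamma> * \<omega> (\<xi> # z # vs))) =
        (\<lambda>vs. ((a ^ M * \<Delta> \<beta> \<gamma>) * e) * \<omega> (\<eta> # z # vs))"
        by (intro ext) (simp add: \<Delta>_def algebra_simps)
      finally show "(\<lambda>vs. ((a ^ M * \<Delta> \<beta> \<gamma>) * e) * \<omega> (\<eta> # z # vs)) \<in> exact_lie \<omega>" .
    qed
  next
    case False
    then have \<Delta>0: "\<xi> \<beta> * \<eta> \<gamma> = \<xi> \<gamma> * \<eta> \<beta>" if "\<beta> \<in> Ker z" "\<gamma> \<in> Ker z" for \<beta> \<gamma>
      using that by (force simp: \<Delta>_def)
    \<comment> \<open>Otherwise \<open>\<eta>\<close> would vanish on \<open>Ker z\<close> and on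
      the local slice \<open>t\<close> of \<open>z\<close>, hence everywhere.\<close>
    have "\<exists>\<gamma>\<in>Ker z. \<eta> \<gamma> \<noteq> 0"
    proof (rule ccontr)
      assume "\<not> (\<exists>\<gamma>\<in>Ker z. \<eta> \<gamma> \<noteq> 0)"
      then have "b * \<eta> y = 0" if "y \<in> funs X" for y
        using vanish[OF \<eta>V _ that] KerD(2)[OF t(1)] by simp
      then have "\<eta> y = 0" if "y \<in> funs X" for y
        using funs_domain[OF bf vf_funs[OF \<eta>V that]] t(5) that by blast
      then have "\<eta> = 0" by (intro vf_eqI[OF \<eta>V vf_0]) simp
      then show False using \<eta>(2) by simp
    qed
    then obtain \<gamma> where \<gamma>: "\<gamma> \<in> Ker z" "\<eta> \<gamma> \<noteq> 0" by blast
    define c where "c = \<eta> \<gamma>"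
    have cf: "c \<in> funs X" "c \<noteq> 0" and \<xi>\<gamma>: "\<xi> \<gamma> \<in> funs X"
      unfolding c_def using \<gamma>(2) vf_funs[OF \<eta>V KerD(1)[OF \<gamma>(1)]] vf_funs[OF \<xi>V KerD(1)[OF \<gamma>(1)]]
      by (simp_all only: not_False_eq_True)
    \<comment> \<open>This combination vanishes on \<open>Ker z\<close>, so it is proportional to
      \<open>z\<close>. As \<open>\<eta> t = 0\<close>, the factor is determined by
      \<open>c * \<xi> t\<close>.\<close>
    define D where "D = (\<lambda>f. c * \<xi> f) - (\<lambda>f. \<xi> \<gamma> * \<eta> f)"
    have D: "D \<in> VF" unfolding D_def using vf_minus[OF vf_times[OF \<xi>V cf(1)] vf_times[OF \<eta>V \<xi>\<gamma>]] .
    have D0: "D \<beta> = 0" if "\<beta> \<in> Ker z" for \<beta>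
      using \<Delta>0[OF that \<gamma>(1)] by (simp add: D_def c_def mult.commute)
    have vD: "b * D y = D t * z y" if "y \<in> funs X" for y
      using vanish[OF D _ that] D0 by blast
    have Dt: "D t = c * \<xi> t" using KerD(2)[OF t(1)] by (simp add: D_def)
    have \<xi>t: "\<xi> t \<in> funs X" using \<xi>V tf by auto
    \<comment> \<open>Evaluate the proportionality on the slice \<open>s\<close> of
      \<open>\<xi>\<close>, where \<open>D s = c * a\<close> is nonzero.\<close>
    have "\<xi> t \<noteq> 0"
    proof
      assume "\<xi> t = 0"
      then have "b * (c * a) = 0" using vD[OF sf] Dt KerD(2)[OF s(1)] s(2) by (simp add: D_def)
      then show False using funs_mult_nonzero[OF bf funs_mult[OF cf(1) af] t(5)] funs_mult_nonzero[OF cf(1) af cf(2) s(4)] by blast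
    qed
    \<comment> \<open>In the linear relation between the three fields, the multiple of
      \<open>\<eta>\<close> disappears next to \<open>\<eta>\<close>, and the common factor
      \<open>c\<close> cancels.\<close>
    have rel: "b * \<omega> (\<eta> # \<xi> # vs) = \<xi> t * \<omega> (\<eta> # z # vs)" for vs
    proof (cases "set vs \<subseteq> VF")
      case True
      have 1: "(\<lambda>f. (b * c) * \<xi> f) = (\<lambda>f. (c * \<xi> t) * z f) + (\<lambda>f. (b * \<xi> \<gamma>) * \<eta> f)"
      proof (rule vf_eqI)
        show "(\<lambda>f. (b * c) * \<xi> f) \<in> VF" using vf_times[OF \<xi>V funs_mult[OF bf cf(1)]] .
        show "(\<lambda>f. (c * \<xi> t) * z f) + (\<lambda>f. (b * \<xi> \<gamma>) * \<eta> f) \<in> VF"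
          using vf_plus[OF vf_times[OF zV funs_mult[OF cf(1) \<xi>t]] vf_times[OF \<eta>V funs_mult[OF bf \<xi>\<gamma>]]] .
        fix f assume "f \<in> funs X"
        from vD[OF this] show "(b * c) * \<xi> f = ((\<lambda>f. (c * \<xi> t) * z f) + (\<lambda>f. (b * \<xi> \<gamma>) * \<eta> f)) f"
          by (simp add: Dt) (simp add: D_def algebra_simps)
      qed
      have "(b * c) * \<omega> (\<eta> # \<xi> # vs) = \<omega> (\<eta> # (\<lambda>f. (b * c) * \<xi> f) # vs)"
        using forms_times_arg[OF \<omega>_forms \<xi>V funs_mult[OF bf cf(1)], of "[\<eta>]" vs] \<eta>V True by simp
      also have "\<dots> = \<omega> (\<eta> # (\<lambda>f. (c * \<xi> t) * z f) # vs) + \<omega> (\<eta> # (\<lambda>f. (b * \<xi> \<gamma>) * \<eta> f) # vs)"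
        unfolding 1 using forms_add_arg[OF \<omega>_forms vf_times[OF zV funs_mult[OF cf(1) \<xi>t]]
          vf_times[OF \<eta>V funs_mult[OF bf \<xi>\<gamma>]], of "[\<eta>]" vs] \<eta>V True by simp
      also have "\<omega> (\<eta> # (\<lambda>f. (c * \<xi> t) * z f) # vs) = (c * \<xi> t) * \<omega> (\<eta> # z # vs)"
        using forms_times_arg[OF \<omega>_forms zV funs_mult[OF cf(1) \<xi>t], of "[\<eta>]" vs] \<eta>V True by simp
      also have "\<omega> (\<eta> # (\<lambda>f. (b * \<xi> \<gamma>) * \<eta> f) # vs) = (b * \<xi> \<gamma>) * \<omega> (\<eta> # \<eta> # vs)"
        using forms_times_arg[OF \<omega>_forms \<eta>V funs_mult[OF bf \<xi>\<gamma>], of "[\<eta>]" vs] \<eta>V True by simp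
      also have "\<omega> (\<eta> # \<eta> # vs) = 0" by (rule forms_repeat[OF \<omega>_forms]) simp
      finally have "c * (b * \<omega> (\<eta> # \<xi> # vs)) = c * (\<xi> t * \<omega> (\<eta> # z # vs))" by (simp add: mult_ac)
      then show ?thesis by (rule funs_cancel[OF cf funs_mult[OF bf \<omega>f] funs_mult[OF \<xi>t \<omega>f]])
    next
      case False
      then show ?thesis using forms_two_outside[OF \<omega>_forms] by simp
    qed
    show ?thesis
    proof (intro bexI[of _ "\<xi> t"] conjI ballI)
      fix e assume e: "e \<in> PK \<xi> \<eta>"
      have "(\<lambda>vs. (b * e) * \<omega> (\<eta> # \<xi> # vs)) \<in> exact_lie \<omega>"
        by (intro PK_exact \<xi> \<eta> PK_mult[OF \<xi>V \<eta>V] PK_Ker_right[OF \<xi>V t(4)] e)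
      also have "(\<lambda>vs. (b * e) * \<omega> (\<eta> # \<xi> # vs)) = (\<lambda>vs. (\<xi> t * e) * \<omega> (\<eta> # z # vs))"
      proof
        fix vs
        have "(b * e) * \<omega> (\<eta> # \<xi> # vs) = e * (b * \<omega> (\<eta> # \<xi> # vs))" by (simp add: mult_ac)
        then show "(b * e) * \<omega> (\<eta> # \<xi> # vs) = (\<xi> t * e) * \<omega> (\<eta> # z # vs)"
          by (simp only: rel mult_ac)
      qed
      finally show "(\<lambda>vs. (\<xi> t * e) * \<omega> (\<eta> # z # vs)) \<in> exact_lie \<omega>" .
    qed fact+
  qed
qed

lemma funs_prod_mult:
  assumes "finite I" "\<And>i. i \<in> I \<Longrightarrow> p i \<in> funs X" "y \<in> funs X"
  shows "(\<Prod>i\<in>I. p i) * y \<in> funs X"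
    and "(\<And>i. i \<in> I \<Longrightarrow> p i \<noteq> 0) \<Longrightarrow> y \<noteq> 0 \<Longrightarrow> (\<Prod>i\<in>I. p i) * y \<noteq> 0"
proof -
  have "(\<Prod>i\<in>I. p i) * y \<in> funs X \<and> ((\<forall>i\<in>I. p i \<noteq> 0) \<longrightarrow> y \<noteq> 0 \<longrightarrow> (\<Prod>i\<in>I. p i) * y \<noteq> 0)"
    using assms(1,2)
  proof induction
    case empty
    then show ?case using assms(3) by simp
  next
    case (insert i I)
    then show ?case using funs_mult_nonzero[of "p i" "(\<Prod>i\<in>I. p i) * y"] by (simp add: mult.assoc)
  qed
  then show "(\<Prod>i\<in>I. p i) * y \<in> funs X"
    "(\<And>i. i \<in> I \<Longrightarrow> p i \<noteq> 0) \<Longrightarrow> y \<noteq> 0 \<Longrightarrow> (\<Prod>i\<in>I. p i) * y \<noteq> 0" by auto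
qed

text \<open>\<open>P\<close> is a product over all sources \<open>j\<close> and targets
  \<open>i\<close>, chosen before \<open>y\<close>. The exponent and the partition of unity may then
  depend on \<open>y\<close>.\<close>

lemma principal_ideal_exact:
  fixes I :: "'i set"
  assumes I: "finite I" and \<xi>: "\<And>i. i \<in> I \<Longrightarrow> locally_nilpotent X (\<xi> i)"
    and \<eta>: "locally_nilpotent X \<eta>" "\<eta> \<noteq> 0"
    and s: "\<And>i. i \<in> I \<Longrightarrow> s i \<in> Ker \<eta>" "\<And>i. i \<in> I \<Longrightarrow> \<xi> i (s i) = a i"
    and a: "\<And>i. i \<in> I \<Longrightarrow> a i \<in> Ker (\<xi> i)" "\<And>i. i \<in> I \<Longrightarrow> a i \<in> Ker \<eta>" "\<And>i. i \<in> I \<Longrightarrow> a i \<noteq> 0"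
    and unit: "\<And>N. \<exists>c. (\<forall>i\<in>I. c i \<in> Ker \<eta>) \<and> (\<Sum>i\<in>I. c i * a i ^ N) = one_of X"
  shows "\<exists>P\<in>funs X. P \<noteq> 0 \<and>
    (\<forall>i\<in>I. \<forall>y\<in>funs X. (\<lambda>vs. (P * y) * \<omega> (\<eta> # \<xi> i # vs)) \<in> exact_lie \<omega>)"
proof -
  have \<eta>V: "\<eta> \<in> VF" using locally_nilpotent_VF[OF \<eta>(1)] .
  have \<xi>V: "\<xi> i \<in> VF" if "i \<in> I" for i using locally_nilpotent_VF[OF \<xi>[OF that]] .
  have single: "\<exists>P\<in>funs X. P \<noteq> 0 \<and> (\<forall>y\<in>funs X. (\<lambda>vs. (P * y) * \<omega> (\<eta> # \<xi> i # vs)) \<in> exact_lie \<omega>)"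
    if i: "i \<in> I" for i
  proof -
    \<comment> \<open>The case \<open>j = i\<close> is included: then both derivatives along
      \<open>\<xi> j\<close> in the determinant vanish on \<open>Ker z\<close>, and the dependent
      case applies.\<close>
    have "\<exists>p\<in>funs X. p \<noteq> 0 \<and> (\<forall>e\<in>PK (\<xi> j) \<eta>. (\<lambda>vs. (p * e) * \<omega> (\<eta> # \<xi> i # vs)) \<in> exact_lie \<omega>)"
      if "j \<in> I" for j
      using that i by (intro transfer_PK_exact[where s = "s j" and a = "a j" and t = "s i" and b = "a i"] \<xi> \<eta> s a refl)
    then obtain p where p: "\<And>j. j \<in> I \<Longrightarrow> p j \<in> funs X" "\<And>j. j \<in> I \<Longrightarrow> p j \<noteq> 0"
      "\<And>j e. j \<in> I \<Longrightarrow> e \<in> PK (\<xi> j) \<eta> \<Longrightarrow> (\<lambda>vs. (p j * e) * \<omega> (\<eta> # \<xi> i # vs)) \<in> exact_lie \<omega>"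
      by metis
    show ?thesis
    proof (intro bexI[of _ "(\<Prod>j\<in>I. p j) * one_of X"] conjI ballI)
      show "(\<Prod>j\<in>I. p j) * one_of X \<in> funs X" using I p by (intro funs_prod_mult) auto
      show "(\<Prod>j\<in>I. p j) * one_of X \<noteq> 0" using I p by (intro funs_prod_mult(2)) auto
      fix y assume y: "y \<in> funs X"
      \<comment> \<open>The factors of the product other than \<open>p j\<close> are counted to the
        function, so that the product times \<open>y\<close> is \<open>p j * r j\<close> for every
        \<open>j\<close>.\<close>
      define r where "r j = (\<Prod>l\<in>I - {j}. p l) * y" for j
      have rf: "r j \<in> funs X" for j unfolding r_def using I p y by (intro funs_prod_mult) auto
      have "\<exists>m. a j ^ m * r j \<in> PK (\<xi> j) \<eta>" if "j \<in> I" for j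
        using that \<xi> s a rf Ker_one[OF \<eta>V] Ker_mult[OF \<eta>V]
        by (intro slice_localization[where s = "s j"] locally_nilpotent_nilp) auto
      then obtain m where m: "\<And>j. j \<in> I \<Longrightarrow> a j ^ m j * r j \<in> PK (\<xi> j) \<eta>" by metis
      define N where "N = (\<Sum>j\<in>I. m j)"
      have N: "a j ^ N * r j \<in> PK (\<xi> j) \<eta>" if "j \<in> I" for j
        using PK_power_mono[OF \<xi>V[OF that] \<eta>V a(1)[OF that] m[OF that]] member_le_sum[of j I m] I that
        by (simp add: N_def)
      obtain c where c: "\<And>j. j \<in> I \<Longrightarrow> c j \<in> Ker \<eta>" "(\<Sum>j\<in>I. c j * a j ^ N) = one_of X"
        using unit[of N] by blast
      define e where "e j = c j * (a j ^ N * r j)" for j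
      have e: "e j \<in> PK (\<xi> j) \<eta>" if "j \<in> I" for j
        unfolding e_def using PK_mult[OF \<xi>V[OF that] \<eta>V PK_Ker_right[OF \<xi>V[OF that] c(1)[OF that]] N[OF that]] .
      have "(\<Prod>j\<in>I. p j) * y = (\<Prod>j\<in>I. p j) * ((\<Sum>j\<in>I. c j * a j ^ N) * y)"
        using c(2) y by simp
      also have "\<dots> = (\<Sum>j\<in>I. (\<Prod>l\<in>I. p l) * (c j * a j ^ N * y))"
        by (simp add: sum_distrib_left sum_distrib_right)
      also have "\<dots> = (\<Sum>j\<in>I. p j * e j)"
      proof (rule sum.cong[OF refl])
        fix j assume "j \<in> I"
        then have "(\<Prod>l\<in>I. p l) = p j * (\<Prod>l\<in>I - {j}. p l)" using I by (rule prod.remove[rotated])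
        then show "(\<Prod>l\<in>I. p l) * (c j * a j ^ N * y) = p j * e j"
          by (simp only: e_def r_def mult_ac)
      qed
      finally have eq: "(\<Prod>j\<in>I. p j) * y = (\<Sum>j\<in>I. p j * e j)" .
      have "(\<Sum>j\<in>I. (\<lambda>vs. (p j * e j) * \<omega> (\<eta> # \<xi> i # vs))) \<in> exact_lie \<omega>"
        by (intro exact_lie_sum[OF \<omega>_forms] p(3) e)
      also have "(\<Sum>j\<in>I. (\<lambda>vs. (p j * e j) * \<omega> (\<eta> # \<xi> i # vs))) =
        (\<lambda>vs. ((\<Prod>j\<in>I. p j) * one_of X * y) * \<omega> (\<eta> # \<xi> i # vs))"
      proof (rule ext)
        fix vs
        have "(\<Sum>j\<in>I. (\<lambda>vs. (p j * e j) * \<omega> (\<eta> # \<xi> i # vs))) vs = (\<Sum>j\<in>I. p j * e j) * \<omega> (\<eta> # \<xi> i # vs)"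
          by (simp only: fun_sum_apply sum_distrib_right)
        also have "\<dots> = ((\<Prod>j\<in>I. p j) * one_of X * y) * \<omega> (\<eta> # \<xi> i # vs)"
          unfolding eq[symmetric] using y by (simp add: mult.assoc)
        finally show "(\<Sum>j\<in>I. (\<lambda>vs. (p j * e j) * \<omega> (\<eta> # \<xi> i # vs))) vs =
          ((\<Prod>j\<in>I. p j) * one_of X * y) * \<omega> (\<eta> # \<xi> i # vs)" .
      qed
      finally show "(\<lambda>vs. ((\<Prod>j\<in>I. p j) * one_of X * y) * \<omega> (\<eta> # \<xi> i # vs)) \<in> exact_lie \<omega>" .
    qed
  qed
  then obtain P where P: "\<And>i. i \<in> I \<Longrightarrow> P i \<in> funs X" "\<And>i. i \<in> I \<Longrightarrow> P i \<noteq> 0"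
    "\<And>i y. i \<in> I \<Longrightarrow> y \<in> funs X \<Longrightarrow> (\<lambda>vs. (P i * y) * \<omega> (\<eta> # \<xi> i # vs)) \<in> exact_lie \<omega>" by metis
  show ?thesis
  \<comment> \<open>For a fixed target the factors that belong to the other targets are absorbed
    into \<open>y\<close>.\<close>
  proof (intro bexI[of _ "(\<Prod>j\<in>I. P j) * one_of X"] conjI ballI)
    show "(\<Prod>j\<in>I. P j) * one_of X \<in> funs X" using I P by (intro funs_prod_mult) auto
    show "(\<Prod>j\<in>I. P j) * one_of X \<noteq> 0" using I P by (intro funs_prod_mult(2)) auto
    fix i y assume i: "i \<in> I" and y: "y \<in> funs X"
    have "(\<Prod>l\<in>I. P l) = P i * (\<Prod>l\<in>I - {i}. P l)" using I i by (rule prod.remove)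
    then have "(\<Prod>j\<in>I. P j) * one_of X * y = P i * ((\<Prod>l\<in>I - {i}. P l) * y)"
      using y by (simp add: mult.assoc)
    moreover have "(\<Prod>l\<in>I - {i}. P l) * y \<in> funs X" using I P y by (intro funs_prod_mult) auto
    ultimately show "(\<lambda>vs. ((\<Prod>j\<in>I. P j) * one_of X * y) * \<omega> (\<eta> # \<xi> i # vs)) \<in> exact_lie \<omega>"
      using P(3)[OF i] by simp
  qed
qed

section \<open>Modules of fields and of twofold interior products\<close>

lemma \<omega>_plus_second:
  assumes "D \<in> VF" "E \<in> VF" "\<eta> \<in> VF"
  shows "\<omega> (\<eta> # (D + E) # vs) = \<omega> (\<eta> # D # vs) + \<omega> (\<eta> # E # vs)"
  using forms_add_arg[OF \<omega>_forms assms(1,2), of "[\<eta>]" vs] assms(3) forms_two_outside[OF \<omega>_forms]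
  by (cases "set vs \<subseteq> VF") auto

lemma \<omega>_times_second:
  assumes "D \<in> VF" "b \<in> funs X" "\<eta> \<in> VF"
  shows "\<omega> (\<eta> # (\<lambda>f. b * D f) # vs) = b * \<omega> (\<eta> # D # vs)"
  using forms_times_arg[OF \<omega>_forms assms(1,2), of "[\<eta>]" vs] assms(3) forms_two_outside[OF \<omega>_forms]
  by (cases "set vs \<subseteq> VF") auto

lemma \<omega>_zero_second:
  assumes "\<eta> \<in> VF" shows "\<omega> (\<eta> # 0 # vs) = 0"
  using forms_zero_arg[OF \<omega>_forms, of "[\<eta>]" vs] assms forms_two_outside[OF \<omega>_forms]
  by (cases "set vs \<subseteq> VF") auto

lemma interior_interior_forms:
  assumes "\<eta> \<in> VF" "\<zeta> \<in> VF"
  shows "interior_product \<zeta> (interior_product \<eta> \<omega>) \<in> forms X (variety_dim X - 2)"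
proof (cases "variety_dim X < 2")
  case True
  \<comment> \<open>In dimension below 2 the subtraction is truncated to degree 0; two inserted
    fields already exceed the number of arguments of \<open>\<omega>\<close>.\<close>
  have "interior_product \<zeta> (interior_product \<eta> \<omega>) = 0"
    using forms_outside[OF \<omega>_forms] True by (intro ext) simp
  then show ?thesis using forms_zero by metis
next
  case False
  then obtain m where m: "variety_dim X = Suc (Suc m)" by (metis add_2_eq_Suc le_Suc_ex not_less)
  show ?thesis using interior_forms[OF interior_forms[OF \<omega>_forms[unfolded m] assms(1)] assms(2)] m by simp
qed

lemma field_span_VF: "A \<subseteq> funs X \<Longrightarrow> G \<subseteq> VF \<Longrightarrow> D \<in> field_span A G \<Longrightarrow> D \<in> VF"
  by (erule field_span.induct) (use vf_0 vf_plus vf_times in blast)+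

end

lemma field_span_plus: "D \<in> field_span A G \<Longrightarrow> E \<in> field_span A G \<Longrightarrow> D + E \<in> field_span A G"
  by (induction rule: field_span.induct) (auto simp: add.assoc intro: field_span.add)

lemma field_span_times:
  assumes "\<And>b. b \<in> A \<Longrightarrow> a * b \<in> A" "D \<in> field_span A G" shows "(\<lambda>f. a * D f) \<in> field_span A G"
  using assms(2)
proof induction
  case zero
  have "(\<lambda>f. a * (0 :: 'a vfield) f) = 0" by (simp add: fun_eq_iff)
  then show ?case using field_span.zero by metis
next
  case (add b D E)
  have "(\<lambda>f. a * ((\<lambda>f. b * D f) + E) f) = (\<lambda>f. (a * b) * D f) + (\<lambda>f. a * E f)"
    by (intro ext) (simp add: algebra_simps)
  then show ?case using field_span.add[OF assms(1)[OF add(1)] add(2) add.IH] by metis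
qed

lemma pullback_apply: "pullback X \<pi> f x = (if x \<in> points X then f (\<pi> x) else 0)"
  by (simp add: pullback_def restrict_fun_def)

section \<open>Slices and partitions of unity from the base\<close>

theorem corollary9p3:
  fixes X :: "'x variety" and B :: "'b variety" and Y :: "'y variety"
    and \<pi> :: "'x \<Rightarrow> 'b" and n k l :: nat
    and \<delta> :: "'y vfield"
    and \<alpha> :: "nat \<Rightarrow> 'b \<Rightarrow> complex"
    and \<phi> :: "nat \<Rightarrow> 'x \<Rightarrow> 'b \<times> 'y"
    and S :: "'s monoid" and VS :: "'s variety"
    and \<sigma> :: "'s \<Rightarrow> 'x \<Rightarrow> 'x" and \<rho> :: "'s \<Rightarrow> 'b \<Rightarrow> 'b"
    and u :: "nat \<Rightarrow> complex \<Rightarrow> 's"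
    and \<xi> :: "nat \<Rightarrow> 'x vfield" and \<xi>' :: "nat \<Rightarrow> 'b vfield"
    and N :: "'x vfield set"
    and \<omega> :: "'x form" and \<eta> :: "'x vfield"
  assumes X: "affine_variety X" "smooth_variety X"
    and B: "affine_variety B" "smooth_variety B"
    and n: "n = variety_dim X"
    and Y: "affine_variety Y"
    and fibration: "zariski_locally_trivial X B \<pi> Y"
    and \<delta>: "locally_nilpotent Y \<delta>" "\<delta> \<noteq> 0"
    and \<alpha>: "\<And>i. i \<in> {1..k} \<Longrightarrow> \<alpha> i \<in> funs B"
    and no_common_zeros: "\<And>b. b \<in> points B \<Longrightarrow> \<exists>i\<in>{1..k}. \<alpha> i b \<noteq> 0"
    and \<phi>: "\<And>i. i \<in> {1..k} \<Longrightarrow> trivialization X B \<pi> Y (\<alpha> i) (\<phi> i)"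
    and S: "semisimple_group S VS"
    and S_actions: "algebraic_group_action S VS X \<sigma>" "algebraic_group_action S VS B \<rho>"
    and equivariant: "\<And>g x. g \<in> carrier S \<Longrightarrow> x \<in> points X \<Longrightarrow> \<pi> (\<sigma> g x) = \<rho> g (\<pi> x)"
    and u: "\<And>i. i \<in> {1..k} \<Longrightarrow> unipotent_subgroup S VS (u i)"
    and \<xi>: "\<And>i. i \<in> {1..k} \<Longrightarrow> locally_nilpotent X (\<xi> i)"
    and \<xi>_induced: "\<And>i. i \<in> {1..k} \<Longrightarrow> generated_by_action X (\<lambda>t. \<sigma> (u i t)) (\<xi> i)"
    and i: "\<And>i. i \<in> {1..k} \<Longrightarrow> locally_nilpotent B (\<xi>' i) \<and>
              (\<forall>f\<in>funs B. \<xi> i (pullback X \<pi> f) = pullback X \<pi> (\<xi>' i f))"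
    and ii: "\<And>i. i \<in> {1..k} \<Longrightarrow> \<xi>' i (\<alpha> i) = 0"
    and iii: "\<And>i. i \<in> {1..k} \<Longrightarrow> admits_slice_on B (\<alpha> i) (\<xi>' i)"
    and N: "N = field_span (funs X) (\<xi> ` {1..k})"
    and N_x: "\<And>x. x \<in> points X \<Longrightarrow>
              cfun_span (value_at x ` N) =
              cfun_span (value_at x ` {\<xi> j | j. j \<in> {1..k} \<and> \<alpha> j (\<pi> x) \<noteq> 0})"
    and \<omega>: "volume_form X \<omega>"
    and \<eta>: "locally_nilpotent X \<eta>" "\<eta> \<noteq> 0"
    and \<eta>_Ker: "\<And>f. f \<in> funs B \<Longrightarrow> \<eta> (pullback X \<pi> f) = 0"
    and \<eta>_generated: "\<And>f x. f \<in> funs X \<Longrightarrow> x \<in> points X \<Longrightarrow> \<alpha> 1 (\<pi> x) \<noteq> 0 \<Longrightarrow>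
              \<eta> f x = \<alpha> 1 (\<pi> x) ^ l *
                induced_fibre_field (principal_open X (pullback X \<pi> (\<alpha> 1))) Y (\<phi> 1) \<delta> f x"
  shows "\<exists>J. ideal_of X J \<and> J \<noteq> {0} \<and>
           form_submodule X (n - 2)
             {interior_product \<zeta> (interior_product \<eta> \<omega>) | \<zeta>. \<zeta> \<in> field_span J N} \<and>
           {interior_product \<zeta> (interior_product \<eta> \<omega>) | \<zeta>. \<zeta> \<in> field_span J N}
             \<subseteq> {\<tau> \<in> forms X (n - 2). ext_d X \<tau> \<in> Theta \<omega> ` Lie_alg X \<omega>}"
proof -
  interpret B: affine_var B by standard (rule B(1))
  interpret volume_var X \<omega>
    by unfold_locales (rule X(1), rule X(2), rule \<omega>)
  define I where "I = {1..k}"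
  have \<pi>: "regular_map X B \<pi>" using fibration by (simp add: zariski_locally_trivial_def)
  have \<pi>p: "\<pi> x \<in> points B" if "x \<in> points X" for x
    using \<pi> that unfolding regular_map_def by blast
  have \<pi>f: "pullback X \<pi> f \<in> funs X" if "f \<in> funs B" for f
    using \<pi> that unfolding regular_map_def by blast
  have \<eta>V: "\<eta> \<in> VF" using \<eta>(1) by (rule locally_nilpotent_VF)
  have \<pi>Ker: "pullback X \<pi> f \<in> Ker \<eta>" if "f \<in> funs B" for f
    using \<pi>f[OF that] \<eta>_Ker[OF that] by (rule KerI)
  have \<xi>'V: "\<xi>' j \<in> vector_fields B" if "j \<in> I" for j
    using i[of j] that by (simp add: locally_nilpotent_def I_def)
  have slice: "\<alpha> j \<in> funs B" "\<xi>' j (\<alpha> j) = 0" "admits_slice_on B (\<alpha> j) (\<xi>' j)" if "j \<in> I" for j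
    using that \<alpha> ii iii by (auto simp: I_def)
  have "\<exists>s\<in>funs B. \<exists>r. \<xi>' j s = \<alpha> j ^ Suc r" if "j \<in> I" for j
    by (rule B.slice_on_principal_open(1)[OF \<xi>'V[OF that] slice[OF that]])
  then obtain s r where s: "\<And>j. j \<in> I \<Longrightarrow> s j \<in> funs B" "\<And>j. j \<in> I \<Longrightarrow> \<xi>' j (s j) = \<alpha> j ^ Suc (r j)"
    by metis
  \<comment> \<open>A positive power of \<open>\<alpha> j\<close>, hence with the same zeros, that
    is the derivative of the slice \<open>s j\<close>.\<close>
  define q where "q j = \<alpha> j ^ r j * \<alpha> j" for j
  have q: "q j \<in> funs B" "\<xi>' j (s j) = q j" "\<xi>' j (q j) = 0" if "j \<in> I" for j
  proof -
    note \<alpha>j = slice(1,2)[OF that]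
    show "q j \<in> funs B" unfolding q_def by (intro B.funs_power_mult \<alpha>j)
    show "\<xi>' j (s j) = q j" using s(2)[OF that] by (simp add: q_def mult.commute)
    show "\<xi>' j (q j) = 0"
      unfolding q_def using B.vf_Ker_power_mult[OF \<xi>'V[OF that] B.KerI[of "\<alpha> j" "\<xi>' j"]] \<alpha>j by simp
  qed
  have q_apply: "q j b = \<alpha> j b ^ Suc (r j)" for j b
    by (simp add: q_def pointwise)
  have nz: "pullback X \<pi> (q j) \<noteq> 0" if "j \<in> I" for j
  proof -
    have "\<exists>b\<in>points B. \<alpha> j b \<noteq> 0"
      by (rule B.slice_on_principal_open(2)[OF \<xi>'V[OF that] slice[OF that]])
    then obtain b where b: "b \<in> points B" "\<alpha> j b \<noteq> 0" by blast
    interpret Y: affine_var Y by standard (rule Y)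
    obtain y where y: "y \<in> points Y" using Y.points_nonempty by blast
    have tr: "trivialization X B \<pi> Y (\<alpha> j) (\<phi> j)" using \<phi> that by (simp add: I_def)
    \<comment> \<open>The trivialization lifts a point of the base where \<open>\<alpha> j\<close>
      is nonzero, so the pullback does not become zero.\<close>
    have "(b, y) \<in> points (prod_variety (principal_open B (\<alpha> j)) Y)"
      using b y by (simp add: prod_variety_def principal_open_def)
    then have "(b, y) \<in> \<phi> j ` points (principal_open X (pullback X \<pi> (\<alpha> j)))"
      using tr unfolding trivialization_def variety_iso_def bij_betw_def by simp
    then obtain x where "x \<in> points X" "pullback X \<pi> (\<alpha> j) x \<noteq> 0"
      by (auto simp: principal_open_def)
    then have "pullback X \<pi> (q j) x \<noteq> 0" by (simp add: pullback_apply q_apply)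
    then show ?thesis by (auto simp: pointwise)
  qed
  have unit: "\<exists>c. (\<forall>j\<in>I. c j \<in> Ker \<eta>) \<and> (\<Sum>j\<in>I. c j * pullback X \<pi> (q j) ^ M) = one_of X" for M
  proof -
    \<comment> \<open>The Nullstellensatz is applied on \<open>B\<close> rather than on
      \<open>X\<close>, so that the coefficients are pulled back from \<open>B\<close> and
      annihilated by \<open>\<eta>\<close>.\<close>
    define J where "J = {\<Sum>j\<in>I. c j * q j ^ M | c. \<forall>j\<in>I. c j \<in> funs B}"
    have "one_of B \<in> J"
    proof (rule B.nullstellensatz)
      show "ideal_of B J"
        unfolding ideal_of_def
      proof (intro conjI ballI)
        show "J \<subseteq> funs B" unfolding J_def using q(1) by (auto intro!: B.funs_sum B.funs_mult_power)
        show "0 \<in> J" unfolding J_def by (intro CollectI exI[of _ "\<lambda>_. 0"]) simp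
        fix f g assume "f \<in> J" "g \<in> J"
        then obtain c d where "\<forall>j\<in>I. c j \<in> funs B" "\<forall>j\<in>I. d j \<in> funs B"
          "f = (\<Sum>j\<in>I. c j * q j ^ M)" "g = (\<Sum>j\<in>I. d j * q j ^ M)" unfolding J_def by blast
        then show "f + g \<in> J" unfolding J_def
          by (intro CollectI exI[of _ "\<lambda>j. c j + d j"]) (simp add: distrib_right sum.distrib)
      next
        fix f g assume f: "f \<in> funs B" and "g \<in> J"
        then obtain c where "\<forall>j\<in>I. c j \<in> funs B" "g = (\<Sum>j\<in>I. c j * q j ^ M)" unfolding J_def by blast
        then show "f * g \<in> J" unfolding J_def using f
          by (intro CollectI exI[of _ "\<lambda>j. f * c j"]) (simp add: sum_distrib_left mult.assoc)
      qed
      fix b assume b: "b \<in> points B"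
      then obtain j where j: "j \<in> I" "\<alpha> j b \<noteq> 0" using no_common_zeros unfolding I_def by blast
      have "(\<Sum>l\<in>I. (if l = j then one_of B else 0) * q l ^ M) = one_of B * q j ^ M"
        using j(1) by (simp add: if_distrib[of "\<lambda>f. f * _"] I_def cong: if_cong)
      then have "one_of B * q j ^ M \<in> J"
        unfolding J_def by (intro CollectI exI[of _ "\<lambda>l. if l = j then one_of B else 0"]) auto
      moreover have "(one_of B * q j ^ M) b \<noteq> 0" using b j(2) by (simp add: pointwise one_of_def q_apply)
      ultimately show "\<exists>f\<in>J. f b \<noteq> 0" by blast
    qed
    then obtain c where c: "\<And>j. j \<in> I \<Longrightarrow> c j \<in> funs B" "one_of B = (\<Sum>j\<in>I. c j * q j ^ M)"
      unfolding J_def by blast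
    have "(\<Sum>j\<in>I. pullback X \<pi> (c j) * pullback X \<pi> (q j) ^ M) = one_of X"
    proof
      fix x
      show "(\<Sum>j\<in>I. pullback X \<pi> (c j) * pullback X \<pi> (q j) ^ M) x = one_of X x"
      proof (cases "x \<in> points X")
        case True
        have "(\<Sum>j\<in>I. pullback X \<pi> (c j) * pullback X \<pi> (q j) ^ M) x = (\<Sum>j\<in>I. c j * q j ^ M) (\<pi> x)"
          using True by (simp add: pointwise pullback_apply)
        also have "\<dots> = 1" unfolding c(2)[symmetric] using \<pi>p[OF True] by (simp add: one_of_def)
        finally show ?thesis using True by (simp add: one_of_def)
      qed (simp add: pointwise pullback_apply one_of_def)
    qed
    then show ?thesis using c(1) \<pi>Ker by (intro exI[of _ "\<lambda>j. pullback X \<pi> (c j)"]) auto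
  qed
  have \<xi>_pullback: "\<xi> j (pullback X \<pi> f) = pullback X \<pi> (\<xi>' j f)" if "j \<in> I" "f \<in> funs B" for j f
    using i that by (simp add: I_def)
  have "\<exists>P\<in>funs X. P \<noteq> 0 \<and>
    (\<forall>j\<in>I. \<forall>y\<in>funs X. (\<lambda>vs. (P * y) * \<omega> (\<eta> # \<xi> j # vs)) \<in> exact_lie \<omega>)"
  proof (rule principal_ideal_exact[where s = "\<lambda>j. pullback X \<pi> (s j)" and a = "\<lambda>j. pullback X \<pi> (q j)"])
    fix j assume j: "j \<in> I"
    show "locally_nilpotent X (\<xi> j)" using \<xi> j by (simp add: I_def)
    show "\<xi> j (pullback X \<pi> (s j)) = pullback X \<pi> (q j)" using \<xi>_pullback[OF j s(1)[OF j]] q(2)[OF j] by simp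
    have "\<xi> j (pullback X \<pi> (q j)) = 0"
      unfolding \<xi>_pullback[OF j q(1)[OF j]] q(3)[OF j] by (rule ext) (simp add: pullback_apply pointwise)
    then show "pullback X \<pi> (q j) \<in> Ker (\<xi> j)" using \<pi>f[OF q(1)[OF j]] by (intro KerI)
  qed (use \<eta> \<pi>Ker s(1) q(1) nz unit in \<open>simp_all add: I_def\<close>)
  then obtain P where P: "P \<in> funs X" "P \<noteq> 0"
    "\<And>j y. j \<in> I \<Longrightarrow> y \<in> funs X \<Longrightarrow> (\<lambda>vs. (P * y) * \<omega> (\<eta> # \<xi> j # vs)) \<in> exact_lie \<omega>" by blast
  define J where "J = {P * y | y. y \<in> funs X}"
  have J: "ideal_of X J"
    unfolding ideal_of_def
  proof (intro conjI ballI)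
    show "J \<subseteq> funs X" using P(1) by (auto simp: J_def)
    show "0 \<in> J" unfolding J_def by (intro CollectI exI[of _ 0]) auto
    fix f g assume "f \<in> J" "g \<in> J"
    then obtain y y' where "f = P * y" "g = P * y'" "y \<in> funs X" "y' \<in> funs X" unfolding J_def by blast
    then show "f + g \<in> J" unfolding J_def by (intro CollectI exI[of _ "y + y'"]) (auto simp: distrib_left)
  next
    fix f g assume f: "f \<in> funs X" and "g \<in> J"
    then obtain y where "g = P * y" "y \<in> funs X" unfolding J_def by blast
    then show "f * g \<in> J" unfolding J_def using f by (intro CollectI exI[of _ "f * y"]) (auto simp: mult_ac)
  qed
  have Jsub: "J \<subseteq> funs X" using J by (rule ideal_ofD(1))
  have "P \<in> J" unfolding J_def using P(1) by (intro CollectI exI[of _ "one_of X"]) simp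
  then have J0: "J \<noteq> {0}" using P(2) by blast
  have \<xi>V: "\<xi> ` I \<subseteq> VF" using \<xi> locally_nilpotent_VF by (auto simp: I_def)
  have NV: "N \<subseteq> VF" unfolding N using field_span_VF[OF subset_refl \<xi>V] by (auto simp: I_def)
  \<comment> \<open>Keeping \<open>y\<close> arbitrary lets the coefficients of \<open>D\<close>
    with respect to the \<open>\<xi> j\<close> be moved into it.\<close>
  have N_exact: "(\<lambda>vs. (P * y) * \<omega> (\<eta> # D # vs)) \<in> exact_lie \<omega>" if "D \<in> N" "y \<in> funs X" for D y
    using that unfolding N I_def[symmetric]
  proof (induction arbitrary: y)
    case zero
    have "(\<lambda>vs. (P * y) * \<omega> (\<eta> # 0 # vs)) = 0" by (rule ext) (simp add: \<omega>_zero_second[OF \<eta>V])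
    then show ?case using exact_lie_zero[OF \<omega>_forms] by metis
  next
    case (add b D E)
    then obtain j where j: "j \<in> I" "D = \<xi> j" by blast
    have DV: "D \<in> VF" "E \<in> VF"
      using j \<xi>V field_span_VF[OF subset_refl \<xi>V add(3)] by auto
    have "(\<lambda>vs. (P * (y * b)) * \<omega> (\<eta> # D # vs)) + (\<lambda>vs. (P * y) * \<omega> (\<eta> # E # vs)) \<in> exact_lie \<omega>"
      using P(3)[OF j(1), of "y * b"] add j by (intro exact_lie_plus[OF \<omega>_forms]) auto
    also have "(\<lambda>vs. (P * (y * b)) * \<omega> (\<eta> # D # vs)) + (\<lambda>vs. (P * y) * \<omega> (\<eta> # E # vs)) =
      (\<lambda>vs. (P * y) * \<omega> (\<eta> # ((\<lambda>f. b * D f) + E) # vs))"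
      by (rule ext) (simp only: form_apply \<omega>_plus_second[OF vf_times[OF DV(1) add(1)] DV(2) \<eta>V]
          \<omega>_times_second[OF DV(1) add(1) \<eta>V] distrib_left mult.assoc)
    finally show ?case .
  qed
  let ?\<iota> = "\<lambda>\<zeta>. interior_product \<zeta> (interior_product \<eta> \<omega>)"
  have \<zeta>V: "\<zeta> \<in> VF" if "\<zeta> \<in> field_span J N" for \<zeta>
    using field_span_VF[OF Jsub NV that] .
  have exact: "?\<iota> \<zeta> \<in> exact_lie \<omega>" if "\<zeta> \<in> field_span J N" for \<zeta>
    using that
  proof induction
    case zero
    have "?\<iota> 0 = 0" by (rule ext) (simp add: \<omega>_zero_second[OF \<eta>V])
    then show ?case using exact_lie_zero[OF \<omega>_forms] by metis
  next
    case (add a D E)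
    then obtain y where y: "a = P * y" "y \<in> funs X" unfolding J_def by blast
    have DV: "D \<in> VF" "E \<in> VF" "a \<in> funs X"
      using subsetD[OF NV add(2)] \<zeta>V[OF add(3)] subsetD[OF Jsub add(1)] .
    have "?\<iota> ((\<lambda>f. a * D f) + E) = (\<lambda>vs. a * \<omega> (\<eta> # D # vs)) + ?\<iota> E"
      by (rule ext) (simp add: \<omega>_plus_second[OF vf_times[OF DV(1,3)] DV(2) \<eta>V]
          \<omega>_times_second[OF DV(1,3) \<eta>V])
    then show ?case
      using exact_lie_plus[OF \<omega>_forms N_exact[OF add(2) y(2)] add.IH] unfolding y(1)[symmetric] by (simp only:)
  qed
  have forms: "?\<iota> \<zeta> \<in> forms X (n - 2)" if "\<zeta> \<in> field_span J N" for \<zeta>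
    unfolding n by (rule interior_interior_forms[OF \<eta>V \<zeta>V[OF that]])
  have "form_submodule X (n - 2) {?\<iota> \<zeta> | \<zeta>. \<zeta> \<in> field_span J N}"
    unfolding form_submodule_def
  proof (intro conjI ballI)
    show "{?\<iota> \<zeta> | \<zeta>. \<zeta> \<in> field_span J N} \<subseteq> forms X (n - 2)" using forms by blast
    have "?\<iota> 0 = 0" by (rule ext) (simp add: \<omega>_zero_second[OF \<eta>V])
    then show "0 \<in> {?\<iota> \<zeta> | \<zeta>. \<zeta> \<in> field_span J N}"
      using field_span.zero[of J N] by (intro CollectI exI[of _ 0]) metis
    fix \<sigma> \<tau> assume "\<sigma> \<in> {?\<iota> \<zeta> | \<zeta>. \<zeta> \<in> field_span J N}" "\<tau> \<in> {?\<iota> \<zeta> | \<zeta>. \<zeta> \<in> field_span J N}"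
    then obtain D E where DE: "D \<in> field_span J N" "E \<in> field_span J N" "\<sigma> = ?\<iota> D" "\<tau> = ?\<iota> E" by blast
    have "\<sigma> + \<tau> = ?\<iota> (D + E)"
      unfolding DE(3,4) by (rule ext) (simp add: \<omega>_plus_second[OF \<zeta>V[OF DE(1)] \<zeta>V[OF DE(2)] \<eta>V])
    then show "\<sigma> + \<tau> \<in> {?\<iota> \<zeta> | \<zeta>. \<zeta> \<in> field_span J N}"
      using field_span_plus[OF DE(1,2)] by blast
  next
    fix a \<tau> assume a: "a \<in> funs X" and "\<tau> \<in> {?\<iota> \<zeta> | \<zeta>. \<zeta> \<in> field_span J N}"
    then obtain D where D: "D \<in> field_span J N" "\<tau> = ?\<iota> D" by blast
    have "(\<lambda>vs. a * \<tau> vs) = ?\<iota> (\<lambda>f. a * D f)"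
      unfolding D(2) by (rule ext) (simp add: \<omega>_times_second[OF \<zeta>V[OF D(1)] a \<eta>V])
    moreover have "(\<lambda>f. a * D f) \<in> field_span J N"
      using ideal_ofD(4)[OF J a] D(1) by (rule field_span_times)
    ultimately show "(\<lambda>vs. a * \<tau> vs) \<in> {?\<iota> \<zeta> | \<zeta>. \<zeta> \<in> field_span J N}" by blast
  qed
  moreover have "{?\<iota> \<zeta> | \<zeta>. \<zeta> \<in> field_span J N}
      \<subseteq> {\<tau> \<in> forms X (n - 2). ext_d X \<tau> \<in> Theta \<omega> ` Lie_alg X \<omega>}"
    using forms exact by (auto simp: exact_lie_def)
  ultimately show ?thesis using J J0 by blast
qed

end
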